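(* The problem Exact Matching in Red-Blue Bipartite Graphs is logspace reducible to the (decision version of the) Second Stage Recoverable Assignment Problem (2S-RecovAP).
   Context: Exact Matching in Red-Blue Bipartite Graphs: given a bipartite graph $G=(U\cup V,E)$, a subset $R\subseteq E$ of red edges and an integer $k$, decide whether $G$ has a perfect matching $M$ with $|M\cap R|=k$. 2S-RecovAP: given a bipartite graph $G$ (equivalently $K_{n,n}$ with cost $+\infty$ on non-edges) with a fixed perfect matching $M_1$, a cost function $c_2$ on the edges with values in $\mathbb{R}\cup\{+\infty\}$, and an integer $k$, find a perfect matching $M_2$ with $|M_1\cap M_2|\ge k$ minimizing $c_2(M_2)=\sum_{e\in M_2}c_2(e)$; the decision version additionally receives a bound $B$ and asks whether some such $M_2$ has $c_2(M_2)\le B$. *)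

theory Defs
  imports Complex_Main
begin

text \<open>Bipartite graph with sides U = {0..<m}, V = {0..<n}; an edge is a pair (u,v).\<close>

definition perfect_matching ::
  "nat \<Rightarrow> nat \<Rightarrow> (nat \<times> nat) set \<Rightarrow> (nat \<times> nat) set \<Rightarrow> bool" where
  "perfect_matching m n E M \<longleftrightarrow>
     M \<subseteq> E \<and>
     (\<forall>u<m. \<exists>!v. (u, v) \<in> M) \<and>
     (\<forall>v<n. \<exists>!u. (u, v) \<in> M)"

fun bits :: "nat \<Rightarrow> bool list" where
  "bits n = (if n = 0 then [] else (n mod 2 = 1) # bits (n div 2))"

text \<open>Self-delimiting binary code of a natural number.\<close>
definition enc_nat :: "nat \<Rightarrow> bool list" where
  "enc_nat n = concat (map (\<lambda>b. [True, b]) (bits n)) @ [False, False]"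

definition enc_int :: "int \<Rightarrow> bool list" where
  "enc_int i = enc_nat (if i < 0 then 1 else 0) @ enc_nat (nat \<bar>i\<bar>)"

definition enc_bool :: "bool \<Rightarrow> bool list" where
  "enc_bool b = enc_nat (if b then 1 else 0)"

definition enc_cost :: "int option \<Rightarrow> bool list" where
  "enc_cost c = (case c of None \<Rightarrow> enc_nat 0 | Some a \<Rightarrow> enc_nat 1 @ enc_int a)"

definition enc_EM ::
  "nat \<Rightarrow> nat \<Rightarrow> (nat \<times> nat) set \<Rightarrow> (nat \<times> nat) set \<Rightarrow> nat \<Rightarrow> bool list" where
  "enc_EM m n E R k =
     enc_nat m @ enc_nat n @ enc_nat k @
     concat [enc_bool ((i, j) \<in> E). i \<leftarrow> [0..<m], j \<leftarrow> [0..<n]] @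
     concat [enc_bool ((i, j) \<in> R). i \<leftarrow> [0..<m], j \<leftarrow> [0..<n]]"

definition ExactMatching :: "bool list set" where
  "ExactMatching =
     {enc_EM m n E R k | m n E R k.
        E \<subseteq> {..<m} \<times> {..<n} \<and> R \<subseteq> E \<and>
        (\<exists>M. perfect_matching m n E M \<and> card (M \<inter> R) = k)}"

text \<open>2S-RecovAP instance: K_{n,n} on {0..<n} x {0..<n}, cost c2 with None = +infinity
  (non-edges of G), first-stage perfect matching M1 of G, integer k and budget B.\<close>
definition enc_RA ::
  "nat \<Rightarrow> (nat \<times> nat) set \<Rightarrow> (nat \<Rightarrow> nat \<Rightarrow> int option) \<Rightarrow> nat \<Rightarrow> int \<Rightarrow> bool list" where
  "enc_RA n M1 c2 k B =
     enc_nat n @ enc_nat k @ enc_int B @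
     concat [enc_bool ((i, j) \<in> M1). i \<leftarrow> [0..<n], j \<leftarrow> [0..<n]] @
     concat [enc_cost (c2 i j). i \<leftarrow> [0..<n], j \<leftarrow> [0..<n]]"

definition RA_edges :: "nat \<Rightarrow> (nat \<Rightarrow> nat \<Rightarrow> int option) \<Rightarrow> (nat \<times> nat) set" where
  "RA_edges n c2 = {(i, j). i < n \<and> j < n \<and> c2 i j \<noteq> None}"

definition RecovAP_decision :: "bool list set" where
  "RecovAP_decision =
     {enc_RA n M1 c2 k B | n M1 c2 k B.
        (\<forall>i j. (n \<le> i \<or> n \<le> j) \<longrightarrow> c2 i j = None) \<and>
        perfect_matching n n (RA_edges n c2) M1 \<and>
        (\<exists>M2. perfect_matching n n (RA_edges n c2) M2 \<and>
              card (M1 \<inter> M2) \<ge> k \<and>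
              (\<Sum>(i, j)\<in>M2. the (c2 i j)) \<le> B)}"

text \<open>A deterministic machine with a read-only input tape (positions 1..|x| hold the input,
  positions 0 and |x|+1 are end markers read as None), one read/write work tape over the
  symbols {0..<syms} (0 = blank) and a write-only, append-only output tape.
  States are {0..<states}; 0 is the start state, 1 the halting state.
  The transition maps (state, input symbol, work symbol) to
  (new state, input head move, written work symbol, work head move, output symbol or none);
  moves are given by the sign of the integer.\<close>

datatype machine = Machine
  (m_states: nat) (m_syms: nat)
  (m_delta: "nat \<Rightarrow> bool option \<Rightarrow> nat \<Rightarrow> nat \<times> int \<times> nat \<times> int \<times> bool option")

definition wf_machine :: "machine \<Rightarrow> bool" where
  "wf_machine M \<longleftrightarrow> 2 \<le> m_states M \<and> 1 \<le> m_syms M \<and>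
     (\<forall>q a s. q < m_states M \<longrightarrow> s < m_syms M \<longrightarrow>
        (case m_delta M q a s of (q', di, s', dw, out) \<Rightarrow> q' < m_states M \<and> s' < m_syms M))"

type_synonym config = "nat \<times> nat \<times> (nat \<Rightarrow> nat) \<times> nat \<times> bool list"

definition inp :: "bool list \<Rightarrow> nat \<Rightarrow> bool option" where
  "inp x i = (if 1 \<le> i \<and> i \<le> length x then Some (x ! (i - 1)) else None)"

definition move :: "nat \<Rightarrow> int \<Rightarrow> nat" where
  "move p d = nat (int p + sgn d)"

definition step :: "machine \<Rightarrow> bool list \<Rightarrow> config \<Rightarrow> config" where
  "step M x cfg = (case cfg of (q, ih, w, wh, out) \<Rightarrow>
     if q = 1 then cfg
     else (case m_delta M q (inp x ih) (w wh) of (q', di, s', dw, ot) \<Rightarrow>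
       (q', min (length x + 1) (move ih di), w(wh := s'), move wh dw,
        out @ (case ot of None \<Rightarrow> [] | Some b \<Rightarrow> [b]))))"

definition init_config :: config where
  "init_config = (0, 0, \<lambda>_. 0, 0, [])"

definition run :: "machine \<Rightarrow> bool list \<Rightarrow> nat \<Rightarrow> config" where
  "run M x t = (step M x ^^ t) init_config"

definition cfg_state :: "config \<Rightarrow> nat" where
  "cfg_state cfg = fst cfg"

definition cfg_work_head :: "config \<Rightarrow> nat" where
  "cfg_work_head cfg = fst (snd (snd (snd cfg)))"

definition cfg_output :: "config \<Rightarrow> bool list" where
  "cfg_output cfg = snd (snd (snd (snd cfg)))"

definition computes :: "machine \<Rightarrow> (bool list \<Rightarrow> bool list) \<Rightarrow> bool" where
  "computes M f \<longleftrightarrow>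
     (\<forall>x. \<exists>t. cfg_state (run M x t) = 1 \<and> cfg_output (run M x t) = f x)"

definition logspace_bounded :: "machine \<Rightarrow> bool" where
  "logspace_bounded M \<longleftrightarrow>
     (\<exists>c::real. \<forall>x t. real (cfg_work_head (run M x t)) \<le> c * log 2 (real (length x) + 2))"

definition logspace_reducible :: "bool list set \<Rightarrow> bool list set \<Rightarrow> bool" where
  "logspace_reducible L1 L2 \<longleftrightarrow>
     (\<exists>M f. wf_machine M \<and> computes M f \<and> logspace_bounded M \<and>
            (\<forall>x. x \<in> L1 \<longleftrightarrow> f x \<in> L2))"

end

theory Submission
  imports Defs
begin

text \<open>
  Every vertex \<open>i\<close> of \<open>U\<close> is split into a red row, a blue row and an auxiliary row; one extra column
  absorbs whichever of the red and the blue row is not used, and a second one absorbs the auxiliary row.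
  The first-stage matching joins the blue row to the first extra column, so it meets a second-stage
  matching in exactly those \<open>i\<close> that are matched by a red edge; all its other edges are too expensive to
  be used. The intersection constraint thus forces at least \<open>k\<close> red edges, and since red edges cost 1
  the budget \<open>k\<close> allows at most \<open>k\<close> of them.

  The machine is compiled from a structured program over finitely many counters and the input head.
  All counters stay below \<open>3 * length x + 1\<close>, so that they fit in logarithmic space when kept as binary
  tracks of the work tape. The program never decodes a number from the input: it finds \<open>n\<close> by trying
  all candidates up to the input length and comparing their codes with the input, and it copies
  \<open>k\<close>, which may be too long for the work tape, directly to the output.
\<close>

section \<open>Second-stage matchings that count red edges\<close>

text \<open>The first-stage matching must consist of edges of finite cost, whatever \<open>E\<close>
  is. This is the purpose of the auxiliary row and its column: the red row is joined to the second
  extra column and the auxiliary row to the column of the vertex of \<open>V\<close>, by edges that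
  exist for every input but are priced out of the second stage. The blue row remains as the only
  place where the two matchings can meet. Any price above \<open>k\<close> would do;
  \<open>2 * k + 1\<close> has the advantage that its binary digits, least significant first, are a
  1 followed by the digits of \<open>k\<close>, so that it is written by copying, without arithmetic
  on a number that may not fit on the work tape.\<close>

lemma perfect_matching_graph:
  assumes "perfect_matching m n E M" "E \<subseteq> {..<m} \<times> {..<n}"
  obtains f where "bij_betw f {..<m} {..<n}" "M = (\<lambda>i. (i, f i)) ` {..<m}"
    "\<And>i. i < m \<Longrightarrow> (i, f i) \<in> E"
proof -
  define f where "f i = (THE j. (i, j) \<in> M)" for i
  have ME: "M \<subseteq> E" and l: "\<And>i. i < m \<Longrightarrow> \<exists>!j. (i, j) \<in> M" and r: "\<And>j. j < n \<Longrightarrow> \<exists>!i. (i, j) \<in> M"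
    using assms by (auto simp: perfect_matching_def)
  have f: "(i, j) \<in> M \<longleftrightarrow> j = f i" if "i < m" for i j
    using l[OF that] theI'[OF l[OF that]] unfolding f_def by blast
  have b: "i < m \<and> j < n" if "(i, j) \<in> M" for i j
    using that ME assms(2) by auto
  have "bij_betw f {..<m} {..<n}"
    unfolding bij_betw_def
  proof
    show "inj_on f {..<m}"
    proof (rule inj_onI)
      fix i i' assume "i \<in> {..<m}" "i' \<in> {..<m}" "f i = f i'"
      then have "(i, f i) \<in> M" "(i', f i) \<in> M" using f by auto
      with r b show "i = i'" by blast
    qed
    show "f ` {..<m} = {..<n}"
    proof
      show "f ` {..<m} \<subseteq> {..<n}" using b f by auto
      show "{..<n} \<subseteq> f ` {..<m}"
      proof
        fix j assume "j \<in> {..<n}"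
        then obtain i where "(i, j) \<in> M" using r by blast
        with b f show "j \<in> f ` {..<m}" by (metis imageI lessThan_iff)
      qed
    qed
  qed
  moreover have "M = (\<lambda>i. (i, f i)) ` {..<m}"
    using b f by auto (metis imageI lessThan_iff)
  moreover have "(i, f i) \<in> E" if "i < m" for i
    using f[OF that] ME by auto
  ultimately show ?thesis using that by blast
qed

lemma perfect_matching_of_bij:
  assumes "bij_betw h {..<n} {..<n}" "\<And>p. p < n \<Longrightarrow> (p, h p) \<in> E"
  shows "perfect_matching n n E ((\<lambda>p. (p, h p)) ` {..<n})"
proof -
  have "\<exists>!u. (u, v) \<in> (\<lambda>p. (p, h p)) ` {..<n}" if "v < n" for v
  proof -
    obtain u where "u < n" "h u = v"
      using assms(1) \<open>v < n\<close> unfolding bij_betw_def by (metis imageE lessThan_iff)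
    moreover have "u' = u" if "(u', v) \<in> (\<lambda>p. (p, h p)) ` {..<n}" for u'
      using that \<open>u < n\<close> \<open>h u = v\<close> assms(1) by (auto simp: bij_betw_def inj_on_def)
    ultimately show ?thesis by blast
  qed
  then show ?thesis using assms unfolding perfect_matching_def by auto
qed

text \<open>Pigeonhole: on a finite set injectivity gives surjectivity, so the bijections built
  below are checked without exhibiting preimages.\<close>

lemma bij_betw_lessThan:
  assumes "\<And>p. p < n \<Longrightarrow> h p < n" "\<And>p q. p < n \<Longrightarrow> q < n \<Longrightarrow> h p = h q \<Longrightarrow> p = q"
  shows "bij_betw h {..<n} {..<n::nat}"
proof -
  have "inj_on h {..<n}" using assms(2) by (auto simp: inj_on_def)
  moreover have "h ` {..<n} \<subseteq> {..<n}" using assms(1) by auto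
  ultimately show ?thesis using endo_inj_surj[of "{..<n}" h] by (simp add: bij_betw_def)
qed

text \<open>Vertex \<open>i\<close> of \<open>U\<close> becomes the rows \<open>3 * i\<close> (usable for a red edge),
  \<open>3 * i + 1\<close> (usable for a blue edge) and \<open>3 * i + 2\<close>; vertex \<open>j\<close> of \<open>V\<close> becomes column \<open>3 * j\<close>.
  Column \<open>3 * i + 1\<close> absorbs whichever of the first two rows is not used, so its edge in \<open>M\<^sub>1\<close>
  is present exactly if \<open>i\<close> is matched in red. The cost \<open>2 * k + 1\<close> exceeds the budget \<open>k\<close>.\<close>
definition cell_cost :: "(nat \<times> nat) set \<Rightarrow> (nat \<times> nat) set \<Rightarrow> nat \<Rightarrow> nat \<Rightarrow> nat \<Rightarrow> nat \<Rightarrow> nat \<Rightarrow> int option" where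
  "cell_cost E R k i a j b =
    (if b = 0 \<and> a = 0 then (if (i, j) \<in> R then Some 1 else None)
     else if b = 0 \<and> a = 1 then (if (i, j) \<in> E - R then Some 0 else None)
     else if b = 1 \<and> a \<noteq> 2 \<or> b = 2 \<and> a = 2 then (if i = j then Some 0 else None)
     else if a + b = 2 then (if i = j then Some (2 * int k + 1) else None)
     else None)"

definition ra_cost :: "nat \<Rightarrow> (nat \<times> nat) set \<Rightarrow> (nat \<times> nat) set \<Rightarrow> nat \<Rightarrow> nat \<Rightarrow> nat \<Rightarrow> int option" where
  "ra_cost n E R k p q =
    (if p < 3 * n \<and> q < 3 * n then cell_cost E R k (p div 3) (p mod 3) (q div 3) (q mod 3) else None)"

text \<open>Residues with sum 2 pair 0 with 2, 1 with 1 and 2 with 0: these are the antidiagonals of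
  the diagonal blocks of size three.\<close>

definition ra_matching :: "nat \<Rightarrow> (nat \<times> nat) set" where
  "ra_matching n = {(p, q). p < 3 * n \<and> q < 3 * n \<and> p div 3 = q div 3 \<and> p mod 3 + q mod 3 = 2}"

lemma mod3_cases: fixes p :: nat obtains i where "p = 3 * i" | i where "p = 3 * i + 1" | i where "p = 3 * i + 2"
proof -
  have "p = 3 * (p div 3) \<or> p = 3 * (p div 3) + 1 \<or> p = 3 * (p div 3) + 2" by presburger
  then show ?thesis using that by blast
qed

lemma div_mod_3 [simp]:
  "(3 * i + 1) div 3 = (i::nat)" "(3 * i + 1) mod 3 = (1::nat)" "(3 * i + 2) div 3 = i" "(3 * i + 2) mod 3 = (2::nat)"
  "Suc (3 * i) div 3 = i" "Suc (3 * i) mod 3 = Suc 0" "Suc (Suc (3 * i)) div 3 = i" "Suc (Suc (3 * i)) mod 3 = 2"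
  by presburger+

text \<open>Reversing every block of three is an involution, hence injective. Its edges cost 0 or
  \<open>2 * k + 1\<close> independently of \<open>E\<close> and \<open>R\<close>, so all of them
  are present.\<close>

lemma ra_matching_perfect: "perfect_matching (3 * n) (3 * n) (RA_edges (3 * n) (ra_cost n E R k)) (ra_matching n)"
proof -
  define h where "h p = 3 * (p div 3) + (2 - p mod 3)" for p :: nat
  have hh: "h (h p) = p" for p
    by (cases p rule: mod3_cases) (auto simp: h_def)
  have lt: "h p < 3 * n" if "p < 3 * n" for p
    using that by (cases p rule: mod3_cases) (auto simp: h_def)
  have "ra_matching n = (\<lambda>p. (p, h p)) ` {..<3 * n}"
  proof -
    have "p div 3 = q div 3 \<and> p mod 3 + q mod 3 = 2 \<longleftrightarrow> q = h p" for p q :: nat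
    proof
      assume "p div 3 = q div 3 \<and> p mod 3 + q mod 3 = 2"
      then show "q = h p" using mult_div_mod_eq[of 3 q] unfolding h_def by linarith
    next
      assume "q = h p"
      then show "p div 3 = q div 3 \<and> p mod 3 + q mod 3 = 2"
        by (cases p rule: mod3_cases) (auto simp: h_def)
    qed
    then show ?thesis using lt by (auto simp: ra_matching_def)
  qed
  moreover have "(p, h p) \<in> RA_edges (3 * n) (ra_cost n E R k)" if "p < 3 * n" for p
    using that lt[OF that]
    by (cases p rule: mod3_cases) (auto simp: RA_edges_def ra_cost_def cell_cost_def h_def)
  moreover have "bij_betw h {..<3 * n} {..<3 * n}"
    by (rule bij_betw_lessThan) (use lt in auto, metis hh)
  ultimately show ?thesis using perfect_matching_of_bij by metis
qed

lemma sum_lessThan_3: "(\<Sum>p<3 * n. g p) = (\<Sum>i<n. g (3 * i) + g (3 * i + 1) + g (3 * i + 2))"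
  for g :: "nat \<Rightarrow> 'a::comm_monoid_add"
proof (induction n)
  case (Suc n)
  have "{..<3 * Suc n} = insert (3 * n + 2) (insert (3 * n + 1) (insert (3 * n) {..<3 * n}))"
    by auto
  with Suc show ?case by (simp add: ac_simps)
qed simp

text \<open>The correspondence between a matching \<open>f\<close> of the given graph and a cheap
  matching \<open>h\<close> of the new one. One direction of the reduction constructs
  \<open>h\<close> from \<open>f\<close>, the other \<open>f\<close> from \<open>h\<close>; both
  then use the same counts.\<close>

locale matched_pair =
  fixes n k :: nat and E R :: "(nat \<times> nat) set" and f h :: "nat \<Rightarrow> nat" and red :: "nat \<Rightarrow> bool"
  assumes f_less: "\<And>i. i < n \<Longrightarrow> f i < n"
    and red: "\<And>i. i < n \<Longrightarrow> red i \<Longrightarrow> (i, f i) \<in> R \<and> h (3 * i) = 3 * f i \<and> h (3 * i + 1) = 3 * i + 1"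
    and blue: "\<And>i. i < n \<Longrightarrow> \<not> red i \<Longrightarrow>
      (i, f i) \<in> E - R \<and> h (3 * i) = 3 * i + 1 \<and> h (3 * i + 1) = 3 * f i"
    and rest: "\<And>i. i < n \<Longrightarrow> h (3 * i + 2) = 3 * i + 2"
begin

lemma card_red: "card ((\<lambda>i. (i, f i)) ` {..<n} \<inter> R) = card {i. i < n \<and> red i}"
proof -
  have "(\<lambda>i. (i, f i)) ` {..<n} \<inter> R = (\<lambda>i. (i, f i)) ` {i. i < n \<and> red i}"
    using red blue by auto
  then show ?thesis by (simp add: card_image inj_on_def)
qed

text \<open>An edge of \<open>ra_matching\<close> has residues with sum 2. \<open>h\<close> sends
  row \<open>3 * i\<close> to residue 0 or 1 and row \<open>3 * i + 2\<close> to residue 2, so these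
  never qualify; row \<open>3 * i + 1\<close> qualifies exactly if it takes column
  \<open>3 * i + 1\<close>, that is, if \<open>i\<close> is red.\<close>

lemma card_common: "card (ra_matching n \<inter> (\<lambda>p. (p, h p)) ` {..<3 * n}) = card {i. i < n \<and> red i}"
proof -
  have "p div 3 = h p div 3 \<and> p mod 3 + h p mod 3 = 2 \<longleftrightarrow> (\<exists>i. p = 3 * i + 1 \<and> red i)"
    if "p < 3 * n" for p
  proof (cases p rule: mod3_cases)
    case (1 i)
    then show ?thesis using that red[of i] blue[of i] by (cases "red i") (auto, presburger+)
  next
    case (2 i)
    then show ?thesis using that red[of i] blue[of i] by (cases "red i") auto
  next
    case (3 i)
    then show ?thesis using that rest[of i] by (auto, presburger)
  qed
  moreover have "h p < 3 * n" if "p < 3 * n" for p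
    using that by (cases p rule: mod3_cases; cases "red (p div 3)") (use red blue rest f_less in fastforce)+
  ultimately have "ra_matching n \<inter> (\<lambda>p. (p, h p)) ` {..<3 * n}
      = (\<lambda>p. (p, h p)) ` {p. p < 3 * n \<and> (\<exists>i. p = 3 * i + 1 \<and> red i)}"
    unfolding ra_matching_def by blast
  also have "{p. p < 3 * n \<and> (\<exists>i. p = 3 * i + 1 \<and> red i)} = (\<lambda>i. 3 * i + 1) ` {i. i < n \<and> red i}"
    by auto
  finally show ?thesis by (simp add: card_image inj_on_def image_image)
qed

text \<open>Among the cells that \<open>h\<close> uses, only those in a red row at the column of a
  vertex of \<open>V\<close> cost 1; all others cost 0.\<close>

lemma cost: "(\<Sum>(p, q)\<in>(\<lambda>p. (p, h p)) ` {..<3 * n}. the (ra_cost n E R k p q)) = int (card {i. i < n \<and> red i})"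
proof -
  have "(\<Sum>(p, q)\<in>(\<lambda>p. (p, h p)) ` {..<3 * n}. the (ra_cost n E R k p q))
      = (\<Sum>p<3 * n. the (ra_cost n E R k p (h p)))"
    by (subst sum.reindex) (auto simp: inj_on_def)
  also have "\<dots> = (\<Sum>i<n. if red i then 1 else 0)"
    unfolding sum_lessThan_3
  proof (rule sum.cong)
    fix i assume "i \<in> {..<n}"
    then show "the (ra_cost n E R k (3 * i) (h (3 * i))) + the (ra_cost n E R k (3 * i + 1) (h (3 * i + 1)))
        + the (ra_cost n E R k (3 * i + 2) (h (3 * i + 2))) = (if red i then 1 else 0)"
      using red[of i] blue[of i] rest[of i] f_less[of i]
      by (auto simp: ra_cost_def cell_cost_def)
  qed simp
  also have "\<dots> = int (card {i. i < n \<and> red i})"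
    by (simp add: sum.If_cases) (simp add: Int_def)
  finally show ?thesis .
qed

end

lemma exact_matching_imp_assignment:
  assumes "E \<subseteq> {..<n} \<times> {..<n}" "perfect_matching n n E M"
  shows "\<exists>M2. perfect_matching (3 * n) (3 * n) (RA_edges (3 * n) (ra_cost n E R (card (M \<inter> R)))) M2 \<and>
    card (M \<inter> R) \<le> card (ra_matching n \<inter> M2) \<and>
    (\<Sum>(i, j)\<in>M2. the (ra_cost n E R (card (M \<inter> R)) i j)) \<le> int (card (M \<inter> R))"
proof -
  obtain f where f: "bij_betw f {..<n} {..<n}" "M = (\<lambda>i. (i, f i)) ` {..<n}" "\<And>i. i < n \<Longrightarrow> (i, f i) \<in> E"
    by (rule perfect_matching_graph[OF assms(2,1)]) blast
  define red where "red i \<longleftrightarrow> (i, f i) \<in> R" for i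
  \<comment> \<open>The row whose colour agrees with the edge at its vertex takes the column of the
    partner; the row of the other colour goes to the absorbing column
    \<open>3 * i + 1\<close>.\<close>
  define h where "h p = (if p mod 3 = 2 then p else if (p mod 3 = 0) = red (p div 3) then 3 * f (p div 3)
     else 3 * (p div 3) + 1)" for p
  have lt: "f i < n" if "i < n" for i using f(3)[OF that] assms(1) by auto
  interpret matched_pair n k E R f h red for k
    by unfold_locales (use lt f(3) in \<open>auto simp: h_def red_def\<close>)
  have "bij_betw h {..<3 * n} {..<3 * n}"
  proof (rule bij_betw_lessThan)
    fix p assume "p < 3 * n"
    then have "p div 3 < n" "3 * (p div 3) + 1 < 3 * n \<or> p mod 3 = 2" by presburger+
    then show "h p < 3 * n"
      using lt[of "p div 3"] \<open>p < 3 * n\<close> by (auto simp: h_def)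
  next
    fix p q assume pq: "p < 3 * n" "q < 3 * n" "h p = h q"
    have inj: "f i = f j \<longleftrightarrow> i = j" if "i < n" "j < n" for i j
      using f(1) that by (auto simp: bij_betw_def inj_on_def)
    have "3 * i \<noteq> Suc (3 * j)" "3 * i \<noteq> Suc (Suc (3 * j))" "Suc (3 * i) \<noteq> 3 * j"
      "Suc (Suc (3 * i)) \<noteq> 3 * j" "Suc (3 * i) \<noteq> Suc (Suc (3 * j))" for i j
      by presburger+
    then show "p = q" using pq
      by (cases p rule: mod3_cases; cases q rule: mod3_cases) (auto simp: h_def inj split: if_splits)
  qed
  moreover have "(p, h p) \<in> RA_edges (3 * n) (ra_cost n E R (card (M \<inter> R)))" if "p < 3 * n" for p
    using that lt[of "p div 3"] f(3)[of "p div 3"]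
    by (cases p rule: mod3_cases) (auto simp: RA_edges_def ra_cost_def cell_cost_def h_def red_def)
  ultimately show ?thesis
    using card_red card_common cost perfect_matching_of_bij f(2)
    by (intro exI[of _ "(\<lambda>p. (p, h p)) ` {..<3 * n}"]) auto
qed

text \<open>Nonnegative costs turn a bound on the total cost into a bound on every single
  edge.\<close>

lemma ra_cost_nonneg: "ra_cost n E R k p q = Some c \<Longrightarrow> 0 \<le> c"
  by (auto simp: ra_cost_def cell_cost_def split: if_splits)

text \<open>The budget excludes the edges of cost \<open>2 * k + 1\<close>, which fixes the
  auxiliary rows at their own columns. Column \<open>3 * i + 1\<close> can then be reached only from
  the red and the blue row of \<open>i\<close>, so exactly one of the two is absorbed and the other
  names the partner of \<open>i\<close>. The number of red vertices is both the size of the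
  intersection, at least \<open>k\<close>, and the cost, at most \<open>k\<close>.\<close>

lemma assignment_imp_exact_matching:
  assumes "R \<subseteq> E" "E \<subseteq> {..<n} \<times> {..<n}"
    and M2: "perfect_matching (3 * n) (3 * n) (RA_edges (3 * n) (ra_cost n E R k)) M2"
    and common: "k \<le> card (ra_matching n \<inter> M2)"
    and cheap: "(\<Sum>(i, j)\<in>M2. the (ra_cost n E R k i j)) \<le> int k"
  shows "\<exists>M. perfect_matching n n E M \<and> card (M \<inter> R) = k"
proof -
  obtain h where h: "bij_betw h {..<3 * n} {..<3 * n}" "M2 = (\<lambda>p. (p, h p)) ` {..<3 * n}"
      "\<And>p. p < 3 * n \<Longrightarrow> (p, h p) \<in> RA_edges (3 * n) (ra_cost n E R k)"
    using perfect_matching_graph[OF M2] by (auto simp: RA_edges_def)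
  define c where "c p = the (ra_cost n E R k p (h p))" for p
  have some: "ra_cost n E R k p (h p) = Some (c p)" if "p < 3 * n" for p
    using h(3)[OF that] by (auto simp: RA_edges_def c_def)
  have "(\<Sum>p<3 * n. c p) \<le> int k"
    using cheap unfolding h(2) by (subst (asm) sum.reindex) (auto simp: inj_on_def c_def)
  \<comment> \<open>No other edge can compensate for an expensive one, because no cost is
    negative.\<close>
  moreover have "c p \<le> (\<Sum>p<3 * n. c p)" if "p < 3 * n" for p
    by (rule member_le_sum) (use that ra_cost_nonneg[OF some] in auto)
  ultimately have ck: "c p \<le> int k" if "p < 3 * n" for p
    using that by fastforce
  have inj: "p = q" if "h p = h q" "p < 3 * n" "q < 3 * n" for p q
    using h(1) that by (auto simp: bij_betw_def inj_on_def)
  have lt: "h p < 3 * n" if "p < 3 * n" for p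
    using h(3)[OF that] by (auto simp: RA_edges_def)
  have h2: "h (3 * i + 2) = 3 * i + 2" if "i < n" for i
    using some[of "3 * i + 2"] ck[of "3 * i + 2"] that
    by (cases "h (3 * i + 2)" rule: mod3_cases) (auto simp: ra_cost_def cell_cost_def split: if_splits)
  have h0: "h (3 * i) = 3 * i + 1 \<or> (\<exists>j. h (3 * i) = 3 * j \<and> (i, j) \<in> R)" if "i < n" for i
    using some[of "3 * i"] ck[of "3 * i"] that
    by (cases "h (3 * i)" rule: mod3_cases) (auto simp: ra_cost_def cell_cost_def split: if_splits)
  have h1: "h (3 * i + 1) = 3 * i + 1 \<or> (\<exists>j. h (3 * i + 1) = 3 * j \<and> (i, j) \<in> E - R)" if "i < n" for i
    using some[of "3 * i + 1"] ck[of "3 * i + 1"] that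
    by (cases "h (3 * i + 1)" rule: mod3_cases) (auto simp: ra_cost_def cell_cost_def split: if_splits)
  have not_both: "\<not> (h (3 * i) = 3 * i + 1 \<and> h (3 * i + 1) = 3 * i + 1)" if "i < n" for i
    using inj[of "3 * i" "3 * i + 1"] that by auto
  have one: "h (3 * i) = 3 * i + 1 \<or> h (3 * i + 1) = 3 * i + 1" if "i < n" for i
  proof -
    \<comment> \<open>The column is covered by some row, and only the rows \<open>3 * i\<close> and
      \<open>3 * i + 1\<close> have finite cost there.\<close>
    have "3 * i + 1 \<in> h ` {..<3 * n}" using h(1) that by (auto simp: bij_betw_def)
    then obtain p where p: "p < 3 * n" "h p = 3 * i + 1" by auto
    have "p = 3 * i \<or> p = 3 * i + 1"
      using some[of p] p
      by (cases p rule: mod3_cases) (auto simp: ra_cost_def cell_cost_def split: if_splits)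
    with p show ?thesis by auto
  qed
  define red where "red i \<longleftrightarrow> h (3 * i + 1) = 3 * i + 1" for i
  define f where "f i = (if red i then h (3 * i) else h (3 * i + 1)) div 3" for i
  interpret matched_pair n k E R f h red
  proof
    fix i assume i: "i < n"
    show "f i < n" using lt[of "3 * i"] lt[of "3 * i + 1"] i by (auto simp: f_def)
    show "(i, f i) \<in> R \<and> h (3 * i) = 3 * f i \<and> h (3 * i + 1) = 3 * i + 1" if "red i"
      using h0[OF i] not_both[OF i] that by (auto simp: red_def f_def)
    show "(i, f i) \<in> E - R \<and> h (3 * i) = 3 * i + 1 \<and> h (3 * i + 1) = 3 * f i" if "\<not> red i"
      using h1[OF i] one[OF i] that by (auto simp: red_def f_def)
    show "h (3 * i + 2) = 3 * i + 2" using h2[OF i] .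
  qed
  have "bij_betw f {..<n} {..<n}"
  proof (rule bij_betw_lessThan)
    fix i j assume ij: "i < n" "j < n" "f i = f j"
    \<comment> \<open>\<open>p i\<close> is the row that carries the edge at \<open>i\<close>. It
      lies over column \<open>3 * f i\<close>, so injectivity of \<open>h\<close> passes to
      \<open>f\<close>.\<close>
    define p where "p i = (if red i then 3 * i else 3 * i + 1)" for i
    have "h (p i) = 3 * f i" if "i < n" for i
      using red[OF that] blue[OF that] by (auto simp: p_def)
    then have "p i = p j" using ij by - (rule inj, auto simp: p_def)
    moreover have "p i div 3 = i" for i by (auto simp: p_def)
    ultimately show "i = j" by metis
  qed (rule f_less)
  moreover have "(i, f i) \<in> E" if "i < n" for i
    using red[OF that] blue[OF that] \<open>R \<subseteq> E\<close> by auto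
  ultimately have "perfect_matching n n E ((\<lambda>i. (i, f i)) ` {..<n})"
    by (rule perfect_matching_of_bij)
  moreover have "card ((\<lambda>i. (i, f i)) ` {..<n} \<inter> R) = k"
    using card_red card_common cost common cheap unfolding h(2) by auto
  ultimately show ?thesis by blast
qed

section \<open>Encodings\<close>

declare bits.simps [simp del]

lemma bits_0 [simp]: "bits 0 = []"
  by (simp add: bits.simps)

lemma bits_pos: "0 < n \<Longrightarrow> bits n = odd n # bits (n div 2)"
  by (simp add: bits.simps[of n] odd_iff_mod_2_eq_one)

lemma bits_inj: "bits m = bits n \<Longrightarrow> m = n"
proof (induction m arbitrary: n rule: less_induct)
  case (less m)
  show ?case
  proof (cases "m = 0 \<or> n = 0")
    case True
    with less.prems show ?thesis by (cases m; cases n) (auto simp: bits_pos)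
  next
    case False
    with less.prems less.IH[of "m div 2" "n div 2"] have "m div 2 = n div 2" "odd m = odd n"
      by (auto simp: bits_pos)
    then show ?thesis by presburger
  qed
qed

lemma last_bits: "bits n = [] \<or> last (bits n)"
proof (induction n rule: less_induct)
  case (less n)
  show ?case
  proof (cases "n = 0")
    case False
    with less[of "n div 2"] show ?thesis
      by (cases "n div 2 = 0") (auto simp: bits_pos)
  qed simp
qed

text \<open>Digits are listed with the least significant first, so the last one is the leading
  digit. With \<open>last_bits\<close> this describes the canonical digit lists, and a code can be
  checked for canonicity without computing its value.\<close>

lemma bits_surj: "bs = [] \<or> last bs \<Longrightarrow> \<exists>n. bits n = bs"
proof (induction bs)
  case (Cons b bs)
  then obtain n where n: "bits n = bs" by (cases bs) auto
  have "bits (2 * n + of_bool b) = b # bs"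
    using n Cons(2) by (cases n) (auto simp: bits_pos bits.simps)
  then show ?case ..
qed (auto intro: exI[of _ 0])

text \<open>A marker \<open>True\<close> announces one more bit and a marker \<open>False\<close>
  the end, so both words are split in the same way from the left.\<close>

lemma bit_pairs_inj:
  "concat (map (\<lambda>b. [True, b]) bs) @ False # r = concat (map (\<lambda>b. [True, b]) bs') @ False # r' \<longleftrightarrow> bs = bs' \<and> r = r'"
proof (induction bs arbitrary: bs')
  case Nil
  then show ?case by (cases bs') auto
next
  case (Cons b bs)
  then show ?case by (cases bs') auto
qed

text \<open>Stated with arbitrary remainders and as an equivalence, so that equations between
  concatenated codes are taken apart from the left by rewriting. Injectivity is included.\<close>

definition prefix_free :: "('a \<Rightarrow> bool list) \<Rightarrow> bool" where
  "prefix_free e \<longleftrightarrow> (\<forall>a b r s. e a @ r = e b @ s \<longleftrightarrow> a = b \<and> r = s)"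

lemma prefix_freeD: "prefix_free e \<Longrightarrow> e a @ r = e b @ s \<longleftrightarrow> a = b \<and> r = s"
  by (simp add: prefix_free_def)

lemma prefix_free_enc_nat: "prefix_free enc_nat"
  using bits_inj by (auto simp: prefix_free_def enc_nat_def bit_pairs_inj)

lemma prefix_free_enc_bool: "prefix_free enc_bool"
  using prefix_free_enc_nat by (auto simp: prefix_free_def enc_bool_def)

lemma prefix_free_enc_int: "prefix_free enc_int"
  unfolding prefix_free_def enc_int_def
  by (auto simp: prefix_freeD[OF prefix_free_enc_nat] split: if_splits)

lemma prefix_free_enc_cost: "prefix_free enc_cost"
  using prefix_freeD[OF prefix_free_enc_nat] prefix_freeD[OF prefix_free_enc_int]
  by (auto simp: prefix_free_def enc_cost_def split: option.splits)

text \<open>A sequence of codes has no end mark of its own; what aligns the remainders is the common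
  length, which comes from the dimension in the header.\<close>

lemma concat_prefix_free:
  assumes "prefix_free e" "length xs = length ys"
  shows "concat (map e xs) @ r = concat (map e ys) @ s \<longleftrightarrow> xs = ys \<and> r = s"
  using assms(2) by (induction rule: list_induct2) (auto simp: prefix_freeD[OF assms(1)])

definition grid :: "nat \<Rightarrow> nat \<Rightarrow> (nat \<Rightarrow> nat \<Rightarrow> 'a) \<Rightarrow> 'a list" where
  "grid m n g = concat (map (\<lambda>i. map (g i) [0..<n]) [0..<m])"

lemma grid_Suc: "grid (Suc m) n g = grid m n g @ map (g m) [0..<n]"
  by (simp add: grid_def)

lemma length_grid [simp]: "length (grid m n g) = m * n"
  by (induction m) (auto simp: grid_Suc grid_def)

lemma grid_nth: "i < m \<Longrightarrow> j < n \<Longrightarrow> grid m n g ! (i * n + j) = g i j"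
proof (induction m)
  case (Suc m)
  then show ?case
  proof (cases "i = m")
    case False
    then have "i < m" using Suc by simp
    then have "Suc i * n \<le> m * n" by (intro mult_le_mono1) simp
    with Suc \<open>i < m\<close> show ?thesis by (simp add: grid_Suc nth_append)
  qed (auto simp: grid_Suc nth_append)
qed simp

lemma grid_eq_iff: "grid m n g = grid m n g' \<longleftrightarrow> (\<forall>i<m. \<forall>j<n. g i j = g' i j)"
proof
  assume "grid m n g = grid m n g'"
  then show "\<forall>i<m. \<forall>j<n. g i j = g' i j" using grid_nth by metis
next
  assume "\<forall>i<m. \<forall>j<n. g i j = g' i j"
  then show "grid m n g = grid m n g'"
    unfolding grid_def by (intro arg_cong[where f = concat] map_cong) auto
qed

lemma concat_grid: "concat (grid m n (\<lambda>i j. e (g i j))) = concat (map e (grid m n g))"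
  by (simp add: grid_def map_concat comp_def)

lemma enc_EM_grid:
  "enc_EM m n E R k = enc_nat m @ enc_nat n @ enc_nat k @
    concat (map enc_bool (grid m n (\<lambda>i j. (i, j) \<in> E))) @ concat (map enc_bool (grid m n (\<lambda>i j. (i, j) \<in> R)))"
  by (simp add: enc_EM_def concat_grid[symmetric]) (simp add: grid_def)

lemma enc_RA_grid:
  "enc_RA n M1 c2 k B = enc_nat n @ enc_nat k @ enc_int B @
    concat (map enc_bool (grid n n (\<lambda>i j. (i, j) \<in> M1))) @ concat (map enc_cost (grid n n c2))"
  by (simp add: enc_RA_def concat_grid[symmetric]) (simp add: grid_def)

text \<open>Membership in \<open>RecovAP_decision\<close> only yields some instance with the given
  code; injectivity identifies it with the constructed one. The code lists the cells of the square
  only, hence the hypotheses on what lies outside.\<close>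

lemma enc_RA_inj:
  assumes "enc_RA n M1 c2 k B = enc_RA n' M1' c2' k' B'"
    and "M1 \<subseteq> {..<n} \<times> {..<n}" "M1' \<subseteq> {..<n'} \<times> {..<n'}"
    and "\<And>i j. n \<le> i \<or> n \<le> j \<Longrightarrow> c2 i j = None" "\<And>i j. n' \<le> i \<or> n' \<le> j \<Longrightarrow> c2' i j = None"
  shows "n = n' \<and> M1 = M1' \<and> c2 = c2' \<and> k = k' \<and> B = B'"
proof -
  have 1: "n = n'" "k = k'" "B = B'" and
    2: "concat (map enc_bool (grid n n (\<lambda>i j. (i, j) \<in> M1))) @ concat (map enc_cost (grid n n c2)) =
        concat (map enc_bool (grid n n (\<lambda>i j. (i, j) \<in> M1'))) @ concat (map enc_cost (grid n n c2'))"
    using assms(1) unfolding enc_RA_grid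
    by (auto simp: prefix_freeD[OF prefix_free_enc_nat] prefix_freeD[OF prefix_free_enc_int])
  from 2 have "grid n n (\<lambda>i j. (i, j) \<in> M1) = grid n n (\<lambda>i j. (i, j) \<in> M1')" "grid n n c2 = grid n n c2'"
    using concat_prefix_free[OF prefix_free_enc_cost, of "grid n n c2" "grid n n c2'" "[]" "[]"]
    by (auto simp: concat_prefix_free[OF prefix_free_enc_bool])
  then have "\<forall>i<n. \<forall>j<n. (i, j) \<in> M1 \<longleftrightarrow> (i, j) \<in> M1'" "\<forall>i<n. \<forall>j<n. c2 i j = c2' i j"
    by (auto simp: grid_eq_iff)
  then have "M1 = M1'" "c2 i j = c2' i j" for i j
    using assms(2-) 1 by (auto, metis not_le)
  then show ?thesis using 1 by blast
qed

lemma enc_bool_simps: "enc_bool True = [True, True, False, False]" "enc_bool False = [False, False]"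
  by (simp_all add: enc_bool_def enc_nat_def bits.simps)

section \<open>Languages of the part of the input that is still to be read\<close>

definition bool_rows :: "nat \<Rightarrow> bool list set \<Rightarrow> bool list set" where
  "bool_rows m A = {concat (map enc_bool bs) @ w | bs w. length bs = m \<and> w \<in> A}"

lemma bool_rows_0 [simp]: "bool_rows 0 A = A"
  by (auto simp: bool_rows_def)

lemma bool_rows_Suc: "bool_rows (Suc m) A = {enc_bool b @ w | b w. w \<in> bool_rows m A}"
proof -
  have "concat (map enc_bool bs) @ w \<in> {enc_bool b @ w | b w. w \<in> bool_rows m A}" if "length bs = Suc m" "w \<in> A" for bs w
    using that by (cases bs) (auto simp: bool_rows_def)
  moreover have "enc_bool b @ concat (map enc_bool bs) @ w \<in> bool_rows (Suc m) A" if "length bs = m" "w \<in> A" for b bs w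
    unfolding bool_rows_def mem_Collect_eq
    by (rule exI[of _ "b # bs"], rule exI[of _ w]) (use that in simp)
  ultimately show ?thesis unfolding bool_rows_def by blast
qed

text \<open>The rest of a canonical code, when the bit just read was \<open>b\<close>.\<close>
definition code_rest :: "bool \<Rightarrow> bool list set \<Rightarrow> bool list set" where
  "code_rest b A = {concat (map (\<lambda>b. [True, b]) bs) @ False # False # w | bs w. last (b # bs) \<and> w \<in> A}"

text \<open>The start value \<open>True\<close> acts like a digit 1 read before: it lets the empty
  digit list pass, which is the code of 0, while a nonempty list still has to end in
  \<open>True\<close>.\<close>

lemma code_rest_True: "code_rest True A = {enc_nat k @ w | k w. w \<in> A}"
proof -
  have ex: "last (True # bs) \<longleftrightarrow> (\<exists>k. bits k = bs)" for bs
  proof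
    assume "last (True # bs)"
    then show "\<exists>k. bits k = bs" using bits_surj[of bs] by (simp split: if_splits)
  next
    assume "\<exists>k. bits k = bs"
    then obtain k where "bits k = bs" ..
    with last_bits[of k] show "last (True # bs)" by auto
  qed
  have "code_rest True A = {concat (map (\<lambda>b. [True, b]) (bits k)) @ False # False # w | k w. w \<in> A}"
    unfolding code_rest_def ex by blast
  then show ?thesis by (simp add: enc_nat_def)
qed

lemma code_rest_simps:
  "[] \<notin> code_rest b A" "[True] \<notin> code_rest b A"
  "True # c # w \<in> code_rest b A \<longleftrightarrow> w \<in> code_rest c A"
  "False # w \<in> code_rest b A \<longleftrightarrow> b \<and> False # w \<in> (#) False ` (#) False ` A"
proof -
  let ?w = "\<lambda>bs w. concat (map (\<lambda>b. [True, b]) bs) @ False # False # w"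
  have cases: "P" if "w \<in> code_rest b A"
      "\<And>w'. w = False # False # w' \<Longrightarrow> b \<Longrightarrow> w' \<in> A \<Longrightarrow> P"
      "\<And>c bs w'. w = True # c # ?w bs w' \<Longrightarrow> last (c # bs) \<Longrightarrow> w' \<in> A \<Longrightarrow> P" for w b P
  proof -
    from that(1) obtain bs w' where *: "w = ?w bs w'" "last (b # bs)" "w' \<in> A"
      unfolding code_rest_def by blast
    show P
      by (cases bs) (use * that(2,3) in auto)
  qed
  have intro: "?w bs w \<in> code_rest b A" if "last (b # bs)" "w \<in> A" for b bs w
    unfolding code_rest_def mem_Collect_eq
    by (rule exI[of _ bs], rule exI[of _ w]) (use that in simp)
  show "[] \<notin> code_rest b A" "[True] \<notin> code_rest b A"
    by (auto elim: cases)
  show "True # c # w \<in> code_rest b A \<longleftrightarrow> w \<in> code_rest c A"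
  proof
    assume "True # c # w \<in> code_rest b A"
    then show "w \<in> code_rest c A" by (rule cases) (use intro in auto)
  next
    assume "w \<in> code_rest c A"
    then obtain bs w' where "w = ?w bs w'" "last (c # bs)" "w' \<in> A"
      unfolding code_rest_def by blast
    then show "True # c # w \<in> code_rest b A"
      using intro[of b "c # bs" w'] by simp
  qed
  show "False # w \<in> code_rest b A \<longleftrightarrow> b \<and> False # w \<in> (#) False ` (#) False ` A"
  proof
    assume "False # w \<in> code_rest b A"
    then show "b \<and> False # w \<in> (#) False ` (#) False ` A" by (rule cases) auto
  next
    assume "b \<and> False # w \<in> (#) False ` (#) False ` A"
    then show "False # w \<in> code_rest b A" using intro[of b "[]"] by auto
  qed
qed

lemma grid_nth_eq: "length bs = m * n \<Longrightarrow> grid m n (\<lambda>i j. bs ! (i * n + j)) = bs"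
proof (rule nth_equalityI)
  fix t assume "t < length (grid m n (\<lambda>i j. bs ! (i * n + j)))"
  then have t: "t < m * n" by simp
  then have "0 < n" by (cases n) auto
  with t have "t div n < m" "t mod n < n" by (auto simp: less_mult_imp_div_less)
  from grid_nth[OF this, of "\<lambda>i j. bs ! (i * n + j)"]
  show "grid m n (\<lambda>i j. bs ! (i * n + j)) ! t = bs ! t" by simp
qed simp

text \<open>Matches the output loops, which treat three rows or columns of one vertex per turn, with
  a single enumeration of all \<open>3 * n\<close> indices.\<close>

lemma concat_map_upt_3: "concat (map f [0..<3 * n]) = concat (map (\<lambda>i. f (3 * i) @ f (3 * i + 1) @ f (3 * i + 2)) [0..<n])"
proof (induction n)
  case (Suc n)
  have "3 * Suc n = Suc (Suc (Suc (3 * n)))" by simp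
  then have "[0..<3 * Suc n] = [0..<3 * n] @ [3 * n, 3 * n + 1, 3 * n + 2]"
    by (simp only: upt_Suc) simp
  with Suc show ?case by simp
qed simp

text \<open>The edge matrix alone has at least \<open>n * n \<ge> n\<close> symbols and the header
  makes the inequality strict. Hence the dimension of a square instance is found among the numbers
  below the input length.\<close>

lemma less_length_enc_EM: "n < length (enc_EM n n E R k)"
proof -
  have *: "2 \<le> length (enc_nat i)" for i by (simp add: enc_nat_def)
  have l: "length bs \<le> length (concat (map enc_bool bs))" for bs
  proof (induction bs)
    case (Cons b bs)
    have "2 \<le> length (enc_bool b)" using * by (simp add: enc_bool_def)
    with Cons show ?case by simp
  qed simp
  have "n \<le> n * n" by simp
  also have "\<dots> \<le> length (concat (map enc_bool (grid n n (\<lambda>i j. (i, j) \<in> E))))"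
    using l[of "grid n n (\<lambda>i j. (i, j) \<in> E)"] by simp
  finally show ?thesis using *[of n] unfolding enc_EM_grid by simp
qed

text \<open>Only square instances are translated. Sides of different size admit no perfect matching,
  so such inputs share the output \<open>[]\<close> with malformed words; \<open>[]\<close> is not
  the code of any instance.\<close>

definition reduces_to :: "bool list \<Rightarrow> bool list \<Rightarrow> bool" where
  "reduces_to x y \<longleftrightarrow>
    (\<exists>n E R k. E \<subseteq> {..<n} \<times> {..<n} \<and> R \<subseteq> E \<and> x = enc_EM n n E R k \<and>
       y = enc_RA (3 * n) (ra_matching n) (ra_cost n E R k) k (int k)) \<or>
    (\<nexists>n E R k. E \<subseteq> {..<n} \<times> {..<n} \<and> R \<subseteq> E \<and> x = enc_EM n n E R k) \<and> y = []"

lemma enc_EM_inj: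
  assumes "enc_EM n n E R k = enc_EM n' n' E' R' k'"
    and "E \<subseteq> {..<n} \<times> {..<n}" "R \<subseteq> E" "E' \<subseteq> {..<n'} \<times> {..<n'}" "R' \<subseteq> E'"
  shows "n = n' \<and> E = E' \<and> R = R' \<and> k = k'"
proof -
  have 1: "n = n'" "k = k'" and
    2: "concat (map enc_bool (grid n n (\<lambda>i j. (i, j) \<in> E))) @ concat (map enc_bool (grid n n (\<lambda>i j. (i, j) \<in> R))) =
        concat (map enc_bool (grid n n (\<lambda>i j. (i, j) \<in> E'))) @ concat (map enc_bool (grid n n (\<lambda>i j. (i, j) \<in> R')))"
    using assms(1) unfolding enc_EM_grid
    by (auto simp: prefix_freeD[OF prefix_free_enc_nat])
  from 2 have "grid n n (\<lambda>i j. (i, j) \<in> E) = grid n n (\<lambda>i j. (i, j) \<in> E')"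
    "grid n n (\<lambda>i j. (i, j) \<in> R) = grid n n (\<lambda>i j. (i, j) \<in> R')"
    using concat_prefix_free[OF prefix_free_enc_bool, of "grid n n (\<lambda>i j. (i, j) \<in> R)" "grid n n (\<lambda>i j. (i, j) \<in> R')" "[]" "[]"]
    by (auto simp: concat_prefix_free[OF prefix_free_enc_bool])
  then have "\<forall>i<n. \<forall>j<n. (i, j) \<in> E \<longleftrightarrow> (i, j) \<in> E'" "\<forall>i<n. \<forall>j<n. (i, j) \<in> R \<longleftrightarrow> (i, j) \<in> R'"
    by (auto simp: grid_eq_iff)
  then have "E = E'" "R = R'"
    using assms(2-) 1 by auto
  then show ?thesis using 1 by blast
qed

lemma reduces_to_correct:
  assumes "reduces_to x y"
  shows "x \<in> ExactMatching \<longleftrightarrow> y \<in> RecovAP_decision"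
proof
  assume "x \<in> ExactMatching"
  then obtain m n E R k M where x: "x = enc_EM m n E R k" "E \<subseteq> {..<m} \<times> {..<n}" "R \<subseteq> E"
      "perfect_matching m n E M" "card (M \<inter> R) = k"
    by (auto simp: ExactMatching_def)
  obtain f where "bij_betw f {..<m} {..<n}" by (rule perfect_matching_graph[OF x(4,2)]) blast
  \<comment> \<open>A perfect matching is a bijection between the sides, so a yes-instance always
    falls under the first case of \<open>reduces_to\<close>.\<close>
  then have "m = n" using bij_betw_same_card by fastforce
  with assms x have y: "y = enc_RA (3 * n) (ra_matching n) (ra_cost n E R k) k (int k)"
    unfolding reduces_to_def using enc_EM_inj by metis
  show "y \<in> RecovAP_decision"
    unfolding RecovAP_decision_def mem_Collect_eq
    by (rule exI[of _ "3 * n"], rule exI[of _ "ra_matching n"], rule exI[of _ "ra_cost n E R k"],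
        rule exI[of _ k], rule exI[of _ "int k"])
      (use y exact_matching_imp_assignment[of E n M R] ra_matching_perfect x \<open>m = n\<close> in \<open>auto simp: ra_cost_def\<close>)
next
  assume "y \<in> RecovAP_decision"
  then obtain n' M1 c2 k' B M2 where y: "y = enc_RA n' M1 c2 k' B"
    "\<And>i j. n' \<le> i \<or> n' \<le> j \<Longrightarrow> c2 i j = None" "perfect_matching n' n' (RA_edges n' c2) M1"
    "perfect_matching n' n' (RA_edges n' c2) M2" "card (M1 \<inter> M2) \<ge> k'"
    "(\<Sum>(i, j)\<in>M2. the (c2 i j)) \<le> B"
    unfolding RecovAP_decision_def by blast
  \<comment> \<open>Every code starts with a nonempty \<open>enc_nat\<close>, which rules out the
    second case of \<open>reduces_to\<close>.\<close>
  have "y \<noteq> []" by (simp add: y enc_RA_def enc_nat_def)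
  with assms obtain n E R k where x: "E \<subseteq> {..<n} \<times> {..<n}" "R \<subseteq> E" "x = enc_EM n n E R k"
      "y = enc_RA (3 * n) (ra_matching n) (ra_cost n E R k) k (int k)"
    unfolding reduces_to_def by blast
  have "n' = 3 * n \<and> M1 = ra_matching n \<and> c2 = ra_cost n E R k \<and> k' = k \<and> B = int k"
  proof (rule enc_RA_inj)
    show "M1 \<subseteq> {..<n'} \<times> {..<n'}" using y(3) by (auto simp: perfect_matching_def RA_edges_def)
  qed (use x y(1,2) in \<open>auto simp: ra_matching_def ra_cost_def\<close>)
  with y assignment_imp_exact_matching[OF x(2,1)] have "\<exists>M. perfect_matching n n E M \<and> card (M \<inter> R) = k"
    by blast
  with x show "x \<in> ExactMatching" unfolding ExactMatching_def by blast
qed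

section \<open>Compiling counter programs\<close>

datatype test = In "bool option" | Eq nat nat | Not test

text \<open>Incrementing, copying and comparing for equality are the operations that one pass from
  the least significant digit upwards can perform; everything else is done by counting up.\<close>

datatype com =
    Out bool
  | Mv int
  | Inc nat
  | Copy nat nat
  | Seq com com  (infixr ";;" 60)
  | If test com com
  | While test com

definition nvars :: nat where "nvars = 16"

type_synonym state = "nat \<times> (nat \<Rightarrow> nat) \<times> bool list"

fun holds :: "bool list \<Rightarrow> test \<Rightarrow> nat \<Rightarrow> (nat \<Rightarrow> nat) \<Rightarrow> bool" where
  "holds x (In a) h v \<longleftrightarrow> inp x h = a"
| "holds x (Eq i j) h v \<longleftrightarrow> v i = v j"
| "holds x (Not t) h v \<longleftrightarrow> \<not> holds x t h v"

fun wf_test :: "test \<Rightarrow> bool" where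
  "wf_test (In a) \<longleftrightarrow> True"
| "wf_test (Eq i j) \<longleftrightarrow> i < nvars \<and> j < nvars"
| "wf_test (Not t) \<longleftrightarrow> wf_test t"

text \<open>A derivation certifies termination and, through the side condition of
  \<open>Inc\<close>, that no increment goes beyond \<open>L\<close>; the space bound is drawn from
  it.\<close>

inductive exec :: "nat \<Rightarrow> bool list \<Rightarrow> com \<Rightarrow> state \<Rightarrow> state \<Rightarrow> bool" for L x where
  Out: "exec L x (Out b) (h, v, o') (h, v, o' @ [b])"
| Mv: "exec L x (Mv d) (h, v, o') (min (length x + 1) (move h d), v, o')"
| Inc: "i < nvars \<Longrightarrow> v i < L \<Longrightarrow> exec L x (Inc i) (h, v, o') (h, v(i := Suc (v i)), o')"
| Copy: "i < nvars \<Longrightarrow> j < nvars \<Longrightarrow> exec L x (Copy i j) (h, v, o') (h, v(i := v j), o')"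
| Seq: "exec L x c1 s s' \<Longrightarrow> exec L x c2 s' s'' \<Longrightarrow> exec L x (Seq c1 c2) s s''"
| IfT: "wf_test t \<Longrightarrow> holds x t h v \<Longrightarrow> exec L x c1 (h, v, o') s' \<Longrightarrow> exec L x (If t c1 c2) (h, v, o') s'"
| IfF: "wf_test t \<Longrightarrow> \<not> holds x t h v \<Longrightarrow> exec L x c2 (h, v, o') s' \<Longrightarrow> exec L x (If t c1 c2) (h, v, o') s'"
| WhileF: "wf_test t \<Longrightarrow> \<not> holds x t h v \<Longrightarrow> exec L x (While t c) (h, v, o') (h, v, o')"
| WhileT: "wf_test t \<Longrightarrow> holds x t h v \<Longrightarrow> exec L x c (h, v, o') s' \<Longrightarrow> exec L x (While t c) s' s'' \<Longrightarrow>
    exec L x (While t c) (h, v, o') s''"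

section \<open>Binary counters on the tracks of the work tape\<close>

definition mk :: "(nat \<Rightarrow> bool) \<Rightarrow> nat" where
  "mk f = horner_sum of_bool 2 (map f [0..<nvars + 2])"

text \<open>A work symbol carries all tracks of its cell, track \<open>j\<close> being its binary
  digit \<open>j\<close>; \<open>bit\<close> and \<open>mk\<close> translate between the two
  views.\<close>

lemma bit_mk: "bit (mk f) j \<longleftrightarrow> j < nvars + 2 \<and> f j"
  unfolding mk_def by (auto simp: bit_horner_sum_bit_iff simp del: upt_Suc)

lemma horner_bits_less: "horner_sum of_bool (2::nat) bs < 2 ^ length bs"
  by (induction bs) auto

lemma mk_less: "mk f < 2 ^ (nvars + 2)"
  using horner_bits_less[of "map f [0..<nvars + 2]"] unfolding mk_def by (simp del: upt_Suc)

lemma mk_cong: "(\<And>j. j < nvars + 2 \<Longrightarrow> f j = g j) \<Longrightarrow> mk f = mk g"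
  unfolding mk_def by (rule arg_cong[where f = "horner_sum of_bool 2"]) auto

text \<open>Track 0 marks cell 0, track 1 the cells in use, and track \<open>j + 2\<close> holds the binary digits of
  counter \<open>j\<close>, least significant digit at cell 0.\<close>
definition cell :: "(nat \<Rightarrow> nat) \<Rightarrow> nat \<Rightarrow> nat \<Rightarrow> nat \<Rightarrow> bool" where
  "cell v u p j = (if j = 0 then p = 0 else if j = 1 then p < u else bit (v (j - 2)) p)"

definition tape :: "(nat \<Rightarrow> nat) \<Rightarrow> nat \<Rightarrow> nat \<Rightarrow> nat" where
  "tape v u p = mk (cell v u p)"

text \<open>\<open>u\<close> is the number of cells marked on track 1. The marks form the right end
  of the copying and comparing scans, so all digits that may be nonzero have to lie below
  \<open>u\<close>.\<close>

definition good :: "nat \<Rightarrow> (nat \<Rightarrow> nat) \<Rightarrow> nat \<Rightarrow> bool" where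
  "good K v u \<longleftrightarrow> 1 \<le> u \<and> u \<le> K \<and> (\<forall>j<nvars. v j < 2 ^ u)"

type_synonym scan = "(nat \<Rightarrow> bool) \<Rightarrow> (nat \<Rightarrow> bool) \<times> bool option"
type_synonym trans = "bool option \<Rightarrow> nat \<Rightarrow> nat \<times> int \<times> nat \<times> int \<times> bool option"

text \<open>A scan rewrites cells from left to right until \<open>g\<close> returns a verdict,
  then returns to cell 0 and leaves by the exit for that verdict.\<close>
definition scan_code :: "scan \<Rightarrow> nat \<Rightarrow> nat \<Rightarrow> nat \<Rightarrow> nat \<Rightarrow> trans" where
  "scan_code g b eT eF q a s =
    (if q = b then
       (case g (bit s) of
          (f, None) \<Rightarrow> (b, 0, mk f, 1, None)
        | (f, Some r) \<Rightarrow> (if r then b + 1 else b + 2, 0, mk f, 0, None))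
     else if bit s 0 then (if q = b + 1 then eT else eF, 0, s, 0, None)
     else (if q = b + 1 then b + 1 else b + 2, 0, s, -1, None))"

text \<open>Carry propagation: ones are cleared up to the first zero, which is set. That cell may be
  a fresh one, hence the mark on track 1.\<close>

definition inc_scan :: "nat \<Rightarrow> scan" where
  "inc_scan i f = (if f (i + 2) then (f(i + 2 := False), None) else (f(i + 2 := True, 1 := True), Some True))"

definition copy_scan :: "nat \<Rightarrow> nat \<Rightarrow> scan" where
  "copy_scan i j f = (if f 1 then (f(i + 2 := f (j + 2)), None) else (f, Some True))"

definition eq_scan :: "nat \<Rightarrow> nat \<Rightarrow> scan" where
  "eq_scan i j f = (if \<not> f 1 then (f, Some True) else if f (i + 2) \<noteq> f (j + 2) then (f, Some False) else (f, None))"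

text \<open>A scan takes three states: one for moving right and one per verdict for moving
  back.\<close>

fun test_size :: "test \<Rightarrow> nat" where
  "test_size (In a) = 1"
| "test_size (Eq i j) = 3"
| "test_size (Not t) = test_size t"

fun branch_code :: "test \<Rightarrow> nat \<Rightarrow> nat \<Rightarrow> nat \<Rightarrow> nat \<Rightarrow> trans" where
  "branch_code (In c) b eT eF q a s = (if a = c then eT else eF, 0, s, 0, None)"
| "branch_code (Eq i j) b eT eF q a s = scan_code (eq_scan i j) b eT eF q a s"
| "branch_code (Not t) b eT eF q a s = branch_code t b eF eT q a s"

fun com_size :: "com \<Rightarrow> nat" where
  "com_size (Out b) = 1"
| "com_size (Mv d) = 1"
| "com_size (Inc i) = 3"
| "com_size (Copy i j) = 3"
| "com_size (Seq c1 c2) = com_size c1 + com_size c2"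
| "com_size (If t c1 c2) = test_size t + com_size c1 + com_size c2"
| "com_size (While t c) = test_size t + com_size c"

text \<open>The states of \<open>com_code c b e\<close> are \<open>b, \<dots>, b + com_size c - 1\<close>, with entry \<open>b\<close> and exit \<open>e\<close>.\<close>
fun com_code :: "com \<Rightarrow> nat \<Rightarrow> nat \<Rightarrow> nat \<Rightarrow> trans" where
  "com_code (Out c) b e q a s = (e, 0, s, 0, Some c)"
| "com_code (Mv d) b e q a s = (e, d, s, 0, None)"
| "com_code (Inc i) b e q a s = scan_code (inc_scan i) b e e q a s"
| "com_code (Copy i j) b e q a s = scan_code (copy_scan i j) b e e q a s"
| "com_code (Seq c1 c2) b e q a s =
     (let m = b + com_size c1 in
      if q < m then com_code c1 b m q a s else com_code c2 m e q a s)"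
| "com_code (If t c1 c2) b e q a s =
     (let m1 = b + test_size t; m2 = m1 + com_size c1 in
      if q < m1 then branch_code t b m1 m2 q a s
      else if q < m2 then com_code c1 m1 e q a s
      else com_code c2 m2 e q a s)"
| "com_code (While t c) b e q a s =
     (let m = b + test_size t in
      if q < m then branch_code t b m e q a s else com_code c m b q a s)"

lemma test_size_pos: "0 < test_size t"
  by (induction t) auto

lemma com_size_pos: "0 < com_size c"
  by (induction c) auto

section \<open>Runs of a machine with a bounded work head\<close>

definition reach :: "machine \<Rightarrow> bool list \<Rightarrow> nat \<Rightarrow> config \<Rightarrow> config \<Rightarrow> bool" where
  "reach M x H = (\<lambda>c c'. cfg_work_head c \<le> H \<and> c' = step M x c \<and> cfg_work_head c' \<le> H)\<^sup>*\<^sup>*"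

lemma reach_trans: "reach M x H a b \<Longrightarrow> reach M x H b c \<Longrightarrow> reach M x H a c"
  unfolding reach_def by (rule rtranclp_trans)

lemma reach_refl: "reach M x H a a"
  unfolding reach_def by simp

lemma reach_step:
  assumes "m_delta M q (inp x h) (w p) = (q', d, s', dw, ot)" "q \<noteq> 1"
    and "p \<le> H" "move p dw \<le> H"
  shows "reach M x H (q, h, w, p, out)
    (q', min (length x + 1) (move h d), w(p := s'), move p dw,
      out @ (case ot of None \<Rightarrow> [] | Some b \<Rightarrow> [b]))"
  unfolding reach_def
  by (rule r_into_rtranclp) (use assms in \<open>simp add: step_def cfg_work_head_def\<close>)

text \<open>\<open>reach\<close> records the bound at both ends of every step, so it holds for all
  intermediate configurations and not only for the last.\<close>

lemma reach_run:
  assumes "reach M x H c c'" "cfg_work_head c \<le> H"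
  shows "\<exists>t. (step M x ^^ t) c = c' \<and> (\<forall>t'\<le>t. cfg_work_head ((step M x ^^ t') c) \<le> H)"
  using assms unfolding reach_def
proof (induction rule: rtranclp_induct)
  case base
  then show ?case by (intro exI[of _ 0]) auto
next
  case (step y z)
  then obtain t where t: "(step M x ^^ t) c = y" "\<forall>t'\<le>t. cfg_work_head ((step M x ^^ t') c) \<le> H"
    by auto
  show ?case
    by (intro exI[of _ "Suc t"]) (use t step in \<open>auto simp: le_Suc_eq\<close>)
qed

lemma move_simps [simp]: "move p 0 = p" "move p 1 = Suc p" "move p (- 1) = p - 1"
  by (auto simp: move_def)

text \<open>Track 0 identifies cell 0, so the way back is found without a counter. The machine is
  assumed to agree with the scan only on the states of the scan, which lets the lemma apply inside
  any larger program; \<open>2 \<le> b\<close> keeps these states apart from the halting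
  state.\<close>

lemma scan_return:
  assumes agree: "\<And>q. b \<le> q \<Longrightarrow> q < b + 3 \<Longrightarrow> m_delta M q = scan_code g b eT eF q"
    and "2 \<le> b" "h \<le> length x + 1"
  shows "p \<le> H \<Longrightarrow> (\<And>i. i \<le> p \<Longrightarrow> bit (w i) 0 \<longleftrightarrow> i = 0) \<Longrightarrow>
    reach M x H (if r then b + 1 else b + 2, h, w, p, out) (if r then eT else eF, h, w, 0, out)"
proof (induction p)
  case 0
  let ?q = "if r then b + 1 else b + 2"
  have "m_delta M ?q (inp x h) (w 0) = (if r then eT else eF, 0, w 0, 0, None)"
    using 0(2)[of 0] by (subst agree) (auto simp: scan_code_def)
  from reach_step[where w = w and p = 0, OF this, of H] show ?case
    using assms by (auto split: if_splits)
next
  case (Suc p)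
  let ?q = "if r then b + 1 else b + 2"
  have "m_delta M ?q (inp x h) (w (Suc p)) = (?q, 0, w (Suc p), -1, None)"
    using Suc(3)[of "Suc p"] by (subst agree) (auto simp: scan_code_def)
  from reach_step[where w = w and p = "Suc p", OF this, of H out] Suc assms
  have "reach M x H (?q, h, w, Suc p, out) (?q, h, w, p, out)"
    by (auto split: if_splits)
  moreover have "reach M x H (?q, h, w, p, out) (if r then eT else eF, h, w, 0, out)"
    using Suc by auto
  ultimately show ?case by (rule reach_trans)
qed

lemma scan_forward:
  assumes agree: "\<And>q. b \<le> q \<Longrightarrow> q < b + 3 \<Longrightarrow> m_delta M q = scan_code g b eT eF q"
    and "2 \<le> b" "h \<le> length x + 1"
  shows "p \<le> H \<Longrightarrow> (\<And>i. i < p \<Longrightarrow> g (bit (w i)) = (f i, None)) \<Longrightarrow>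
    reach M x H (b, h, w, 0, out) (b, h, \<lambda>i. if i < p then mk (f i) else w i, p, out)"
proof (induction p)
  case 0
  then show ?case by (simp add: reach_refl)
next
  case (Suc p)
  let ?w = "\<lambda>i. if i < p then mk (f i) else w i"
  have "m_delta M b (inp x h) (?w p) = (b, 0, mk (f p), 1, None)"
    using Suc(3)[of p] by (subst agree) (auto simp: scan_code_def)
  from reach_step[where w = ?w and p = p, OF this, of H out] Suc(2) assms
  have "reach M x H (b, h, ?w, p, out) (b, h, ?w(p := mk (f p)), Suc p, out)"
    by (auto split: if_splits)
  moreover have "?w(p := mk (f p)) = (\<lambda>i. if i < Suc p then mk (f i) else w i)"
    by auto
  ultimately have "reach M x H (b, h, ?w, p, out) (b, h, \<lambda>i. if i < Suc p then mk (f i) else w i, Suc p, out)"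
    by (simp only:)
  with Suc show ?case by (auto intro: reach_trans)
qed

text \<open>\<open>p\<close> is the cell where the verdict falls and \<open>f i\<close> the new
  contents of cell \<open>i\<close>; cells to the right of \<open>p\<close> keep their
  symbols.\<close>

lemma scan_reach:
  assumes agree: "\<And>q. b \<le> q \<Longrightarrow> q < b + 3 \<Longrightarrow> m_delta M q = scan_code g b eT eF q"
    and "2 \<le> b" "h \<le> length x + 1" "p \<le> H"
    and scan: "\<And>i. i < p \<Longrightarrow> g (bit (w i)) = (f i, None)" "g (bit (w p)) = (f p, Some r)"
    and first: "\<And>i. i \<le> p \<Longrightarrow> f i 0 \<longleftrightarrow> i = 0"
    and w': "w' = (\<lambda>i. if i \<le> p then mk (f i) else w i)"
  shows "reach M x H (b, h, w, 0, out) (if r then eT else eF, h, w', 0, out)"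
proof -
  let ?w = "\<lambda>i. if i < p then mk (f i) else w i" and ?q = "if r then b + 1 else b + 2"
  have "m_delta M b (inp x h) (?w p) = (?q, 0, mk (f p), 0, None)"
    using scan(2) by (subst agree) (auto simp: scan_code_def)
  from reach_step[where w = ?w and p = p, OF this, of H out] assms
  have "reach M x H (b, h, ?w, p, out) (?q, h, ?w(p := mk (f p)), p, out)"
    by (auto split: if_splits)
  moreover have "?w(p := mk (f p)) = w'"
    unfolding w' by auto
  moreover have "reach M x H (b, h, w, 0, out) (b, h, ?w, p, out)"
    using scan_forward[OF agree] assms by blast
  moreover have "reach M x H (?q, h, w', p, out) (if r then eT else eF, h, w', 0, out)"
    by (rule scan_return[OF agree]) (use assms first in \<open>auto simp: w' bit_mk\<close>)
  ultimately show ?thesis by (simp only:) (blast intro: reach_trans)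
qed

section \<open>Correctness of the scans\<close>

lemma bit_nat_less: "n < 2 ^ u \<Longrightarrow> bit (n::nat) p \<Longrightarrow> p < u"
proof (rule ccontr)
  assume "n < 2 ^ u" "bit n p" "\<not> p < u"
  then have "n < 2 ^ p" by (meson less_le_trans not_less one_le_numeral power_increasing)
  with \<open>bit n p\<close> show False by (simp add: bit_iff_odd)
qed

text \<open>\<open>r\<close> is the number of trailing ones: they become zeros, digit
  \<open>r\<close> becomes one, the higher digits stay. For odd \<open>n\<close> the carry passes to
  \<open>n div 2\<close>, which gives the induction.\<close>

lemma bit_Suc_nat:
  "\<exists>r. (\<forall>p<r. bit n p) \<and> \<not> bit n r \<and>
    (\<forall>p. bit (Suc n) p \<longleftrightarrow> (if p < r then False else p = r \<or> bit n p))"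
proof (induction n rule: less_induct)
  case (less n)
  show ?case
  proof (cases "even n")
    case True
    then obtain m where m: "n = 2 * m" by (auto elim!: evenE)
    have "bit n p \<longleftrightarrow> p \<noteq> 0 \<and> bit m (p - 1)" "bit (Suc n) p \<longleftrightarrow> p = 0 \<or> bit m (p - 1)" for p
      by (cases p; simp add: m bit_0 bit_Suc)+
    then show ?thesis
      by (intro exI[of _ 0]) auto
  next
    case False
    then obtain m where m: "n = 2 * m + 1" by (auto elim!: oddE)
    from less[of m] m obtain r where r: "\<forall>p<r. bit m p" "\<not> bit m r"
      "\<forall>p. bit (Suc m) p \<longleftrightarrow> (if p < r then False else p = r \<or> bit m p)"
      by auto
    have n: "bit n p \<longleftrightarrow> p = 0 \<or> bit m (p - 1)" for p
      by (cases p) (auto simp: m bit_0 bit_Suc)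
    have s: "bit (Suc n) p \<longleftrightarrow> p \<noteq> 0 \<and> bit (Suc m) (p - 1)" for p
      by (cases p) (auto simp: m bit_0 bit_Suc)
    show ?thesis
      by (intro exI[of _ "Suc r"]) (use r in \<open>auto simp: n s less_Suc_eq_0_disj\<close>)
  qed
qed

lemma bit_tape: "bit (tape v u p) = (\<lambda>j. j < nvars + 2 \<and> cell v u p j)"
  by (auto simp: tape_def bit_mk)

lemma inc_reach:
  assumes agree: "\<And>q. b \<le> q \<Longrightarrow> q < b + 3 \<Longrightarrow> m_delta M q = scan_code (inc_scan i) b e e q"
    and "2 \<le> b" "h \<le> length x + 1" "good K v u" "i < nvars" "v i < L" "L < 2 ^ K"
  shows "\<exists>u'. good K (v(i := Suc (v i))) u' \<and>
    reach M x K (b, h, tape v u, 0, out) (e, h, tape (v(i := Suc (v i))) u', 0, out)"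
proof -
  obtain r where r: "\<And>p. p < r \<Longrightarrow> bit (v i) p" "\<not> bit (v i) r"
      "\<And>p. bit (Suc (v i)) p \<longleftrightarrow> (if p < r then False else p = r \<or> bit (v i) p)"
    using bit_Suc_nat[of "v i"] by blast
  \<comment> \<open>Digit \<open>r\<close> of the new value is set, and the new value is at most
    \<open>L\<close>, which is below \<open>2 ^ K\<close>.\<close>
  have rK: "r < K"
    by (rule bit_nat_less[of "Suc (v i)"]) (use assms r(3)[of r] in auto)
  \<comment> \<open>Digit \<open>r - 1\<close> of the old value is set and hence marked. At most one
    cell is added, directly behind the marked ones, so the marks stay contiguous.\<close>
  have ru: "r \<le> u"
    using bit_nat_less[of "v i" u "r - 1"] r(1)[of "r - 1"] assms by (cases r) (auto simp: good_def)
  define u' where "u' = max u (Suc r)"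
  \<comment> \<open>Otherwise the new value would equal \<open>2 ^ u'\<close> and have digit
    \<open>u'\<close> set; but \<open>u'\<close> exceeds \<open>r\<close>, where old and new digits
    coincide.\<close>
  have less: "Suc (v i) < 2 ^ u'"
  proof (rule ccontr)
    assume "\<not> ?thesis"
    moreover have "v i < 2 ^ u'" using assms unfolding good_def u'_def
      by (meson less_le_trans max.cobounded1 one_le_numeral power_increasing)
    ultimately have "Suc (v i) = 2 ^ u'" by simp
    then have "bit (Suc (v i)) u'" by (simp add: bit_iff_odd)
    moreover have "\<not> bit (v i) u'" using bit_nat_less[OF \<open>v i < 2 ^ u'\<close>] by blast
    ultimately show False using r(3)[of u'] by (auto simp: u'_def split: if_splits)
  qed
  have "v j < 2 ^ u'" if "j < nvars" for j
    using that assms unfolding good_def u'_def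
    by (meson less_le_trans max.cobounded1 one_le_numeral power_increasing)
  then have good: "good K (v(i := Suc (v i))) u'"
    using less assms rK by (auto simp: good_def u'_def)
  define f where "f = (\<lambda>p j. if j = i + 2 then p = r else j < nvars + 2 \<and> (cell v u p j \<or> j = 1 \<and> p = r))"
  have "reach M x K (b, h, tape v u, 0, out) (if True then e else e, h, tape (v(i := Suc (v i))) u', 0, out)"
  proof (rule scan_reach[OF agree, where f = f and p = r])
    fix p assume "p < r"
    then show "inc_scan i (bit (tape v u p)) = (f p, None)"
      using r(1)[of p] ru \<open>i < nvars\<close> by (auto simp: inc_scan_def bit_tape f_def cell_def fun_eq_iff)
  next
    show "inc_scan i (bit (tape v u r)) = (f r, Some True)"
      using r(2) \<open>i < nvars\<close> by (auto simp: inc_scan_def bit_tape f_def cell_def fun_eq_iff)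
  next
    show "tape (v(i := Suc (v i))) u' = (\<lambda>p. if p \<le> r then mk (f p) else tape v u p)"
    proof
      fix p
      show "tape (v(i := Suc (v i))) u' p = (if p \<le> r then mk (f p) else tape v u p)"
        using r ru unfolding tape_def
        by (auto intro!: mk_cong simp: cell_def f_def u'_def split: if_splits)
    qed
  qed (use assms rK in \<open>auto simp: f_def cell_def\<close>)
  with good show ?thesis by auto
qed

text \<open>Unmarked cells hold only zero digits, so copying the marked ones is complete and the
  number of marks is unchanged. The scan stops at cell \<open>u\<close>, which it leaves as it
  is.\<close>

lemma copy_reach:
  assumes agree: "\<And>q. b \<le> q \<Longrightarrow> q < b + 3 \<Longrightarrow> m_delta M q = scan_code (copy_scan i j) b e e q"
    and "2 \<le> b" "h \<le> length x + 1" "good K v u" "i < nvars" "j < nvars"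
  shows "\<exists>u'. good K (v(i := v j)) u' \<and>
    reach M x K (b, h, tape v u, 0, out) (e, h, tape (v(i := v j)) u', 0, out)"
proof -
  define f where "f = (\<lambda>p k. k < nvars + 2 \<and> cell (v(i := v j)) u p k)"
  have z: "\<not> bit (v k) p" if "k < nvars" "u \<le> p" for k p
    using bit_nat_less[of "v k" u p] that assms by (auto simp: good_def)
  have "reach M x K (b, h, tape v u, 0, out) (if True then e else e, h, tape (v(i := v j)) u, 0, out)"
  proof (rule scan_reach[OF agree, where f = f and p = u])
    fix p assume "p < u"
    then show "copy_scan i j (bit (tape v u p)) = (f p, None)"
      using assms by (auto simp: copy_scan_def bit_tape f_def cell_def fun_eq_iff)
  next
    show "copy_scan i j (bit (tape v u u)) = (f u, Some True)"
      using assms z[of _ u] by (auto simp: copy_scan_def bit_tape f_def cell_def fun_eq_iff split: if_splits)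
  next
    show "tape (v(i := v j)) u = (\<lambda>p. if p \<le> u then mk (f p) else tape v u p)"
      using assms z by (auto intro!: mk_cong simp: tape_def cell_def f_def fun_eq_iff split: if_splits)
  qed (use assms in \<open>auto simp: f_def cell_def good_def\<close>)
  moreover have "good K (v(i := v j)) u" using assms by (auto simp: good_def)
  ultimately show ?thesis by auto
qed

text \<open>Different values differ in a marked cell, so the first differing digit is met before the
  scan reaches the end of the marks. Each symbol is rewritten by itself.\<close>

lemma eq_reach:
  assumes agree: "\<And>q. b \<le> q \<Longrightarrow> q < b + 3 \<Longrightarrow> m_delta M q = scan_code (eq_scan i j) b eT eF q"
    and "2 \<le> b" "h \<le> length x + 1" "good K v u" "i < nvars" "j < nvars"
  shows "reach M x K (b, h, tape v u, 0, out) (if v i = v j then eT else eF, h, tape v u, 0, out)"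
proof -
  define f where "f = (\<lambda>p k. k < nvars + 2 \<and> cell v u p k)"
  have tape: "tape v u = (\<lambda>p'. if p' \<le> p then mk (f p') else tape v u p')" for p
    by (auto intro!: mk_cong simp: tape_def cell_def f_def fun_eq_iff)
  show ?thesis
  proof (cases "v i = v j")
    case True
    have "reach M x K (b, h, tape v u, 0, out) (if True then eT else eF, h, tape v u, 0, out)"
      by (rule scan_reach[OF agree, where f = f and p = u]; (rule tape)?)
        (use assms True in \<open>auto simp: eq_scan_def bit_tape f_def cell_def good_def fun_eq_iff\<close>)
    with True show ?thesis by simp
  next
    case False
    then have "\<exists>p. bit (v i) p \<noteq> bit (v j) p" by (auto simp: bit_eq_iff)
    then obtain p where p: "bit (v i) p \<noteq> bit (v j) p" "\<And>p'. p' < p \<Longrightarrow> bit (v i) p' = bit (v j) p'"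
      using LeastI_ex[of "\<lambda>p. bit (v i) p \<noteq> bit (v j) p"] not_less_Least by blast
    have pu: "p < u" using p(1) bit_nat_less[of _ u p] assms by (metis good_def)
    have "reach M x K (b, h, tape v u, 0, out) (if False then eT else eF, h, tape v u, 0, out)"
      by (rule scan_reach[OF agree, where f = f and p = p]; (rule tape)?)
        (use assms p pu in \<open>auto simp: eq_scan_def bit_tape f_def cell_def good_def fun_eq_iff\<close>)
    with False show ?thesis by simp
  qed
qed

lemma test_reach:
  assumes "\<And>q. b \<le> q \<Longrightarrow> q < b + test_size t \<Longrightarrow> m_delta M q = branch_code t b eT eF q"
    and "2 \<le> b" "h \<le> length x + 1" "good K v u" "wf_test t"
  shows "reach M x K (b, h, tape v u, 0, out) (if holds x t h v then eT else eF, h, tape v u, 0, out)"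
  using assms
proof (induction t arbitrary: eT eF)
  case (In c)
  have "m_delta M b (inp x h) (tape v u 0) = (if inp x h = c then eT else eF, 0, tape v u 0, 0, None)"
    using In(1)[of b] by (simp add: fun_eq_iff)
  from reach_step[where w = "tape v u" and p = 0, OF this, of K] show ?case
    using In by (auto split: if_splits)
next
  case (Eq i j)
  then show ?case using eq_reach[of b M i j eT eF h x K v u out] by (simp add: fun_eq_iff)
next
  case (Not t)
  from Not(1)[of eF eT] Not(2-) show ?case
    by (simp add: fun_eq_iff split: if_splits)
qed

text \<open>Induction on the derivation, since a loop body may be executed many times. Position
  \<open>b\<close>, exit \<open>e\<close> and mark count \<open>u\<close> are general because they
  change from one subprogram to the next.\<close>

lemma exec_reach:
  assumes "exec L x c s s'" "L < 2 ^ K"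
    and "\<And>q. b \<le> q \<Longrightarrow> q < b + com_size c \<Longrightarrow> m_delta M q = com_code c b e q"
    and "2 \<le> b" "fst s \<le> length x + 1" "good K (fst (snd s)) u"
  shows "fst s' \<le> length x + 1 \<and> (\<exists>u'. good K (fst (snd s')) u' \<and>
    reach M x K (b, fst s, tape (fst (snd s)) u, 0, snd (snd s))
      (e, fst s', tape (fst (snd s')) u', 0, snd (snd s')))"
  using assms
proof (induction arbitrary: b e u rule: exec.induct)
  case (Out c h v o')
  have "m_delta M b (inp x h) (tape v u 0) = (e, 0, tape v u 0, 0, Some c)"
    using Out(2)[of b] by (simp add: fun_eq_iff)
  from reach_step[where w = "tape v u" and p = 0, OF this, of K] Out show ?case
    by (intro conjI exI[of _ u]) (auto split: if_splits)
next
  case (Mv d h v o')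
  have "m_delta M b (inp x h) (tape v u 0) = (e, d, tape v u 0, 0, None)"
    using Mv(2)[of b] by (simp add: fun_eq_iff)
  from reach_step[where w = "tape v u" and p = 0, OF this, of K] Mv show ?case
    by (intro conjI exI[of _ u]) auto
next
  case (Inc i v h o')
  have "m_delta M q = scan_code (inc_scan i) b e e q" if "b \<le> q" "q < b + 3" for q
    using Inc.prems(2)[of q] that by (simp add: fun_eq_iff)
  from inc_reach[OF this, of h x K v u L o'] Inc show ?case by (simp add: fun_upd_def)
next
  case (Copy i j h v o')
  have "m_delta M q = scan_code (copy_scan i j) b e e q" if "b \<le> q" "q < b + 3" for q
    using Copy.prems(2)[of q] that by (simp add: fun_eq_iff)
  from copy_reach[OF this, of h x K v u o'] Copy show ?case by (simp add: fun_upd_def)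
next
  case (Seq c1 s s' c2 s'')
  let ?m = "b + com_size c1"
  have a1: "m_delta M q = com_code c1 b ?m q" if "b \<le> q" "q < ?m" for q
    using Seq.prems(2)[of q] that by (simp add: fun_eq_iff Let_def)
  have a2: "m_delta M q = com_code c2 ?m e q" if "?m \<le> q" "q < ?m + com_size c2" for q
    using Seq.prems(2)[of q] that by (simp add: fun_eq_iff Let_def)
  from Seq.IH(1)[OF Seq.prems(1) a1 Seq.prems(3-5)] obtain u1 where
    1: "fst s' \<le> length x + 1" "good K (fst (snd s')) u1"
      "reach M x K (b, fst s, tape (fst (snd s)) u, 0, snd (snd s))
        (?m, fst s', tape (fst (snd s')) u1, 0, snd (snd s'))" by blast
  from Seq.IH(2)[OF Seq.prems(1) a2 _ 1(1,2)] Seq.prems(3) obtain u2 where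
    2: "fst s'' \<le> length x + 1" "good K (fst (snd s'')) u2"
      "reach M x K (?m, fst s', tape (fst (snd s')) u1, 0, snd (snd s'))
        (e, fst s'', tape (fst (snd s'')) u2, 0, snd (snd s''))" by auto
  from 2 reach_trans[OF 1(3) 2(3)] show ?case by blast
next
  case (IfT t h v c1 o' s' c2)
  let ?m1 = "b + test_size t" and ?m2 = "b + test_size t + com_size c1"
  have t: "m_delta M q = branch_code t b ?m1 ?m2 q" if "b \<le> q" "q < ?m1" for q
    using IfT.prems(2)[of q] that by (simp add: fun_eq_iff Let_def)
  have a: "m_delta M q = com_code c1 ?m1 e q" if "?m1 \<le> q" "q < ?m1 + com_size c1" for q
    using IfT.prems(2)[of q] that by (simp add: fun_eq_iff Let_def)
  have 0: "reach M x K (b, h, tape v u, 0, o') (?m1, h, tape v u, 0, o')"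
    using test_reach[OF t, of h x K v u o'] IfT by auto
  from IfT.IH[OF IfT.prems(1) a _ IfT.prems(4-5)] IfT.prems(3) obtain u1 where
    1: "fst s' \<le> length x + 1" "good K (fst (snd s')) u1"
      "reach M x K (?m1, h, tape v u, 0, o')
        (e, fst s', tape (fst (snd s')) u1, 0, snd (snd s'))" by auto
  from 1 reach_trans[OF 0 1(3)] show ?case by auto
next
  case (IfF t h v c2 o' s' c1)
  let ?m1 = "b + test_size t" and ?m2 = "b + test_size t + com_size c1"
  have t: "m_delta M q = branch_code t b ?m1 ?m2 q" if "b \<le> q" "q < ?m1" for q
    using IfF.prems(2)[of q] that by (simp add: fun_eq_iff Let_def)
  have a: "m_delta M q = com_code c2 ?m2 e q" if "?m2 \<le> q" "q < ?m2 + com_size c2" for q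
    using IfF.prems(2)[of q] that by (simp add: fun_eq_iff Let_def)
  have 0: "reach M x K (b, h, tape v u, 0, o') (?m2, h, tape v u, 0, o')"
    using test_reach[OF t, of h x K v u o'] IfF by auto
  from IfF.IH[OF IfF.prems(1) a _ IfF.prems(4-5)] IfF.prems(3) obtain u1 where
    1: "fst s' \<le> length x + 1" "good K (fst (snd s')) u1"
      "reach M x K (?m2, h, tape v u, 0, o')
        (e, fst s', tape (fst (snd s')) u1, 0, snd (snd s'))" by auto
  from 1 reach_trans[OF 0 1(3)] show ?case by auto
next
  case (WhileF t h v c o')
  let ?m = "b + test_size t"
  have t: "m_delta M q = branch_code t b ?m e q" if "b \<le> q" "q < ?m" for q
    using WhileF.prems(2)[of q] that by (simp add: fun_eq_iff Let_def)
  from test_reach[OF t, of h x K v u o'] WhileF show ?case by auto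
next
  case (WhileT t h v c o' s' s'')
  let ?m = "b + test_size t"
  have t: "m_delta M q = branch_code t b ?m e q" if "b \<le> q" "q < ?m" for q
    using WhileT.prems(2)[of q] that by (simp add: fun_eq_iff Let_def)
  have a: "m_delta M q = com_code c ?m b q" if "?m \<le> q" "q < ?m + com_size c" for q
    using WhileT.prems(2)[of q] that by (simp add: fun_eq_iff Let_def)
  have 0: "reach M x K (b, h, tape v u, 0, o') (?m, h, tape v u, 0, o')"
    using test_reach[OF t, of h x K v u o'] WhileT by auto
  from WhileT.IH(1)[OF WhileT.prems(1) a _ WhileT.prems(4-5)] WhileT.prems(3) obtain u1 where
    1: "fst s' \<le> length x + 1" "good K (fst (snd s')) u1"
      "reach M x K (?m, h, tape v u, 0, o')
        (b, fst s', tape (fst (snd s')) u1, 0, snd (snd s'))" by auto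
  \<comment> \<open>The body was compiled with exit \<open>b\<close>, so after one round the machine
    is back at the entry of the same loop code.\<close>
  from WhileT.IH(2)[OF WhileT.prems(1,2,3) 1(1,2)] obtain u2 where
    2: "fst s'' \<le> length x + 1" "good K (fst (snd s'')) u2"
      "reach M x K (b, fst s', tape (fst (snd s')) u1, 0, snd (snd s'))
        (e, fst s'', tape (fst (snd s'')) u2, 0, snd (snd s''))" by auto
  from 2 reach_trans[OF 0 reach_trans[OF 1(3) 2(3)]] show ?case by auto
qed

text \<open>State 0 marks cell 0 as the first cell and as one in use, which makes the blank tape
  represent counters that are all 0; state 1 halts and the program proper starts at state 2.\<close>

definition compile :: "com \<Rightarrow> machine" where
  "compile c = Machine (2 + com_size c) (2 ^ (nvars + 2))
    (\<lambda>q a s. if q = 0 then (2, 0, mk (\<lambda>j. j \<le> 1), 0, None)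
      else if q = 1 then (1, 0, s, 0, None) else com_code c 2 1 q a s)"

lemma branch_code_wf:
  assumes "b \<le> q" "q < b + test_size t" "s < 2 ^ (nvars + 2)" "branch_code t b eT eF q a s = (q', d, s', dw, ot)"
  shows "(b \<le> q' \<and> q' < b + test_size t \<or> q' = eT \<or> q' = eF) \<and> s' < 2 ^ (nvars + 2)"
  using assms
  by (induction t arbitrary: eT eF)
    (auto simp: scan_code_def mk_less[simplified] split: if_splits prod.splits option.splits)

lemma com_code_wf:
  assumes "b \<le> q" "q < b + com_size c" "s < 2 ^ (nvars + 2)" "com_code c b e q a s = (q', d, s', dw, ot)"
  shows "(b \<le> q' \<and> q' < b + com_size c \<or> q' = e) \<and> s' < 2 ^ (nvars + 2)"
  using assms
proof (induction c arbitrary: b e)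
  case (Seq c1 c2)
  then show ?case
    using Seq(1)[of b "b + com_size c1"] Seq(2)[of "b + com_size c1" e] com_size_pos[of c2]
    by (fastforce simp: Let_def split: if_splits)
next
  case (If t c1 c2)
  then show ?case
    using branch_code_wf[of b q t s "b + test_size t" "b + test_size t + com_size c1" a]
      If(1)[of "b + test_size t" e] If(2)[of "b + test_size t + com_size c1" e]
      com_size_pos[of c1] com_size_pos[of c2]
    by (fastforce simp: Let_def split: if_splits)
next
  case (While t c)
  then show ?case
    using branch_code_wf[of b q t s "b + test_size t" e a]
      While(1)[of "b + test_size t" b] com_size_pos[of c] test_size_pos[of t]
    by (fastforce simp: Let_def split: if_splits)
qed (auto simp: scan_code_def mk_less[simplified] split: if_splits prod.splits option.splits)

lemma compile_wf: "wf_machine (compile c)"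
proof -
  have "case m_delta (compile c) q a s of (q', di, s', dw, out) \<Rightarrow>
      q' < 2 + com_size c \<and> s' < 2 ^ (nvars + 2)"
    if "q < 2 + com_size c" "s < 2 ^ (nvars + 2)" for q a s
  proof (cases "q = 0")
    case True
    then show ?thesis using mk_less com_size_pos[of c] by (simp add: compile_def)
  next
    case False
    show ?thesis
    proof (cases "q = 1")
      case True
      then show ?thesis using mk_less com_size_pos[of c] that by (simp add: compile_def)
    next
      case F: False
      obtain q' d s' dw ot where "com_code c 2 1 q a s = (q', d, s', dw, ot)"
        by (metis prod_cases5)
      with com_code_wf[OF _ _ that(2) this] that False F show ?thesis
        by (auto simp: compile_def)
    qed
  qed
  then show ?thesis by (auto simp: wf_machine_def compile_def)
qed

lemma compile_run:
  assumes "exec L x c (0, \<lambda>_. 0, []) (h, v, out)" "L < 2 ^ K" "1 \<le> K"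
  shows "\<exists>t. cfg_state (run (compile c) x t) = 1 \<and> cfg_output (run (compile c) x t) = out"
    and "cfg_work_head (run (compile c) x t) \<le> K"
proof -
  let ?M = "compile c"
  have a: "m_delta ?M q = com_code c 2 1 q" if "2 \<le> q" "q < 2 + com_size c" for q
    using that by (simp add: compile_def fun_eq_iff)
  have 0: "reach ?M x K init_config (2, 0, tape (\<lambda>_. 0) 1, 0, [])"
  proof -
    have "m_delta ?M 0 (inp x 0) 0 = (2, 0, mk (\<lambda>j. j \<le> 1), 0, None)"
      by (simp add: compile_def)
    from reach_step[where w = "\<lambda>_. 0" and p = 0, OF this, of K]
    have "reach ?M x K init_config (2, 0, (\<lambda>_. 0)(0 := mk (\<lambda>j. j \<le> 1)), 0, [])"
      by (simp add: init_config_def)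
    moreover have "(\<lambda>_. 0)(0 := mk (\<lambda>j. j \<le> 1)) = tape (\<lambda>_. 0) 1"
    proof
      fix p
      have "mk (\<lambda>_. False) = 0" by (rule bit_eqI) (simp add: bit_mk)
      moreover have "tape (\<lambda>_. 0) 1 p = mk (if p = 0 then (\<lambda>j. j \<le> 1) else (\<lambda>_. False))"
        unfolding tape_def by (rule mk_cong) (auto simp: cell_def)
      ultimately show "((\<lambda>_. 0)(0 := mk (\<lambda>j. j \<le> 1))) p = tape (\<lambda>_. 0) 1 p" by simp
    qed
    ultimately show ?thesis by simp
  qed
  have "good K (\<lambda>_. 0) 1" using assms by (simp add: good_def)
  with exec_reach[OF assms(1,2) a, of 1] obtain u' where
    "reach ?M x K (2, 0, tape (\<lambda>_. 0) 1, 0, []) (1, h, tape v u', 0, out)" by auto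
  from reach_run[OF reach_trans[OF 0 this]] obtain T where
    T: "run ?M x T = (1, h, tape v u', 0, out)" "\<And>t. t \<le> T \<Longrightarrow> cfg_work_head (run ?M x t) \<le> K"
    by (auto simp: run_def init_config_def cfg_work_head_def)
  then show "\<exists>t. cfg_state (run ?M x t) = 1 \<and> cfg_output (run ?M x t) = out"
    by (intro exI[of _ T]) (simp add: cfg_state_def cfg_output_def)
  \<comment> \<open>A halted configuration no longer changes, so the bound on the head up to time
    \<open>T\<close> extends to all times.\<close>
  have halted: "run ?M x (T + d) = run ?M x T" for d
    by (induction d) (use T(1) in \<open>auto simp: run_def step_def\<close>)
  show "cfg_work_head (run ?M x t) \<le> K"
    using T(2)[of t] T(2)[of T] halted[of "t - T"] by (cases "t \<le> T") auto
qed

section \<open>The reduction as a counter program\<close>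

inductive_simps exec_simps:
  "exec L x (Out b) (h, v, p) s"
  "exec L x (Mv d) (h, v, p) s"
  "exec L x (Inc i) (h, v, p) s"
  "exec L x (Copy i j) (h, v, p) s"
  "exec L x (c1 ;; c2) s' s"
  "exec L x (If t c1 c2) (h, v, p) s"

inductive_simps exec_While: "exec L x (While t c) (h, v, p) s"

abbreviation (input) "Flag \<equiv> 2 :: nat"
abbreviation (input) "Num \<equiv> 3 :: nat"
abbreviation (input) "Half \<equiv> 4 :: nat"
abbreviation (input) "Count \<equiv> 5 :: nat"
abbreviation (input) "Par \<equiv> 6 :: nat"
abbreviation (input) "Aux \<equiv> 7 :: nat"
abbreviation (input) "Row \<equiv> 8 :: nat"
abbreviation (input) "Col \<equiv> 9 :: nat"
abbreviation (input) "Row' \<equiv> 10 :: nat"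
abbreviation (input) "Col' \<equiv> 11 :: nat"
abbreviation (input) "IsR \<equiv> 12 :: nat"
abbreviation (input) "IsE \<equiv> 13 :: nat"
abbreviation (input) "Len \<equiv> 14 :: nat"
abbreviation (input) "Dim \<equiv> 15 :: nat"

text \<open>Counter 0 is never written and keeps the value 0.\<close>
abbreviation "clear i \<equiv> Copy i 0"
abbreviation "skip \<equiv> Mv 0"

text \<open>The loop variable returns to 0 at the end, so a loop leaves the counters as it found
  them whenever its body does.\<close>

definition For :: "nat \<Rightarrow> nat \<Rightarrow> com \<Rightarrow> com" where
  "For i n c = clear i ;; While (Not (Eq i n)) (c ;; Inc i) ;; clear i"

text \<open>Counter 0 and the scratch counters are 0 between the pieces of the program. Each piece
  clears what it used, so that its effect on the remaining state can be stated as an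
  equality.\<close>

definition tidy :: "(nat \<Rightarrow> nat) \<Rightarrow> bool" where
  "tidy v \<longleftrightarrow> v 0 = 0 \<and> v Num = 0 \<and> v Half = 0 \<and> v Count = 0 \<and> v Par = 0 \<and> v Row' = 0 \<and> v Col' = 0"

text \<open>The first move leaves the right end marker, which reads \<open>None\<close> like the
  left one and would stop the loop at once.\<close>

definition rewind :: com where
  "rewind = Mv (- 1) ;; While (Not (In None)) (Mv (- 1)) ;; Mv 1"

text \<open>\<open>Count\<close> climbs to \<open>Num\<close> in steps of two; \<open>Half\<close>
  counts the complete pairs and \<open>Par\<close> receives what is left over.\<close>

definition halve :: com where
  "halve = While (Not (Eq Count Num)) (Inc Count ;; If (Eq Count Num) (Inc Par) (Inc Count ;; Inc Half)) ;;
     Copy Num Half ;; clear Half ;; clear Count"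

text \<open>The symbols of the code are produced one at a time by repeated halving and handed to
  \<open>a\<close>. With \<open>expect\<close> the code is compared with the input, with
  \<open>Out\<close> it is written.\<close>

definition for_code :: "(bool \<Rightarrow> com) \<Rightarrow> nat \<Rightarrow> com" where
  "for_code a i = Copy Num i ;;
     While (Not (Eq Num 0)) (a True ;; halve ;; If (Eq Par 0) (a False) (a True) ;; clear Par) ;;
     a False ;; a False"

definition fail :: com where
  "fail = clear Flag ;; Inc Flag"

text \<open>A mismatch raises the flag and the run goes on, so nested loops need no jump to an error
  exit.\<close>

definition expect :: "bool \<Rightarrow> com" where
  "expect b = If (In (Some b)) (Mv 1) fail"

definition measure_input :: com where
  "measure_input = rewind ;; While (Not (In None)) (Mv 1 ;; Inc Len)"

text \<open>By prefix-freeness at most one candidate fits, so the search may run on after a hit.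
  Without a hit \<open>Dim\<close> stays 0 and the format check decides.\<close>

definition find_dim :: com where
  "find_dim = For Aux Len (rewind ;; clear Flag ;; for_code expect Aux ;; If (Eq Flag 0) (Copy Dim Aux) skip) ;; clear Flag"

definition expect_code :: com where
  "expect_code = Inc Par ;;
     While (In (Some True)) (Mv 1 ;; clear Par ;; If (In (Some True)) (Inc Par) skip ;; Mv 1) ;;
     expect False ;; expect False ;; If (Eq Par 0) fail skip ;; clear Par"

definition expect_bool :: com where
  "expect_bool = If (In (Some True))
     (expect True ;; expect True ;; expect False ;; expect False) (expect False ;; expect False)"

definition check_format :: com where
  "check_format = rewind ;; for_code expect Dim ;; for_code expect Dim ;; expect_code ;;
     For Row Dim (For Col Dim expect_bool) ;; For Row Dim (For Col Dim expect_bool) ;;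
     If (In None) skip fail"

definition skip_code :: com where
  "skip_code = While (In (Some True)) (Mv 1 ;; Mv 1) ;; Mv 1 ;; Mv 1"

definition skip_bool :: com where
  "skip_bool = If (In (Some True)) (Mv 1 ;; Mv 1 ;; Mv 1 ;; Mv 1) (Mv 1 ;; Mv 1)"

definition goto_cell :: com where
  "goto_cell = For Row' Row (For Col' Dim skip_bool) ;; For Col' Col skip_bool"

text \<open>Both bits of a cell are looked up anew from the left end each time, with positions kept
  only in counters. The first symbol of an \<open>enc_bool\<close> code already tells the
  bit.\<close>

definition with_cell :: "com \<Rightarrow> com" where
  "with_cell c =
     rewind ;; skip_code ;; skip_code ;; skip_code ;; goto_cell ;; If (In (Some True)) (Inc IsE) skip ;;
     rewind ;; skip_code ;; skip_code ;; skip_code ;; For Row' Dim (For Col' Dim skip_bool) ;; goto_cell ;;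
       If (In (Some True)) (Inc IsR) skip ;;
     c ;; clear IsE ;; clear IsR"

definition check_red :: com where
  "check_red = For Row Dim (For Col Dim (with_cell
     (If (Eq IsR 0) skip (If (Eq IsE 0) fail skip))))"

fun outs :: "bool list \<Rightarrow> com" where
  "outs [] = skip"
| "outs (b # bs) = Out b ;; outs bs"

definition copy_k :: com where
  "copy_k = rewind ;; skip_code ;; skip_code ;;
     While (In (Some True)) (Out True ;; Mv 1 ;; If (In (Some True)) (Out True) (Out False) ;; Mv 1) ;;
     Out False ;; Out False"

definition out_dim :: com where
  "out_dim = For Row Dim (Inc Aux ;; Inc Aux ;; Inc Aux) ;; for_code Out Aux ;; clear Aux"

definition out_matching_cell :: "nat \<Rightarrow> nat \<Rightarrow> com" where
  "out_matching_cell a b = If (Eq Row Col) (outs (enc_bool (a + b = 2))) (outs (enc_bool False))"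

text \<open>The branches follow \<open>cell_cost\<close>. In the expensive one,
  \<open>enc_nat 1\<close> tags a finite cost, \<open>enc_nat 0\<close> is the sign and
  \<open>[True, True]\<close> the lowest digit of \<open>2 * k + 1\<close> with its marker;
  \<open>copy_k\<close> supplies the other digits and the end mark.\<close>

definition out_cost_cell :: "nat \<Rightarrow> nat \<Rightarrow> com" where
  "out_cost_cell a b =
    (if b = 0 \<and> a = 0 then If (Eq IsR 0) (outs (enc_cost None)) (outs (enc_cost (Some 1)))
     else if b = 0 \<and> a = 1 then If (Eq IsE 0) (outs (enc_cost None))
       (If (Eq IsR 0) (outs (enc_cost (Some 0))) (outs (enc_cost None)))
     else if b = 1 \<and> a \<noteq> 2 \<or> b = 2 \<and> a = 2 then If (Eq Row Col) (outs (enc_cost (Some 0))) (outs (enc_cost None))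
     else if a + b = 2 then If (Eq Row Col)
       (outs (enc_nat 1 @ enc_nat 0 @ [True, True]) ;; copy_k) (outs (enc_cost None))
     else outs (enc_cost None))"

definition out_matrix :: "(nat \<Rightarrow> com) \<Rightarrow> com" where
  "out_matrix r = For Row Dim (For Col Dim (r 0) ;; For Col Dim (r 1) ;; For Col Dim (r 2))"

text \<open>The isolated \<open>enc_nat 0\<close> is the sign of the budget, which together with the
  second copy of the code of \<open>k\<close> forms the code of \<open>int k\<close>.\<close>

definition out_instance :: com where
  "out_instance = out_dim ;; copy_k ;; outs (enc_nat 0) ;; copy_k ;;
     out_matrix (\<lambda>a. out_matching_cell a 0 ;; out_matching_cell a 1 ;; out_matching_cell a 2) ;;
     out_matrix (\<lambda>a. with_cell (out_cost_cell a 0 ;; out_cost_cell a 1 ;; out_cost_cell a 2))"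

text \<open>Nothing is written before both checks have passed, so a rejected input leaves the output
  \<open>[]\<close>.\<close>

definition reduction :: com where
  "reduction = measure_input ;; find_dim ;; check_format ;;
     If (Eq Flag 0) (check_red ;; If (Eq Flag 0) out_instance skip) skip"

text \<open>The factor 3 makes room for the dimension \<open>3 * n\<close> of the new instance; the
  summand 1 lets flags be raised on the empty input as well.\<close>

locale bounded_run =
  fixes x :: "bool list" and L :: nat
  assumes L: "3 * length x + 1 \<le> L"
begin

section \<open>Weakest preconditions of counter programs\<close>

definition wp :: "com \<Rightarrow> state \<Rightarrow> (state \<Rightarrow> bool) \<Rightarrow> bool" where
  "wp c s Q \<longleftrightarrow> (\<exists>s'. exec L x c s s' \<and> Q s')"

lemma wp_mono: "wp c s Q \<Longrightarrow> (\<And>s'. Q s' \<Longrightarrow> Q' s') \<Longrightarrow> wp c s Q'"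
  unfolding wp_def by blast

lemma wp_simps [simp]:
  "wp (Out b) (h, v, p) Q \<longleftrightarrow> Q (h, v, p @ [b])"
  "wp (Mv d) (h, v, p) Q \<longleftrightarrow> Q (min (length x + 1) (move h d), v, p)"
  "i < nvars \<Longrightarrow> wp (Inc i) (h, v, p) Q \<longleftrightarrow> v i < L \<and> Q (h, v(i := Suc (v i)), p)"
  "i < nvars \<Longrightarrow> j < nvars \<Longrightarrow> wp (Copy i j) (h, v, p) Q \<longleftrightarrow> Q (h, v(i := v j), p)"
  "wp (c1 ;; c2) s Q \<longleftrightarrow> wp c1 s (\<lambda>s'. wp c2 s' Q)"
  "wf_test t \<Longrightarrow> wp (If t c1 c2) (h, v, p) Q \<longleftrightarrow> (if holds x t h v then wp c1 (h, v, p) Q else wp c2 (h, v, p) Q)"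
  by (auto simp: wp_def exec_simps) blast+

lemma wp_While:
  "wf_test t \<Longrightarrow> wp (While t c) (h, v, p) Q \<longleftrightarrow>
    (if holds x t h v then wp c (h, v, p) (\<lambda>s. wp (While t c) s Q) else Q (h, v, p))"
  unfolding wp_def by (subst exec_While) (auto, blast+)

declare nvars_def [simp]

text \<open>\<open>I k\<close> describes the state with loop variable \<open>k\<close>. The body has
  to preserve that variable and to establish \<open>I (Suc k)\<close> for the state after the
  increment; \<open>m \<le> L\<close> pays for the increments.\<close>

lemma wp_For:
  assumes "i < nvars" "n < nvars" "i \<noteq> n" "i \<noteq> 0" "m \<le> L"
    and vars: "\<And>k h v p. I k (h, v, p) \<Longrightarrow> v i = k \<and> v n = m \<and> v 0 = 0"
    and init: "v 0 = 0" "I 0 (h, v(i := 0), p)"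
    and step: "\<And>k h v p. k < m \<Longrightarrow> I k (h, v, p) \<Longrightarrow>
      wp c (h, v, p) (\<lambda>(h, v, p). v i = k \<and> I (Suc k) (h, v(i := Suc k), p))"
    and final: "\<And>h v p. I m (h, v, p) \<Longrightarrow> Q (h, v(i := 0), p)"
  shows "wp (For i n c) (h, v, p) Q"
proof -
  let ?w = "While (Not (Eq i n)) (c ;; Inc i)"
  have loop: "k \<le> m \<Longrightarrow> I k (h, v, p) \<Longrightarrow> wp ?w (h, v, p) (\<lambda>(h, v, p). v 0 = 0 \<and> Q (h, v(i := 0), p))" for k h v p
  proof (induction "m - k" arbitrary: k h v p)
    case 0
    then have "k = m" by simp
    with 0 vars[of k h v p] final assms(1-4) show ?case by (subst wp_While) auto
  next
    case (Suc d)
    then have k: "k < m" by simp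
    have "wp c (h, v, p) (\<lambda>(h, v, p). v i < L \<and> wp ?w (h, v(i := Suc (v i)), p) (\<lambda>(h, v, p). v 0 = 0 \<and> Q (h, v(i := 0), p)))"
      by (rule wp_mono[OF step[OF k Suc(4)]]) (use Suc(1)[of "Suc k"] Suc(2) k \<open>m \<le> L\<close> in auto)
    then have "wp (c ;; Inc i) (h, v, p) (\<lambda>s. wp ?w s (\<lambda>(h, v, p). v 0 = 0 \<and> Q (h, v(i := 0), p)))"
      unfolding wp_simps(5) by (rule wp_mono) (use assms(1) in auto)
    then show ?case using vars[OF Suc(4)] k assms(1-4) by (subst wp_While) auto
  qed
  have "wp ?w (h, v(i := 0), p) (\<lambda>s. wp (clear i) s Q)"
    by (rule wp_mono[OF loop[OF _ init(2)]]) (use assms(1-4) vars in \<open>auto split: prod.splits\<close>)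
  then show ?thesis using assms(1-4) init by (simp add: For_def)
qed

lemma wp_skip [simp]: "h \<le> length x + 1 \<Longrightarrow> wp skip (h, v, p) Q \<longleftrightarrow> Q (h, v, p)"
  by simp

lemma wp_rewind: "h \<le> length x + 1 \<Longrightarrow> wp rewind (h, v, p) Q \<longleftrightarrow> Q (Suc 0, v, p)"
proof -
  have loop: "h \<le> length x \<Longrightarrow> wp (While (Not (In None)) (Mv (- 1))) (h, v, p) Q \<longleftrightarrow> Q (0, v, p)" for h Q
    by (induction h; subst wp_While) (auto simp: inp_def)
  assume "h \<le> length x + 1"
  then show ?thesis by (simp add: rewind_def loop)
qed

lemma wp_halve:
  assumes "v 0 = 0" "v Half = 0" "v Count = 0" "v Par = 0" "v Num \<le> L"
  shows "wp halve (h, v, p) Q \<longleftrightarrow> Q (h, v(Num := v Num div 2, Par := v Num mod 2), p)"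
proof -
  let ?w = "While (Not (Eq Count Num)) (Inc Count ;; If (Eq Count Num) (Inc Par) (Inc Count ;; Inc Half))"
  \<comment> \<open>\<open>q\<close> pairs have been counted so far. The next round finds nothing
    left, a single unit, which becomes the parity, or another pair.\<close>
  have loop: "2 * q \<le> v Num \<Longrightarrow> wp ?w (h, v(Half := q, Count := 2 * q), p) Q \<longleftrightarrow>
      Q (h, v(Half := v Num div 2, Count := v Num, Par := v Num mod 2), p)" for q Q
  proof (induction "v Num - 2 * q" arbitrary: q rule: less_induct)
    case less
    consider "v Num = 2 * q" | "v Num = 2 * q + 1" | "2 * q + 2 \<le> v Num" using less by linarith
    then show ?case
    proof cases
      case 1
      moreover have "v(Half := q, Count := 2 * q, Par := 0) = v(Half := q, Count := 2 * q)"
        using assms(4) by (auto simp: fun_eq_iff)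
      ultimately show ?thesis by (subst wp_While) auto
    next
      case 2
      have "wp ?w (h, v(Half := q, Count := v Num, Par := 1), p) Q \<longleftrightarrow> Q (h, v(Half := q, Count := v Num, Par := 1), p)"
        by (subst wp_While) auto
      with 2 assms show ?thesis by (subst wp_While) (auto simp: fun_upd_twist)
    next
      case 3
      with assms less(1)[of "Suc q"] show ?thesis by (subst wp_While) (auto simp: fun_upd_twist)
    qed
  qed
  have "v(Half := 0, Count := 0) = v" using assms by (auto simp: fun_eq_iff)
  with loop[of 0] have "wp ?w (h, v, p) Q \<longleftrightarrow> Q (h, v(Half := v Num div 2, Count := v Num, Par := v Num mod 2), p)" for Q
    by (simp only: mult_0_right le0)
  moreover have "v(Half := v Num div 2, Count := v Num, Par := v Num mod 2, Num := v Num div 2, Half := 0, Count := 0)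
      = v(Num := v Num div 2, Par := v Num mod 2)"
    using assms by (auto simp: fun_eq_iff)
  ultimately show ?thesis using assms by (simp add: halve_def)
qed

section \<open>Effects as relations between head position, flag and output\<close>

type_synonym rel = "nat \<times> nat \<times> bool list \<Rightarrow> nat \<times> nat \<times> bool list \<Rightarrow> bool"

text \<open>All counters but the flag are restored, so an effect is a relation on head position,
  flag and output, and sequencing becomes composition of relations. The flag is arbitrary at the
  start, since an earlier check may have failed.\<close>

definition act :: "(nat \<Rightarrow> nat) \<Rightarrow> com \<Rightarrow> rel \<Rightarrow> bool" where
  "act v c K \<longleftrightarrow> (\<forall>h f p. 1 \<le> h \<longrightarrow> h \<le> length x + 1 \<longrightarrow>
    wp c (h, v(Flag := f), p) (\<lambda>(h', v', p'). 1 \<le> h' \<and> h' \<le> length x + 1 \<and>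
      (\<exists>f'. v' = v(Flag := f') \<and> K (h, f, p) (h', f', p'))))"

lemma actI:
  assumes "\<And>h f p. 1 \<le> h \<Longrightarrow> h \<le> length x + 1 \<Longrightarrow>
    wp c (h, v(Flag := f), p) (\<lambda>(h', v', p'). 1 \<le> h' \<and> h' \<le> length x + 1 \<and>
      (\<exists>f'. v' = v(Flag := f') \<and> K (h, f, p) (h', f', p')))"
  shows "act v c K"
  using assms by (simp add: act_def)

lemma actD:
  assumes "act v c K" "1 \<le> h" "h \<le> length x + 1"
    and "\<And>h' f' p'. 1 \<le> h' \<Longrightarrow> h' \<le> length x + 1 \<Longrightarrow> K (h, f, p) (h', f', p') \<Longrightarrow> Q (h', v(Flag := f'), p')"
  shows "wp c (h, v(Flag := f), p) Q"
proof -
  have "wp c (h, v(Flag := f), p) (\<lambda>(h', v', p'). 1 \<le> h' \<and> h' \<le> length x + 1 \<and>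
      (\<exists>f'. v' = v(Flag := f') \<and> K (h, f, p) (h', f', p')))"
    using assms(1-3) by (simp add: act_def)
  then show ?thesis by (rule wp_mono) (use assms(4) in auto)
qed

lemma act_Seq:
  assumes "act v c1 K1" "act v c2 K2" "\<And>s s' s''. K1 s s' \<Longrightarrow> K2 s' s'' \<Longrightarrow> K s s''"
  shows "act v (c1 ;; c2) K"
proof (rule actI)
  fix h f p assume "1 \<le> h" "h \<le> length x + 1"
  then show "wp (c1 ;; c2) (h, v(Flag := f), p) (\<lambda>(h', v', p'). 1 \<le> h' \<and> h' \<le> length x + 1 \<and>
      (\<exists>f'. v' = v(Flag := f') \<and> K (h, f, p) (h', f', p')))"
    unfolding wp_simps(5)
    by (intro actD[OF assms(1)] actD[OF assms(2)]) (use assms(3) in blast)+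
qed

lemma act_mono:
  assumes "act v c K" "\<And>s s'. K s s' \<Longrightarrow> K' s s'"
  shows "act v c K'"
  by (rule actI, rule actD[OF assms(1)]) (use assms(2) in auto)

lemma act_If:
  assumes "i < nvars" "j < nvars" "i \<noteq> Flag" "j \<noteq> Flag"
    and "v i = v j \<Longrightarrow> act v c1 K" "v i \<noteq> v j \<Longrightarrow> act v c2 K"
  shows "act v (If (Eq i j) c1 c2) K"
  using assms by (cases "v i = v j") (auto simp: act_def)

text \<open>\<open>K k\<close> is the effect of round \<open>k\<close> and \<open>R k\<close> that
  of the first \<open>k\<close> rounds together.\<close>

lemma act_For:
  assumes "i < nvars" "n < nvars" "i \<noteq> n" "i \<noteq> 0" "i \<noteq> Flag" "n \<noteq> Flag" "v 0 = 0" "v i = 0" "v n \<le> L"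
    and init: "\<And>s. R 0 s s" and step: "\<And>k. k < v n \<Longrightarrow> act (v(i := k)) c (K k)"
    and comp: "\<And>k s s' s''. k < v n \<Longrightarrow> R k s s' \<Longrightarrow> K k s' s'' \<Longrightarrow> R (Suc k) s s''"
  shows "act v (For i n c) (R (v n))"
proof (rule actI)
  fix h0 f0 p0 assume h0: "1 \<le> h0" "h0 \<le> length x + 1"
  let ?I = "\<lambda>k (h, v', p). 1 \<le> h \<and> h \<le> length x + 1 \<and> (\<exists>f. v' = v(i := k, Flag := f) \<and> R k (h0, f0, p0) (h, f, p))"
  show "wp (For i n c) (h0, v(Flag := f0), p0) (\<lambda>(h', v', p'). 1 \<le> h' \<and> h' \<le> length x + 1 \<and>
      (\<exists>f'. v' = v(Flag := f') \<and> R (v n) (h0, f0, p0) (h', f', p')))"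
  proof (rule wp_For[where I = ?I and m = "v n"])
    fix k h v' p assume k: "k < v n" and "?I k (h, v', p)"
    then obtain f where f: "1 \<le> h" "h \<le> length x + 1" "v' = v(i := k, Flag := f)" "R k (h0, f0, p0) (h, f, p)"
      by auto
    have tw: "v(i := k, Flag := f, i := Suc k) = v(i := Suc k, Flag := f)" for f
      using assms by (auto simp: fun_eq_iff)
    show "wp c (h, v', p) (\<lambda>(h, v, p). v i = k \<and> ?I (Suc k) (h, v(i := Suc k), p))"
      unfolding f(3)
      by (rule actD[OF step[OF k] f(1,2)]) (use comp[OF k f(4)] assms in \<open>auto simp: tw\<close>)
  next
    fix h v' p assume "?I (v n) (h, v', p)"
    then show "case (h, v'(i := 0), p) of (h', v', p') \<Rightarrow> 1 \<le> h' \<and> h' \<le> length x + 1 \<and>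
      (\<exists>f'. v' = v(Flag := f') \<and> R (v n) (h0, f0, p0) (h', f', p'))"
      using assms by (auto simp: fun_upd_twist) (metis fun_upd_triv fun_upd_twist)
  next
    show "?I 0 (h0, (v(Flag := f0))(i := 0), p0)"
      using assms h0 init by (auto simp: fun_upd_twist)
  qed (use assms in auto)
qed

fun chain :: "(bool \<Rightarrow> rel) \<Rightarrow> bool list \<Rightarrow> rel" where
  "chain K [] s s' \<longleftrightarrow> s' = s"
| "chain K (b # bs) s s'' \<longleftrightarrow> (\<exists>s'. K b s s' \<and> chain K bs s' s'')"

lemma chain_append: "chain K (bs @ bs') s s'' \<longleftrightarrow> (\<exists>s'. chain K bs s s' \<and> chain K bs' s' s'')"
  by (induction bs arbitrary: s) (simp, simp del: split_paired_Ex, blast)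

text \<open>\<open>Num\<close> and \<open>Par\<close> hold intermediate values while
  \<open>a\<close> runs, so the effect of \<open>a\<close> is required for all counter states in
  which counter 0 is 0. \<open>Par < i\<close> keeps the encoded counter apart from the flag and the
  scratch counters.\<close>

lemma act_for_code:
  assumes "tidy v" "Par < i" "i < nvars" "v i \<le> L"
    and a: "\<And>b v. v 0 = 0 \<Longrightarrow> act v (a b) (K b)"
  shows "act v (for_code a i) (chain K (enc_nat (v i)))"
proof (rule actI)
  fix h f p assume h: "1 \<le> h" "h \<le> length x + 1"
  let ?c = "\<lambda>t. concat (map (\<lambda>b. [True, b]) (bits t))"
  let ?w = "While (Not (Eq Num 0)) (a True ;; halve ;; If (Eq Par 0) (a False) (a True) ;; clear Par)"
  have v: "v 0 = 0" "v Num = 0" "v Half = 0" "v Count = 0" "v Par = 0"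
    using assms(1) by (auto simp: tidy_def)
  have loop: "1 \<le> h \<Longrightarrow> h \<le> length x + 1 \<Longrightarrow> t \<le> L \<Longrightarrow>
    (\<And>h' f' p'. 1 \<le> h' \<Longrightarrow> h' \<le> length x + 1 \<Longrightarrow> chain K (?c t) (h, f, p) (h', f', p') \<Longrightarrow> Q (h', v(Flag := f'), p')) \<Longrightarrow>
    wp ?w (h, v(Num := t, Flag := f), p) Q" for t h f p Q
  proof (induction t arbitrary: h f p rule: less_induct)
    case (less t)
    show ?case
    proof (cases "t = 0")
      case True
      then have "Q (h, v(Flag := f), p)"
        using less.prems(1,2) by (intro less.prems(4)) auto
      moreover have eq: "v(Num := 0, Flag := f) = v(Flag := f)" using v by (auto simp: fun_eq_iff)
      moreover have "wp ?w (h, v(Num := 0, Flag := f), p) Q \<longleftrightarrow> Q (h, v(Num := 0, Flag := f), p)"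
        using v by (subst wp_While) simp_all
      ultimately show ?thesis by (simp only: True eq)
    next
      case False
      then have bits: "?c t = True # odd t # ?c (t div 2)"
        using bits_pos[of t] by (simp only: neq0_conv) simp
      let ?v1 = "v(Num := t)" and ?v2 = "v(Num := t div 2, Par := t mod 2)"
      have "wp (a True) (h, ?v1(Flag := f), p) (\<lambda>s. wp halve s (\<lambda>s. wp (If (Eq Par 0) (a False) (a True)) s
          (\<lambda>s. wp (clear Par) s (\<lambda>s. wp ?w s Q))))"
      proof (rule actD[OF a less.prems(1,2)])
        fix h1 f1 p1 assume 1: "1 \<le> h1" "h1 \<le> length x + 1" "K True (h, f, p) (h1, f1, p1)"
        have "wp (a (odd t)) (h1, ?v2(Flag := f1), p1) (\<lambda>s. wp (clear Par) s (\<lambda>s. wp ?w s Q))"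
        proof (rule actD[OF a 1(1,2)])
          fix h2 f2 p2 assume 2: "1 \<le> h2" "h2 \<le> length x + 1" "K (odd t) (h1, f1, p1) (h2, f2, p2)"
          have K: "chain K (?c t) (h, f, p) s" if "chain K (?c (t div 2)) (h2, f2, p2) s" for s
            unfolding bits chain.simps using that 1(3) 2(3) by blast
          have "wp ?w (h2, v(Num := t div 2, Flag := f2), p2) Q"
          proof (rule less.IH[OF _ 2(1,2)])
            show "t div 2 < t" "t div 2 \<le> L" using False less.prems(3) by simp_all
          qed (rule less.prems(4)[OF _ _ K])
          moreover have "?v2(Flag := f2, Par := 0) = v(Num := t div 2, Flag := f2)"
            using v by (auto simp: fun_eq_iff)
          ultimately show "wp (clear Par) (h2, ?v2(Flag := f2), p2) (\<lambda>s. wp ?w s Q)"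
            using v by simp
        qed (use v in simp)
        then have "wp (If (Eq Par 0) (a False) (a True)) (h1, ?v2(Flag := f1), p1)
            (\<lambda>s. wp (clear Par) s (\<lambda>s. wp ?w s Q))"
          using v by (auto simp: mod2_eq_if split: if_splits)
        moreover have "?v1(Flag := f1, Num := t div 2, Par := t mod 2) = ?v2(Flag := f1)"
          by (auto simp: fun_eq_iff)
        ultimately show "wp halve (h1, ?v1(Flag := f1), p1) (\<lambda>s. wp (If (Eq Par 0) (a False) (a True)) s
          (\<lambda>s. wp (clear Par) s (\<lambda>s. wp ?w s Q)))"
          using v less.prems(3) by (subst wp_halve) auto
      qed (use v in simp)
      with False v show ?thesis by (subst wp_While) auto
    qed
  qed
  let ?Q = "\<lambda>(h', v', p'). 1 \<le> h' \<and> h' \<le> length x + 1 \<and>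
      (\<exists>f'. v' = v(Flag := f') \<and> chain K (enc_nat (v i)) (h, f, p) (h', f', p'))"
  have "wp ?w (h, v(Num := v i, Flag := f), p) (\<lambda>s. wp (a False) s (\<lambda>s. wp (a False) s ?Q))"
  proof (rule loop[OF h assms(4)])
    fix h1 f1 p1 assume 1: "1 \<le> h1" "h1 \<le> length x + 1" "chain K (?c (v i)) (h, f, p) (h1, f1, p1)"
    show "wp (a False) (h1, v(Flag := f1), p1) (\<lambda>s. wp (a False) s ?Q)"
    proof (intro actD[OF a] 1)
      fix h2 f2 p2 h3 f3 p3
      assume "1 \<le> h3" "h3 \<le> length x + 1" "K False (h1, f1, p1) (h2, f2, p2)" "K False (h2, f2, p2) (h3, f3, p3)"
      moreover from this have "chain K (enc_nat (v i)) (h, f, p) (h3, f3, p3)"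
        unfolding enc_nat_def chain_append chain.simps using 1(3) by blast
      ultimately show "?Q (h3, v(Flag := f3), p3)" by blast
    qed (use v in auto)
  qed
  moreover have "v(Flag := f, Num := v i) = v(Num := v i, Flag := f)"
    by (auto simp: fun_eq_iff)
  ultimately show "wp (for_code a i) (h, v(Flag := f), p) ?Q"
    using assms by (simp add: for_code_def)
qed

text \<open>Parsing as an equivalence of membership questions: with the flag down, the rest of the
  input lies in \<open>A\<close> before exactly if it lies in \<open>B\<close> afterwards. Once the
  flag is up both sides are false, so failures compose like successes.\<close>

definition accepts :: "bool list set \<Rightarrow> bool list set \<Rightarrow> rel" where
  "accepts A B = (\<lambda>(h, f, p) (h', f', p'). p' = p \<and>
    (f = 0 \<and> drop (h - 1) x \<in> A \<longleftrightarrow> f' = 0 \<and> drop (h' - 1) x \<in> B))"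

text \<open>Quantified over the continuation, so that one relation describes reading
  \<open>b\<close> at every place in a code.\<close>

definition consumes :: "bool \<Rightarrow> rel" where
  "consumes b s s' \<longleftrightarrow> (\<forall>A. accepts ((#) b ` A) A s s')"

lemma accepts_trans: "accepts A B s s' \<Longrightarrow> accepts B C s' s'' \<Longrightarrow> accepts A C s s''"
  by (auto simp: accepts_def)

lemma accepts_refl: "accepts A A s s"
  by (auto simp: accepts_def)

lemma act_accepts_Seq: "act v c1 (accepts A B) \<Longrightarrow> act v c2 (accepts B C) \<Longrightarrow> act v (c1 ;; c2) (accepts A C)"
  by (erule act_Seq, assumption, erule accepts_trans)

lemma chain_consumes: "chain consumes ys s s' \<Longrightarrow> accepts ((@) ys ` A) A s s'"
proof (induction ys arbitrary: s)
  case Nil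
  then show ?case by (simp add: accepts_refl)
next
  case (Cons y ys)
  then obtain s1 where "consumes y s s1" "accepts ((@) ys ` A) A s1 s'"
    unfolding chain.simps by blast
  moreover have "(@) (y # ys) ` A = (#) y ` ((@) ys ` A)" by (auto simp: image_image)
  ultimately show ?case unfolding consumes_def using accepts_trans by metis
qed

lemma inp_drop: "1 \<le> h \<Longrightarrow> inp x h = (case drop (h - 1) x of [] \<Rightarrow> None | y # _ \<Rightarrow> Some y)"
  by (cases "h - 1 < length x") (auto simp: inp_def Cons_nth_drop_Suc[symmetric])

lemma drop_pred_Cons: "1 \<le> h \<Longrightarrow> drop (h - 1) x = y # ys \<Longrightarrow> drop h x = ys \<and> h \<le> length x"
proof (cases h)
  case (Suc n)
  assume "drop (h - 1) x = y # ys"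
  moreover have "length (drop (h - 1) x) = length x - n" "drop h x = tl (drop (h - 1) x)"
    using Suc by (auto simp: drop_Suc tl_drop)
  ultimately show ?thesis using Suc by auto
qed simp

lemma act_fail: "v 0 = 0 \<Longrightarrow> act v fail (\<lambda>(h, f, p) (h', f', p'). f' \<noteq> 0 \<and> p' = p)"
  by (rule actI) (use L in \<open>auto simp: fail_def\<close>)

lemma act_skip: "act v skip (=)"
  by (rule actI) auto

lemma act_consumes: "v 0 = 0 \<Longrightarrow> act v (expect b) (consumes b)"
proof (rule actI)
  fix h f p assume v: "v 0 = 0" and h: "1 \<le> h" "h \<le> length x + 1"
  show "wp (expect b) (h, v(Flag := f), p) (\<lambda>(h', v', p'). 1 \<le> h' \<and> h' \<le> length x + 1 \<and>
    (\<exists>f'. v' = v(Flag := f') \<and> consumes b (h, f, p) (h', f', p')))"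
  proof (cases "inp x h = Some b")
    case True
    then obtain w where w: "drop (h - 1) x = b # w"
      using h by (auto simp: inp_drop split: list.splits)
    then have "drop h x = w" "h \<le> length x" using drop_pred_Cons h by blast+
    with True w h show ?thesis
      by (auto simp: expect_def consumes_def accepts_def)
  next
    case False
    then have "drop (h - 1) x \<notin> (#) b ` A" for A
      using h by (auto simp: inp_drop)
    with False h v L show ?thesis
      by (auto simp: expect_def fail_def consumes_def accepts_def)
  qed
qed

lemma act_expect: "v 0 = 0 \<Longrightarrow> act v (expect b) (accepts ((#) b ` A) A)"
  by (rule act_mono[OF act_consumes]) (auto simp: consumes_def)

lemma act_If_In:
  assumes "act v c1 K1" "act v c2 K2"
    and "\<And>h f p s'. 1 \<le> h \<Longrightarrow> h \<le> length x + 1 \<Longrightarrow> inp x h = a \<Longrightarrow> K1 (h, f, p) s' \<Longrightarrow> K (h, f, p) s'"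
    and "\<And>h f p s'. 1 \<le> h \<Longrightarrow> h \<le> length x + 1 \<Longrightarrow> inp x h \<noteq> a \<Longrightarrow> K2 (h, f, p) s' \<Longrightarrow> K (h, f, p) s'"
  shows "act v (If (In a) c1 c2) K"
proof (rule actI)
  fix h f p assume h: "1 \<le> h" "h \<le> length x + 1"
  show "wp (If (In a) c1 c2) (h, v(Flag := f), p) (\<lambda>(h', v', p'). 1 \<le> h' \<and> h' \<le> length x + 1 \<and>
    (\<exists>f'. v' = v(Flag := f') \<and> K (h, f, p) (h', f', p')))"
  proof (cases "inp x h = a")
    case True
    then have "wp c1 (h, v(Flag := f), p) (\<lambda>(h', v', p'). 1 \<le> h' \<and> h' \<le> length x + 1 \<and>
      (\<exists>f'. v' = v(Flag := f') \<and> K (h, f, p) (h', f', p')))"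
      by (intro actD[OF assms(1) h]) (use assms(3)[OF h] in auto)
    with True show ?thesis by simp
  next
    case False
    then have "wp c2 (h, v(Flag := f), p) (\<lambda>(h', v', p'). 1 \<le> h' \<and> h' \<le> length x + 1 \<and>
      (\<exists>f'. v' = v(Flag := f') \<and> K (h, f, p) (h', f', p')))"
      by (intro actD[OF assms(2) h]) (use assms(4)[OF h] in auto)
    with False show ?thesis by simp
  qed
qed

lemma act_expect_bool:
  assumes "v 0 = 0"
  shows "act v expect_bool (accepts {enc_bool b @ w | b w. w \<in> A} A)"
  unfolding expect_bool_def
proof (rule act_If_In)
  show "act v (expect True ;; expect True ;; expect False ;; expect False)
      (accepts ((#) True ` (#) True ` (#) False ` (#) False ` A) A)"
    by (rule act_accepts_Seq act_expect assms)+
  show "act v (expect False ;; expect False) (accepts ((#) False ` (#) False ` A) A)"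
    by (rule act_accepts_Seq act_expect assms)+
  have set: "{enc_bool b @ w | b w. w \<in> A} =
      (#) True ` (#) True ` (#) False ` (#) False ` A \<union> (#) False ` (#) False ` A"
  proof -
    have "{enc_bool b @ w | b w. w \<in> A} = (\<Union>b. (@) (enc_bool b) ` A)" by auto
    then show ?thesis by (simp add: UNIV_bool enc_bool_simps image_image Un_commute)
  qed
  fix h f :: nat and p :: "bool list" and s' assume h: "1 \<le> h"
  show "accepts {enc_bool b @ w | b w. w \<in> A} A (h, f, p) s'" if "inp x h = Some True"
      "accepts ((#) True ` (#) True ` (#) False ` (#) False ` A) A (h, f, p) s'"
  proof -
    have "drop (h - 1) x \<notin> (#) False ` (#) False ` A" using that(1) h by (auto simp: inp_drop)
    with that(2) show ?thesis unfolding set by (auto simp: accepts_def)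
  qed
  show "accepts {enc_bool b @ w | b w. w \<in> A} A (h, f, p) s'" if "inp x h \<noteq> Some True"
      "accepts ((#) False ` (#) False ` A) A (h, f, p) s'"
  proof -
    have "drop (h - 1) x \<notin> (#) True ` (#) True ` (#) False ` (#) False ` A" using that(1) h by (auto simp: inp_drop)
    with that(2) show ?thesis unfolding set by (auto simp: accepts_def)
  qed
qed

lemma act_expect_row:
  assumes "v 0 = 0" "v Col = 0" "v Dim \<le> L"
  shows "act v (For Col Dim expect_bool) (accepts (bool_rows (v Dim + t) A) (bool_rows t A))"
proof -
  let ?n = "v Dim"
  have "act v (For Col Dim expect_bool) (accepts (bool_rows (?n + t) A) (bool_rows (?n - ?n + t) A))"
  proof (rule act_For[where R = "\<lambda>k. accepts (bool_rows (?n + t) A) (bool_rows (?n - k + t) A)"])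
    fix k assume "k < ?n"
    then have "?n - k + t = Suc (?n - Suc k + t)" by simp
    then have *: "bool_rows (?n - k + t) A = {enc_bool b @ w | b w. w \<in> bool_rows (?n - Suc k + t) A}"
      by (simp only: bool_rows_Suc)
    show "act (v(Col := k)) expect_bool (accepts (bool_rows (?n - k + t) A) (bool_rows (?n - Suc k + t) A))"
      unfolding * by (rule act_expect_bool) (use assms in simp)
  qed (use assms in \<open>auto intro: accepts_trans accepts_refl\<close>)
  then show ?thesis by simp
qed

lemma act_expect_matrix:
  assumes "v 0 = 0" "v Row = 0" "v Col = 0" "v Dim \<le> L"
  shows "act v (For Row Dim (For Col Dim expect_bool)) (accepts (bool_rows (v Dim * v Dim) A) A)"
proof -
  let ?n = "v Dim"
  have "act v (For Row Dim (For Col Dim expect_bool)) (accepts (bool_rows (?n * ?n) A) (bool_rows ((?n - ?n) * ?n) A))"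
  proof (rule act_For[where R = "\<lambda>k. accepts (bool_rows (?n * ?n) A) (bool_rows ((?n - k) * ?n) A)"])
    fix k assume "k < ?n"
    then have *: "(?n - k) * ?n = ?n + (?n - Suc k) * ?n"
      by (metis Suc_diff_Suc mult_Suc)
    show "act (v(Row := k)) (For Col Dim expect_bool)
        (accepts (bool_rows ((?n - k) * ?n) A) (bool_rows ((?n - Suc k) * ?n) A))"
      using act_expect_row[of "v(Row := k)" "(?n - Suc k) * ?n" A] assms unfolding * by simp
  qed (use assms in \<open>auto intro: accepts_trans accepts_refl\<close>)
  then show ?thesis by simp
qed

lemma act_expect_code:
  assumes "v 0 = 0" "v Par = 0"
  shows "act v expect_code (accepts {enc_nat k @ w | k w. w \<in> A} A)"
proof (rule actI)
  fix h f p assume h: "1 \<le> h" "h \<le> length x + 1"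
  let ?w = "While (In (Some True)) (Mv 1 ;; clear Par ;; If (In (Some True)) (Inc Par) skip ;; Mv 1)"
  let ?B = "(#) False ` (#) False ` A"
  \<comment> \<open>At every turn the original question equals membership of the rest in
    \<open>code_rest\<close> for the bit remembered in \<open>Par\<close>; at the exit only the end
    mark and the test of that bit are left.\<close>
  have loop: "1 \<le> h \<Longrightarrow> h \<le> length x + 1 \<Longrightarrow>
    (\<And>h' q'. 1 \<le> h' \<Longrightarrow> h' \<le> length x + 1 \<Longrightarrow>
       (drop (h - 1) x \<in> code_rest (q \<noteq> 0) A \<longleftrightarrow> q' \<noteq> 0 \<and> drop (h' - 1) x \<in> ?B) \<Longrightarrow>
       Q (h', v(Par := q', Flag := f), p)) \<Longrightarrow>
    wp ?w (h, v(Par := q, Flag := f), p) Q" for h q :: nat and Q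
  proof (induction "length x + 1 - h" arbitrary: h q rule: less_induct)
    case less
    note h = less.prems(1,2) and Q = less.prems(3)
    show ?case
    proof (cases "drop (h - 1) x")
      case Nil
      then have "wp ?w (h, v(Par := q, Flag := f), p) Q \<longleftrightarrow> Q (h, v(Par := q, Flag := f), p)"
        using h by (subst wp_While) (auto simp: inp_drop)
      moreover have "Q (h, v(Par := q, Flag := f), p)"
        by (rule Q[OF h]) (use Nil in \<open>simp add: code_rest_simps image_iff\<close>)
      ultimately show ?thesis by blast
    next
      case (Cons a w)
      show ?thesis
      proof (cases a)
        case False
        then have "wp ?w (h, v(Par := q, Flag := f), p) Q \<longleftrightarrow> Q (h, v(Par := q, Flag := f), p)"
          using h Cons by (subst wp_While) (auto simp: inp_drop)
        moreover have "Q (h, v(Par := q, Flag := f), p)"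
          by (rule Q[OF h]) (use False Cons in \<open>simp add: code_rest_simps(4)\<close>)
        ultimately show ?thesis by blast
      next
        case True
        have d1: "drop h x = w" "h \<le> length x" using drop_pred_Cons[OF h(1) Cons] by auto
        \<comment> \<open>The minimum covers an input that ends right after a marker
          \<open>True\<close>: the bit then counts as 0 and the head stays at the end, where no code
          can be completed.\<close>
        define h2 where "h2 = min (length x + 1) (Suc (Suc h))"
        define q2 :: nat where "q2 = of_bool (inp x (Suc h) = Some True)"
        have "v(Par := q, Flag := f, Par := 0) = v(Par := 0, Flag := f)"
          "v(Par := 0, Flag := f, Par := Suc 0) = v(Par := 1, Flag := f)"
          by (auto simp: fun_eq_iff)
        then have step: "wp ?w (h, v(Par := q, Flag := f), p) Q \<longleftrightarrow> wp ?w (h2, v(Par := q2, Flag := f), p) Q"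
          using h Cons True d1 assms L
          by (subst wp_While) (auto simp: inp_drop[of h] q2_def h2_def)
        have iff: "drop (h - 1) x \<in> code_rest (q \<noteq> 0) A \<longleftrightarrow> drop (h2 - 1) x \<in> code_rest (q2 \<noteq> 0) A"
        proof (cases w)
          case Nil
          then show ?thesis using Cons True d1 by (simp add: code_rest_simps h2_def min_def)
        next
          case (Cons c w')
          have d2: "drop (Suc h) x = w'" "Suc h \<le> length x"
            using drop_pred_Cons[of "Suc h" c w'] d1 Cons by auto
          then have "q2 = of_bool c" using inp_drop[of "Suc h"] d1 Cons by (simp add: q2_def)
          then show ?thesis using d2 \<open>drop (h - 1) x = a # w\<close> True Cons
            by (simp add: code_rest_simps h2_def)
        qed
        have "wp ?w (h2, v(Par := q2, Flag := f), p) Q"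
        proof (rule less.hyps)
          show "length x + 1 - h2 < length x + 1 - h" "1 \<le> h2" "h2 \<le> length x + 1"
            using d1 by (auto simp: h2_def)
        qed (use Q iff in auto)
        with step show ?thesis by blast
      qed
    qed
  qed
  let ?Q = "\<lambda>(h', v', p'). 1 \<le> h' \<and> h' \<le> length x + 1 \<and>
      (\<exists>f'. v' = v(Flag := f') \<and> accepts {enc_nat k @ w | k w. w \<in> A} A (h, f, p) (h', f', p'))"
  have "wp ?w (h, v(Par := 1, Flag := f), p) (\<lambda>s. wp (expect False) s (\<lambda>s. wp (expect False) s
      (\<lambda>s. wp (If (Eq Par 0) fail skip) s (\<lambda>s. wp (clear Par) s ?Q))))"
  proof (rule loop[OF h])
    fix h1 q :: nat assume h1: "1 \<le> h1" "h1 \<le> length x + 1"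
      and q: "drop (h - 1) x \<in> code_rest ((1::nat) \<noteq> 0) A \<longleftrightarrow> q \<noteq> 0 \<and> drop (h1 - 1) x \<in> ?B"
    have "act (v(Par := q)) (expect False ;; expect False) (accepts ?B A)"
      by (rule act_accepts_Seq act_expect | simp add: assms)+
    then have "wp (expect False ;; expect False) (h1, v(Par := q, Flag := f), p)
      (\<lambda>s. wp (If (Eq Par 0) fail skip) s (\<lambda>s. wp (clear Par) s ?Q))"
    proof (rule actD[OF _ h1])
      fix h2 f2 p2 assume 2: "1 \<le> h2" "h2 \<le> length x + 1" "accepts ?B A (h1, f, p) (h2, f2, p2)"
      have "v(Par := q, Flag := g, Par := 0) = v(Flag := g)" for g
        using assms by (auto simp: fun_eq_iff)
      with 2 q show "wp (If (Eq Par 0) fail skip) (h2, v(Par := q, Flag := f2), p2) (\<lambda>s. wp (clear Par) s ?Q)"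
        using assms L by (auto simp: fail_def accepts_def code_rest_True)
    qed
    then show "wp (expect False) (h1, v(Par := q, Flag := f), p) (\<lambda>s. wp (expect False) s
      (\<lambda>s. wp (If (Eq Par 0) fail skip) s (\<lambda>s. wp (clear Par) s ?Q)))"
      by simp
  qed
  moreover have "v(Flag := f, Par := Suc 0) = v(Par := 1, Flag := f)" by (auto simp: fun_eq_iff)
  ultimately show "wp expect_code (h, v(Flag := f), p) ?Q"
    using assms L by (simp add: expect_code_def)
qed

definition well_formed :: "nat \<Rightarrow> bool" where
  "well_formed n \<longleftrightarrow> (\<exists>k bs cs. length bs = n * n \<and> length cs = n * n \<and>
     x = enc_nat n @ enc_nat n @ enc_nat k @ concat (map enc_bool bs) @ concat (map enc_bool cs))"

lemma act_expect_dim: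
  assumes "tidy v" "v Dim \<le> L"
  shows "act v (for_code expect Dim) (accepts ((@) (enc_nat (v Dim)) ` A) A)"
  by (rule act_mono[OF act_for_code[OF assms(1) _ _ assms(2) act_consumes]]) (auto intro: chain_consumes)

lemma act_check_format:
  assumes "tidy v" "v Row = 0" "v Col = 0" "v Dim \<le> L"
  shows "act v check_format (\<lambda>(h, f, p) (h', f', p'). p' = p \<and> (f' = 0 \<longleftrightarrow> f = 0 \<and> well_formed (v Dim)))"
proof -
  let ?n = "v Dim"
  let ?C = "bool_rows (?n * ?n) {[]}"
  let ?B = "bool_rows (?n * ?n) ?C"
  let ?A = "{enc_nat k @ w | k w. w \<in> ?B}"
  have v: "v 0 = 0" "v Par = 0" using assms(1) by (auto simp: tidy_def)
  have None: "inp x h = None \<longleftrightarrow> drop (h - 1) x = []" if "1 \<le> h" for h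
    by (cases "drop (h - 1) x") (simp_all only: inp_drop[OF that] list.case option.distinct list.distinct simp_thms)
  have e: "act v (If (In None) skip fail) (accepts {[]} UNIV)"
  proof (rule act_If_In[OF act_skip act_fail[of v, OF v(1)]])
    fix h f :: nat and p s' assume h: "1 \<le> h"
    show "accepts {[]} UNIV (h, f, p) s'" if "inp x h = None" "(h, f, p) = s'"
      using that None[OF h] by (auto simp: accepts_def)
    show "accepts {[]} UNIV (h, f, p) s'" if "inp x h \<noteq> None"
        "(case (h, f, p) of (h, f, p) \<Rightarrow> \<lambda>(h', f', p'). f' \<noteq> 0 \<and> p' = p) s'"
      using that None[OF h] by (simp add: accepts_def split: prod.splits)
  qed
  have "act v (for_code expect Dim ;; for_code expect Dim ;; expect_code ;;
     For Row Dim (For Col Dim expect_bool) ;; For Row Dim (For Col Dim expect_bool) ;; If (In None) skip fail)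
     (accepts ((@) (enc_nat ?n) ` (@) (enc_nat ?n) ` ?A) UNIV)" (is "act v ?c (accepts ?S UNIV)")
    by (rule act_accepts_Seq act_expect_dim act_expect_code act_expect_matrix e assms v)+
  moreover have "act v rewind (\<lambda>(h, f, p) (h', f', p'). h' = 1 \<and> f' = f \<and> p' = p)"
    by (rule actI) (auto simp: wp_rewind)
  ultimately have "act v (rewind ;; ?c) (\<lambda>(h, f, p) (h', f', p'). p' = p \<and> (f' = 0 \<longleftrightarrow> f = 0 \<and> x \<in> ?S))"
  proof (elim act_Seq[rotated])
    fix s s' s'' :: "nat \<times> nat \<times> bool list"
    \<comment> \<open>Stated for an arbitrary language: only the head position 1 matters, where the
      rest of the input is all of \<open>x\<close>.\<close>
    have "(\<lambda>(h, f, p) (h', f', p'). p' = p \<and> (f' = 0 \<longleftrightarrow> f = 0 \<and> x \<in> S)) s s''"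
      if "accepts S UNIV s' s''" "(\<lambda>(h, f, p) (h', f', p'). h' = 1 \<and> f' = f \<and> p' = p) s s'" for S
      using that by (auto simp: accepts_def)
    then show "accepts ?S UNIV s' s'' \<Longrightarrow> (\<lambda>(h, f, p) (h', f', p'). h' = 1 \<and> f' = f \<and> p' = p) s s' \<Longrightarrow>
      (\<lambda>(h, f, p) (h', f', p'). p' = p \<and> (f' = 0 \<longleftrightarrow> f = 0 \<and> x \<in> ?S)) s s''" .
  qed
  moreover have "x \<in> ?S \<longleftrightarrow> well_formed ?n"
    unfolding well_formed_def bool_rows_def image_iff
    by (simp only: mem_Collect_eq bex_simps singleton_iff) (metis append_Nil2)
  ultimately show ?thesis by (simp only: check_format_def)
qed

section \<open>Length of the input and search for the dimension\<close>

lemma wp_measure_input: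
  "wp measure_input (0, \<lambda>_. 0, []) Q \<longleftrightarrow> Q (Suc (length x), (\<lambda>_. 0)(Len := length x), [])"
proof -
  have loop: "h \<le> length x \<Longrightarrow>
    wp (While (Not (In None)) (Mv 1 ;; Inc Len)) (Suc h, v(Len := h), p) Q \<longleftrightarrow>
    Q (Suc (length x), v(Len := length x), p)" for h v p
  proof (induction "length x - h" arbitrary: h)
    case 0
    then show ?case by (subst wp_While) (auto simp: inp_def)
  next
    case (Suc d)
    then have "h < length x" by simp
    then show ?case
      using Suc(1)[of "Suc h"] Suc(2) L by (subst wp_While) (auto simp: inp_def)
  qed
  have "(\<lambda>_. 0)(Len := 0) = (\<lambda>_. 0 :: nat)" by auto
  with loop[of 0 "\<lambda>_. 0" "[]"] show ?thesis by (simp add: measure_input_def wp_rewind)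
qed

text \<open>The postcondition does not claim that the code of \<open>n\<close> is a prefix of the
  input, only that no other candidate below the input length can be.\<close>

lemma wp_find_dim:
  assumes "tidy v" "v Len = length x" "v Aux = 0" "v Dim = 0" "v Flag = 0" "h \<le> length x + 1" "1 \<le> h"
    and Q: "\<And>h n. 1 \<le> h \<Longrightarrow> h \<le> length x + 1 \<Longrightarrow> n \<le> length x \<Longrightarrow>
      (\<And>m r. m < length x \<Longrightarrow> x = enc_nat m @ r \<Longrightarrow> n = m) \<Longrightarrow> Q (h, v(Dim := n), p)"
  shows "wp find_dim (h, v, p) Q"
proof -
  \<comment> \<open>After the candidates below \<open>k\<close>, any of them whose code is a prefix
    of the input is the value stored in \<open>Dim\<close>; the flag may hold the outcome of the
    last comparison.\<close>
  define J where "J k w \<longleftrightarrow> (\<exists>f n. w = v(Aux := k, Dim := n, Flag := f) \<and> n \<le> length x \<and>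
    (\<forall>m<k. \<forall>r. x = enc_nat m @ r \<longrightarrow> n = m))" for k w
  let ?I = "\<lambda>k (h, v', p'). p' = p \<and> 1 \<le> h \<and> h \<le> length x + 1 \<and> J k v'"
  have v: "v 0 = 0" using assms(1) by (simp add: tidy_def)
  let ?c = "rewind ;; clear Flag ;; for_code expect Aux ;; If (Eq Flag 0) (Copy Dim Aux) skip"
  have "wp (For Aux Len ?c) (h, v, p) (\<lambda>s. wp (clear Flag) s Q)"
  proof (rule wp_For[where I = ?I and m = "length x"])
    fix k h v' p' assume k: "k < length x" and "?I k (h, v', p')"
    then obtain f n where h: "1 \<le> h" "h \<le> length x + 1" and v': "v' = v(Aux := k, Dim := n, Flag := f)"
      and n: "n \<le> length x" "\<And>m r. m < k \<Longrightarrow> x = enc_nat m @ r \<Longrightarrow> n = m" and p: "p' = p"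
      unfolding J_def by blast
    let ?v = "v(Aux := k, Dim := n)"
    let ?P = "\<lambda>(h, v, p). v Aux = k \<and> ?I (Suc k) (h, v(Aux := Suc k), p)"
    have "act ?v (for_code expect Aux) (chain consumes (enc_nat (?v Aux)))"
      by (rule act_for_code) (use assms(1) k L act_consumes in \<open>auto simp: tidy_def\<close>)
    then have "wp (for_code expect Aux) (1, ?v(Flag := 0), p) (\<lambda>s. wp (If (Eq Flag 0) (Copy Dim Aux) skip) s ?P)"
    proof (rule actD)
      fix h1 f1 p1 assume h1: "1 \<le> h1" "h1 \<le> length x + 1"
        and "chain consumes (enc_nat (?v Aux)) (1, 0, p) (h1, f1, p1)"
      then have "accepts ((@) (enc_nat k) ` UNIV) UNIV (1, 0, p) (h1, f1, p1)"
        using chain_consumes by simp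
      then have p1: "p1 = p" and f1: "f1 = 0 \<longleftrightarrow> (\<exists>r. x = enc_nat k @ r)"
        by (auto simp: accepts_def)
      have k_unique: "m = k" if "f1 = 0" "x = enc_nat m @ r" for m r
        using that f1 prefix_freeD[OF prefix_free_enc_nat] by metis
      have J: "J (Suc k) (v(Aux := Suc k, Dim := if f1 = 0 then k else n, Flag := f1))"
        unfolding J_def
      proof (intro exI conjI allI impI)
        show "(if f1 = 0 then k else n) \<le> length x" using n(1) k by simp
        fix m r assume m: "m < Suc k" and x: "x = enc_nat m @ r"
        show "(if f1 = 0 then k else n) = m"
        proof (cases "f1 = 0")
          case True
          then show ?thesis using k_unique[OF True x] by simp
        next
          case False
          with f1 x have "m \<noteq> k" by blast
          with m n(2)[OF _ x] False show ?thesis by simp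
        qed
      qed (rule refl)
      have "v(Aux := k, Dim := n, Flag := f1, Dim := k, Aux := Suc k) = v(Aux := Suc k, Dim := k, Flag := f1)"
        "v(Aux := k, Dim := n, Flag := f1, Aux := Suc k) = v(Aux := Suc k, Dim := n, Flag := f1)"
        by (auto simp: fun_eq_iff)
      then show "wp (If (Eq Flag 0) (Copy Dim Aux) skip) (h1, ?v(Flag := f1), p1) ?P"
        using h1 p1 v J by (cases "f1 = 0") simp_all
    qed (use h in auto)
    moreover have "v'(Flag := 0) = ?v(Flag := 0)" unfolding v' by (auto simp: fun_eq_iff)
    ultimately show "wp ?c (h, v', p') ?P"
      using h v unfolding p by (simp add: wp_rewind v')
  next
    fix h v' p' assume "?I (length x) (h, v', p')"
    then obtain f n where h: "1 \<le> h" "h \<le> length x + 1" and v': "v' = v(Aux := length x, Dim := n, Flag := f)"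
      and n: "n \<le> length x" "\<And>m r. m < length x \<Longrightarrow> x = enc_nat m @ r \<Longrightarrow> n = m" and p: "p' = p"
      unfolding J_def by blast
    have "v'(Aux := 0, Flag := 0) = v(Dim := n)"
      unfolding v' using assms by (auto simp: fun_eq_iff)
    with Q[OF h n] v show "wp (clear Flag) (h, v'(Aux := 0), p') Q"
      by (simp add: p v')
  next
    have "v(Aux := 0) = v(Aux := 0, Dim := 0, Flag := 0)"
      using assms by (auto simp: fun_eq_iff)
    then have "J 0 (v(Aux := 0))"
      unfolding J_def by (intro exI[of _ 0] conjI) auto
    then show "?I 0 (h, v(Aux := 0), p)" using assms(6,7) by simp
  next
    fix k h v' p' assume "?I k (h, v', p')"
    then show "v' Aux = k \<and> v' Len = length x \<and> v' 0 = 0"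
      using assms(2) v by (auto simp: J_def)
  qed (use assms(2) v L in auto)
  then show ?thesis by (simp add: find_dim_def)
qed

section \<open>Moving the head in an input known to be a code\<close>

definition at_input :: "nat \<Rightarrow> bool list \<Rightarrow> bool" where
  "at_input h ys \<longleftrightarrow> 1 \<le> h \<and> h \<le> length x + 1 \<and> drop (h - 1) x = ys"

lemma inp_at_input: "at_input h (y # ys) \<Longrightarrow> inp x h = Some y"
  by (auto simp: at_input_def inp_drop)

lemma at_input_Cons: "at_input h (y # ys) \<Longrightarrow> h \<le> length x \<and> at_input (Suc h) ys"
  using drop_pred_Cons[of h y ys] by (auto simp: at_input_def)

lemma wp_skip_code:
  assumes "at_input h (enc_nat i @ r)" "\<And>h. at_input h r \<Longrightarrow> Q (h, v, p)"
  shows "wp skip_code (h, v, p) Q"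
proof -
  have loop: "at_input h (concat (map (\<lambda>b. [True, b]) bs) @ False # r) \<Longrightarrow>
    (\<And>h. at_input h (False # r) \<Longrightarrow> Q (h, v, p)) \<Longrightarrow>
    wp (While (In (Some True)) (Mv 1 ;; Mv 1)) (h, v, p) Q" for bs h r Q
  proof (induction bs arbitrary: h)
    case Nil
    then show ?case using inp_at_input[of h False r] by (subst wp_While) auto
  next
    case (Cons b bs)
    let ?r = "concat (map (\<lambda>b. [True, b]) bs) @ False # r"
    have "at_input h (True # b # ?r)" using Cons(2) by simp
    moreover from at_input_Cons[OF this] have "h \<le> length x" "at_input (Suc h) (b # ?r)" by auto
    moreover from at_input_Cons[OF this(2)] have "Suc h \<le> length x" "at_input (Suc (Suc h)) ?r" by auto
    ultimately show ?case using inp_at_input[of h True] Cons(1)[of "Suc (Suc h)"] Cons(3)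
      by (subst wp_While) auto
  qed
  have "wp (While (In (Some True)) (Mv 1 ;; Mv 1)) (h, v, p) (\<lambda>s. wp (Mv 1) s (\<lambda>s. wp (Mv 1) s Q))"
  proof (rule loop)
    fix h assume "at_input h (False # False # r)"
    from at_input_Cons[OF this] have "h \<le> length x" "at_input (Suc h) (False # r)" by auto
    moreover from at_input_Cons[OF this(2)] have "Suc h \<le> length x" "at_input (Suc (Suc h)) r" by auto
    ultimately show "wp (Mv 1) (h, v, p) (\<lambda>s. wp (Mv 1) s Q)" using assms(2) by simp
  qed (use assms(1) in \<open>simp add: enc_nat_def\<close>)
  then show ?thesis by (simp add: skip_code_def)
qed

lemma wp_skip_bool:
  assumes "at_input h (enc_bool b @ r)" "\<And>h. at_input h r \<Longrightarrow> Q (h, v, p)"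
  shows "wp skip_bool (h, v, p) Q"
proof (cases b)
  case True
  then have 1: "at_input h (True # True # False # False # r)" using assms(1) by (simp add: enc_bool_simps)
  from at_input_Cons[OF this] have 2: "h \<le> length x" "at_input (Suc h) (True # False # False # r)" by auto
  from at_input_Cons[OF 2(2)] have 3: "Suc h \<le> length x" "at_input (Suc (Suc h)) (False # False # r)" by auto
  from at_input_Cons[OF 3(2)] have 4: "Suc (Suc h) \<le> length x" "at_input (Suc (Suc (Suc h))) (False # r)" by auto
  from at_input_Cons[OF 4(2)] have 5: "Suc (Suc (Suc h)) \<le> length x" "at_input (Suc (Suc (Suc (Suc h)))) r" by auto
  show ?thesis using inp_at_input[OF 1] 2(1) 3(1) 4(1) 5 assms(2) by (simp add: skip_bool_def)
next
  case False
  then have 1: "at_input h (False # False # r)" using assms(1) by (simp add: enc_bool_simps)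
  from at_input_Cons[OF this] have 2: "h \<le> length x" "at_input (Suc h) (False # r)" by auto
  from at_input_Cons[OF 2(2)] have 3: "Suc h \<le> length x" "at_input (Suc (Suc h)) r" by auto
  show ?thesis using inp_at_input[OF 1] 2(1) 3 assms(2) by (simp add: skip_bool_def)
qed

text \<open>The number of entries is read from a counter \<open>m\<close>, so this serves both for a
  full row, with \<open>Dim\<close>, and for the part of a row to the left of a cell, with
  \<open>Col\<close>.\<close>

lemma wp_skip_row:
  assumes "v 0 = 0" "v Col' = 0" "m < nvars" "m \<noteq> Col'" "v m \<le> L" "length bs = v m"
    and "at_input h (concat (map enc_bool bs) @ r)" "\<And>h. at_input h r \<Longrightarrow> Q (h, v, p)"
  shows "wp (For Col' m skip_bool) (h, v, p) Q"
proof (rule wp_For[where m = "v m" and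
      I = "\<lambda>k (h, v', p'). v' = v(Col' := k) \<and> p' = p \<and> at_input h (concat (map enc_bool (drop k bs)) @ r)"])
  fix k h v' p' assume k: "k < v m"
    and I: "case (h, v', p') of (h, v', p') \<Rightarrow> v' = v(Col' := k) \<and> p' = p \<and> at_input h (concat (map enc_bool (drop k bs)) @ r)"
  from k assms(6) have "drop k bs = bs ! k # drop (Suc k) bs" by (simp add: Cons_nth_drop_Suc)
  with I have "at_input h (enc_bool (bs ! k) @ concat (map enc_bool (drop (Suc k) bs)) @ r)" by simp
  then show "wp skip_bool (h, v', p') (\<lambda>(h, v', p'). v' Col' = k \<and> (case (h, v'(Col' := Suc k), p') of (h, v', p') \<Rightarrow>
      v' = v(Col' := Suc k) \<and> p' = p \<and> at_input h (concat (map enc_bool (drop (Suc k) bs)) @ r)))"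
    by (rule wp_skip_bool) (use I in auto)
next
  fix h v' p' assume I: "case (h, v', p') of (h, v', p') \<Rightarrow> v' = v(Col' := v m) \<and> p' = p \<and> at_input h (concat (map enc_bool (drop (v m) bs)) @ r)"
  moreover have "v(Col' := v m, Col' := 0) = v" using assms(2) by auto
  ultimately show "Q (h, v'(Col' := 0), p')" using assms(6,8) by simp
qed (use assms in auto)

lemma wp_skip_rows:
  assumes "v 0 = 0" "v Col' = 0" "v Row' = 0" "m < nvars" "m \<noteq> Col'" "m \<noteq> Row'" "v m \<le> L" "v Dim \<le> L"
    and "length bs = v m * v Dim" "at_input h (concat (map enc_bool bs) @ r)" "\<And>h. at_input h r \<Longrightarrow> Q (h, v, p)"
  shows "wp (For Row' m (For Col' Dim skip_bool)) (h, v, p) Q"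
proof (rule wp_For[where m = "v m" and
      I = "\<lambda>k (h, v', p'). v' = v(Row' := k) \<and> p' = p \<and> at_input h (concat (map enc_bool (drop (k * v Dim) bs)) @ r)"])
  fix k h v' p' assume k: "k < v m"
    and I: "case (h, v', p') of (h, v', p') \<Rightarrow> v' = v(Row' := k) \<and> p' = p \<and> at_input h (concat (map enc_bool (drop (k * v Dim) bs)) @ r)"
  let ?bs = "take (v Dim) (drop (k * v Dim) bs)"
  have "Suc k * v Dim \<le> length bs" using k assms(9) by (metis Suc_leI mult_le_mono1)
  then have len: "length ?bs = v Dim" by simp
  have "drop (k * v Dim) bs = ?bs @ drop (Suc k * v Dim) bs"
    by (metis append_take_drop_id drop_drop mult_Suc)
  with I have "at_input h (concat (map enc_bool ?bs) @ concat (map enc_bool (drop (Suc k * v Dim) bs)) @ r)"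
    by (metis (no_types, lifting) append.assoc case_prod_conv concat_append map_append)
  then show "wp (For Col' Dim skip_bool) (h, v', p') (\<lambda>(h, v', p'). v' Row' = k \<and> (case (h, v'(Row' := Suc k), p') of (h, v', p') \<Rightarrow>
      v' = v(Row' := Suc k) \<and> p' = p \<and> at_input h (concat (map enc_bool (drop (Suc k * v Dim) bs)) @ r)))"
    by (rule wp_skip_row[rotated 6]) (use I assms len in auto)
next
  fix h v' p' assume I: "case (h, v', p') of (h, v', p') \<Rightarrow> v' = v(Row' := v m) \<and> p' = p \<and> at_input h (concat (map enc_bool (drop (v m * v Dim) bs)) @ r)"
  moreover have "v(Row' := v m, Row' := 0) = v" using assms(3) by auto
  ultimately show "Q (h, v'(Row' := 0), p')" using assms(9,11) by simp
qed (use assms in auto)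

lemma wp_goto_cell:
  assumes "tidy v" "v Dim = n" "v Row < n" "v Col < n" "n \<le> L" "length bs = n * n"
    and "at_input h (concat (map enc_bool bs) @ r)" "\<And>h. inp x h = Some (bs ! (v Row * n + v Col)) \<Longrightarrow> 1 \<le> h \<Longrightarrow> h \<le> length x + 1 \<Longrightarrow> Q (h, v, p)"
  shows "wp goto_cell (h, v, p) Q"
proof -
  let ?t = "v Row * n"
  have t: "?t + v Col < n * n"
  proof -
    have "?t + v Col < Suc (v Row) * n" using assms(4) by simp
    also have "\<dots> \<le> n * n" using assms(3) by (intro mult_le_mono1) simp
    finally show ?thesis .
  qed
  \<comment> \<open>The entries before the wanted one split into the complete rows above it and the
    part of its own row to the left, as the two loops of \<open>goto_cell\<close> pass over
    them.\<close>
  have "bs = take ?t bs @ take (v Col) (drop ?t bs) @ drop (?t + v Col) bs"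
    by (metis append_take_drop_id drop_drop add.commute)
  moreover have "drop (?t + v Col) bs = bs ! (?t + v Col) # drop (Suc (?t + v Col)) bs"
    using t assms(6) by (simp add: Cons_nth_drop_Suc)
  ultimately have "concat (map enc_bool bs) = concat (map enc_bool (take ?t bs)) @ concat (map enc_bool (take (v Col) (drop ?t bs)))
      @ enc_bool (bs ! (?t + v Col)) @ concat (map enc_bool (drop (Suc (?t + v Col)) bs))"
    by (metis (no_types, lifting) concat.simps(2) concat_append list.map(2) map_append)
  with assms(7) have at: "at_input h (concat (map enc_bool (take ?t bs)) @ concat (map enc_bool (take (v Col) (drop ?t bs)))
      @ enc_bool (bs ! (?t + v Col)) @ concat (map enc_bool (drop (Suc (?t + v Col)) bs)) @ r)"
    by simp
  have "wp (For Row' Row (For Col' Dim skip_bool)) (h, v, p) (\<lambda>s. wp (For Col' Col skip_bool) s Q)"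
  proof (rule wp_skip_rows[OF _ _ _ _ _ _ _ _ _ at])
    fix h1 assume at1: "at_input h1 (concat (map enc_bool (take (v Col) (drop ?t bs)))
      @ enc_bool (bs ! (?t + v Col)) @ concat (map enc_bool (drop (Suc (?t + v Col)) bs)) @ r)"
    show "wp (For Col' Col skip_bool) (h1, v, p) Q"
    proof (rule wp_skip_row[OF _ _ _ _ _ _ at1])
      fix h2 assume "at_input h2 (enc_bool (bs ! (?t + v Col)) @ concat (map enc_bool (drop (Suc (?t + v Col)) bs)) @ r)"
      moreover have "\<exists>zs. enc_bool b = b # zs" for b by (cases b) (auto simp: enc_bool_simps)
      ultimately show "Q (h2, v, p)"
        using assms(8) inp_at_input unfolding at_input_def by (metis append_Cons)
    qed (use assms t in \<open>auto simp: tidy_def\<close>)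
  qed (use assms t in \<open>auto simp: tidy_def\<close>)
  then show ?thesis by (simp add: goto_cell_def)
qed

section \<open>Writing the output\<close>

definition emits :: "bool list \<Rightarrow> rel" where
  "emits ys = (\<lambda>(h, f, p) (h', f', p'). f' = f \<and> p' = p @ ys)"

lemma emits_append: "emits ys s s' \<Longrightarrow> emits zs s' s'' \<Longrightarrow> emits (ys @ zs) s s''"
  by (auto simp: emits_def)

lemma act_emits_Seq: "act v c1 (emits ys) \<Longrightarrow> act v c2 (emits zs) \<Longrightarrow> act v (c1 ;; c2) (emits (ys @ zs))"
  by (erule act_Seq, assumption, erule emits_append)

lemma act_Out: "act v (Out b) (emits [b])"
  by (rule actI) (auto simp: emits_def)

lemma act_outs: "act v (outs ys) (emits ys)"
proof (induction ys)
  case Nil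
  have "act v skip (emits [])" by (rule actI) (auto simp: emits_def)
  then show ?case by simp
next
  case (Cons y ys)
  from act_emits_Seq[OF act_Out[of v y] this] show ?case by simp
qed

lemma act_emits_For:
  assumes "i < nvars" "n < nvars" "i \<noteq> n" "i \<noteq> 0" "i \<noteq> Flag" "n \<noteq> Flag" "v 0 = 0" "v i = 0" "v n \<le> L"
    and "\<And>k. k < v n \<Longrightarrow> act (v(i := k)) c (emits (g k))"
  shows "act v (For i n c) (emits (concat (map g [0..<v n])))"
  by (rule act_For[where R = "\<lambda>k. emits (concat (map g [0..<k]))" and K = "\<lambda>k. emits (g k)"])
    (use assms in \<open>auto simp: emits_def\<close>)

lemma chain_emits: "chain (\<lambda>b. emits [b]) ys s s' \<Longrightarrow> emits ys s s'"
proof (induction ys arbitrary: s)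
  case Nil
  then show ?case by (auto simp: emits_def)
next
  case (Cons y ys)
  then obtain s1 where "emits [y] s s1" "emits ys s1 s'" unfolding chain.simps by blast
  from emits_append[OF this] show ?case by simp
qed

lemma act_out_dim:
  assumes "tidy v" "v Row = 0" "v Aux = 0" "v Dim \<le> length x"
  shows "act v out_dim (emits (enc_nat (3 * v Dim)))"
proof (rule actI)
  fix h f p assume h: "1 \<le> h" "h \<le> length x + 1"
  have v: "v 0 = 0" using assms(1) by (simp add: tidy_def)
  let ?Q = "\<lambda>(h', v', p'). 1 \<le> h' \<and> h' \<le> length x + 1 \<and>
    (\<exists>f'. v' = v(Flag := f') \<and> emits (enc_nat (3 * v Dim)) (h, f, p) (h', f', p'))"
  let ?n = "v Dim"
  have "wp (For Row Dim (Inc Aux ;; Inc Aux ;; Inc Aux)) (h, v(Flag := f), p)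
    (\<lambda>s. wp (for_code Out Aux) s (\<lambda>s. wp (clear Aux) s ?Q))"
  \<comment> \<open>\<open>Aux\<close> triples the dimension by counting. It may exceed the input
    length here, up to \<open>3 * length x\<close>, which is still within \<open>L\<close>.\<close>
  proof (rule wp_For[where m = ?n and
      I = "\<lambda>k (h', v', p'). v' = v(Flag := f, Row := k, Aux := 3 * k) \<and> p' = p \<and> h' = h"])
    fix k h' v' p' assume "k < ?n"
      and "case (h', v', p') of (h', v', p') \<Rightarrow> v' = v(Flag := f, Row := k, Aux := 3 * k) \<and> p' = p \<and> h' = h"
    then show "wp (Inc Aux ;; Inc Aux ;; Inc Aux) (h', v', p') (\<lambda>(h', v', p'). v' Row = k \<and>
        (case (h', v'(Row := Suc k), p') of (h', v', p') \<Rightarrow>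
          v' = v(Flag := f, Row := Suc k, Aux := 3 * Suc k) \<and> p' = p \<and> h' = h))"
      using assms L by (auto simp: fun_eq_iff)
  next
    fix h' v' p' assume I: "case (h', v', p') of (h', v', p') \<Rightarrow>
      v' = v(Flag := f, Row := ?n, Aux := 3 * ?n) \<and> p' = p \<and> h' = h"
    let ?v = "v(Aux := 3 * ?n)"
    have "act ?v (for_code Out Aux) (chain (\<lambda>b. emits [b]) (enc_nat (?v Aux)))"
      by (rule act_for_code) (use assms L act_Out in \<open>auto simp: tidy_def\<close>)
    then have "wp (for_code Out Aux) (h, ?v(Flag := f), p) (\<lambda>s. wp (clear Aux) s ?Q)"
    proof (rule actD[OF _ h])
      fix h1 f1 p1 assume "1 \<le> h1" "h1 \<le> length x + 1" "chain (\<lambda>b. emits [b]) (enc_nat (?v Aux)) (h, f, p) (h1, f1, p1)"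
      moreover from chain_emits[OF this(3)] have "emits (enc_nat (3 * ?n)) (h, f, p) (h1, f1, p1)"
        by simp
      moreover have "?v(Flag := f1, Aux := 0) = v(Flag := f1)" using assms(3) by (auto simp: fun_eq_iff)
      ultimately show "wp (clear Aux) (h1, ?v(Flag := f1), p1) ?Q"
        using v by auto
    qed
    moreover have "v(Flag := f, Row := ?n, Aux := 3 * ?n, Row := 0) = ?v(Flag := f)"
      using assms(2) by (auto simp: fun_eq_iff)
    ultimately show "wp (for_code Out Aux) (h', v'(Row := 0), p') (\<lambda>s. wp (clear Aux) s ?Q)"
      using I by simp
  next
    show "case (h, (v(Flag := f))(Row := 0), p) of (h', v', p') \<Rightarrow>
        v' = v(Flag := f, Row := 0, Aux := 3 * 0) \<and> p' = p \<and> h' = h"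
      using assms(3) by (auto simp: fun_eq_iff)
  qed (use assms v L in auto)
  then show "wp out_dim (h, v(Flag := f), p) ?Q" by (simp add: out_dim_def)
qed

lemma act_out_matching_cell:
  "act v (out_matching_cell a b) (emits (enc_bool (v Row = v Col \<and> a + b = 2)))"
  unfolding out_matching_cell_def by (rule act_If) (auto intro: act_outs[THEN act_mono])

text \<open>\<open>r a\<close> writes the three columns of vertex \<open>j\<close> in the row of
  residue \<open>a\<close> of vertex \<open>i\<close>; the three inner loops complete the three rows
  of that vertex.\<close>

lemma act_out_matrix:
  assumes "v 0 = 0" "v Row = 0" "v Col = 0" "v Dim = n" "n \<le> L"
    and cell: "\<And>i j a. i < n \<Longrightarrow> j < n \<Longrightarrow> a < 3 \<Longrightarrow>
      act (v(Row := i, Col := j)) (r a) (emits (e (g (3 * i + a) (3 * j)) @ e (g (3 * i + a) (3 * j + 1)) @ e (g (3 * i + a) (3 * j + 2))))"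
  shows "act v (out_matrix r) (emits (concat (map e (grid (3 * n) (3 * n) g))))"
proof -
  have row: "act (v(Row := i)) (For Col Dim (r a)) (emits (concat (map (\<lambda>q. e (g (3 * i + a) q)) [0..<3 * n])))"
    if "i < n" "a < 3" for i a
  proof -
    have "act (v(Row := i)) (For Col Dim (r a)) (emits (concat (map (\<lambda>j. e (g (3 * i + a) (3 * j)) @
        e (g (3 * i + a) (3 * j + 1)) @ e (g (3 * i + a) (3 * j + 2))) [0..<(v(Row := i)) Dim])))"
      by (rule act_emits_For) (use assms that in auto)
    then show ?thesis using assms(4) by (simp add: concat_map_upt_3)
  qed
  have "act v (out_matrix r) (emits (concat (map (\<lambda>i. concat (map (\<lambda>q. e (g (3 * i + 0) q)) [0..<3 * n]) @
      concat (map (\<lambda>q. e (g (3 * i + 1) q)) [0..<3 * n]) @ concat (map (\<lambda>q. e (g (3 * i + 2) q)) [0..<3 * n])) [0..<v Dim])))"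
    unfolding out_matrix_def
  proof (rule act_emits_For)
    fix i assume i: "i < v Dim"
    show "act (v(Row := i)) (For Col Dim (r 0) ;; For Col Dim (r 1) ;; For Col Dim (r 2))
      (emits (concat (map (\<lambda>q. e (g (3 * i + 0) q)) [0..<3 * n]) @
        concat (map (\<lambda>q. e (g (3 * i + 1) q)) [0..<3 * n]) @ concat (map (\<lambda>q. e (g (3 * i + 2) q)) [0..<3 * n])))"
      by (intro act_emits_Seq row) (use i assms(4) in auto)
  qed (use assms in auto)
  also have "concat (map (\<lambda>i. concat (map (\<lambda>q. e (g (3 * i + 0) q)) [0..<3 * n]) @
      concat (map (\<lambda>q. e (g (3 * i + 1) q)) [0..<3 * n]) @ concat (map (\<lambda>q. e (g (3 * i + 2) q)) [0..<3 * n])) [0..<v Dim])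
      = concat (map (\<lambda>p. concat (map (\<lambda>q. e (g p q)) [0..<3 * n])) [0..<3 * n])"
    using assms(4) by (simp add: concat_map_upt_3[of "\<lambda>p. concat (map (\<lambda>q. e (g p q)) [0..<3 * n])"])
  also have "\<dots> = concat (map e (grid (3 * n) (3 * n) g))"
  proof -
    have "concat (concat (map F xs)) = concat (map (\<lambda>p. concat (F p)) xs)" for F :: "nat \<Rightarrow> bool list list" and xs
      by (induction xs) auto
    then show ?thesis unfolding concat_grid[symmetric] unfolding grid_def by (rule sym)
  qed
  finally show ?thesis .
qed

end

text \<open>Only \<open>n\<close> is bounded by the length of the input, because only
  \<open>n\<close> is held in a counter; \<open>k\<close> is met solely as a code in the
  input.\<close>

locale encoded_run = bounded_run +
  fixes n k :: nat and bs cs :: "bool list"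
  assumes x: "x = enc_nat n @ enc_nat n @ enc_nat k @ concat (map enc_bool bs) @ concat (map enc_bool cs)"
    and length_bs: "length bs = n * n" and length_cs: "length cs = n * n"
    and n_le: "n \<le> length x"
begin

lemma wp_goto_k:
  assumes "h \<le> length x + 1"
    and "\<And>h. at_input h (enc_nat k @ concat (map enc_bool bs) @ concat (map enc_bool cs)) \<Longrightarrow> Q (h, v, p)"
  shows "wp rewind (h, v, p) (\<lambda>s. wp skip_code s (\<lambda>s. wp skip_code s Q))"
proof -
  have "at_input 1 (enc_nat n @ enc_nat n @ enc_nat k @ concat (map enc_bool bs) @ concat (map enc_bool cs))"
    unfolding at_input_def by (intro conjI, simp, simp, simp only: diff_self_eq_0 drop_0) (rule x)
  then show ?thesis using assms by (simp add: wp_rewind) (intro wp_skip_code[of _ n])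
qed

lemma act_copy_k: "act v copy_k (emits (enc_nat k))"
proof (rule actI)
  fix h f p assume h: "1 \<le> h" "h \<le> length x + 1"
  let ?v = "v(Flag := f)"
  let ?w = "While (In (Some True)) (Out True ;; Mv 1 ;; If (In (Some True)) (Out True) (Out False) ;; Mv 1)"
  have loop: "at_input h (concat (map (\<lambda>b. [True, b]) bs) @ False # r) \<Longrightarrow>
    (\<And>h. 1 \<le> h \<Longrightarrow> h \<le> length x + 1 \<Longrightarrow> Q (h, ?v, p @ concat (map (\<lambda>b. [True, b]) bs))) \<Longrightarrow>
    wp ?w (h, ?v, p) Q" for bs h p r Q
  proof (induction bs arbitrary: h p)
    case Nil
    have at: "at_input h (False # r)" using Nil(1) by simp
    have "wp ?w (h, ?v, p) Q \<longleftrightarrow> Q (h, ?v, p)"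
      using inp_at_input[OF at] by (subst wp_While) auto
    moreover have "Q (h, ?v, p)"
      by (rule Nil(2)[unfolded list.map concat.simps append_Nil2]) (use at in \<open>auto simp: at_input_def\<close>)
    ultimately show ?case by blast
  next
    case (Cons b bs)
    let ?r = "concat (map (\<lambda>b. [True, b]) bs) @ False # r"
    have 1: "at_input h (True # b # ?r)" using Cons(2) by simp
    from at_input_Cons[OF this] have 2: "h \<le> length x" "at_input (Suc h) (b # ?r)" by auto
    from at_input_Cons[OF this(2)] have 3: "Suc h \<le> length x" "at_input (Suc (Suc h)) ?r" by auto
    have "wp ?w (Suc (Suc h), ?v, p @ [True, b]) Q"
      by (rule Cons(1)[OF 3(2)]) (use Cons(3) in simp)
    then show ?case using inp_at_input[OF 1] inp_at_input[OF 2(2)] 2(1) 3(1)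
      by (subst wp_While) auto
  qed
  let ?Q = "\<lambda>(h', v', p'). 1 \<le> h' \<and> h' \<le> length x + 1 \<and> (\<exists>f'. v' = v(Flag := f') \<and> emits (enc_nat k) (h, f, p) (h', f', p'))"
  have "wp rewind (h, ?v, p) (\<lambda>s. wp skip_code s (\<lambda>s. wp skip_code s (\<lambda>s. wp ?w s
      (\<lambda>s. wp (Out False) s (\<lambda>s. wp (Out False) s ?Q)))))"
    by (rule wp_goto_k[OF h(2)], rule loop) (auto simp: enc_nat_def emits_def)
  then show "wp copy_k (h, ?v, p) ?Q" by (simp add: copy_k_def)
qed

lemma wp_read_bit:
  assumes "i < nvars" "i \<noteq> Flag" "v i = 0" "inp x h = Some b" "h \<le> length x + 1"
  shows "wp (If (In (Some True)) (Inc i) skip) (h, v(Flag := f), p) Q \<longleftrightarrow> Q (h, v(i := of_bool b, Flag := f), p)"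
proof (cases b)
  case True
  have "v(Flag := f, i := Suc 0) = v(i := Suc 0, Flag := f)" using assms(2) by (rule fun_upd_twist[OF not_sym])
  with True assms L show ?thesis by simp
next
  case False
  have "v(i := 0) = v" using assms(3) by (rule fun_upd_idem)
  with False assms show ?thesis by (simp del: wp_simps(1-5))
qed

text \<open>The body starts wherever the second look-up left the head, so its effect must not depend
  on the initial head position.\<close>

lemma act_with_cell:
  assumes v: "tidy v" "v IsE = 0" "v IsR = 0" "v Dim = n" "v Row < n" "v Col < n"
    and c: "act (v(IsE := of_bool (bs ! (v Row * n + v Col)), IsR := of_bool (cs ! (v Row * n + v Col)))) c K"
    and K: "\<And>h h' f p s. K (h, f, p) s \<Longrightarrow> K (h', f, p) s"
  shows "act v (with_cell c) K"
proof (rule actI)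
  fix h f p assume h: "1 \<le> h" "h \<le> length x + 1"
  let ?t = "v Row * n + v Col"
  let ?v1 = "v(IsE := of_bool (bs ! ?t))"
  let ?v2 = "v(IsE := of_bool (bs ! ?t), IsR := of_bool (cs ! ?t))"
  let ?Q = "\<lambda>(h', v', p'). 1 \<le> h' \<and> h' \<le> length x + 1 \<and> (\<exists>f'. v' = v(Flag := f') \<and> K (h, f, p) (h', f', p'))"
  let ?cl = "\<lambda>s. wp c s (\<lambda>s. wp (clear IsE) s (\<lambda>s. wp (clear IsR) s ?Q))"
  have v0: "v 0 = 0" using v(1) by (simp add: tidy_def)
  have nL: "n \<le> L" using n_le L by simp
  \<comment> \<open>The pieces are verified from the last to the first, each with the weakest
    precondition of all that follows as its postcondition.\<close>
  have 4: "?cl (h1, ?v2(Flag := f), p)" if h1: "1 \<le> h1" "h1 \<le> length x + 1" for h1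
  proof (rule actD[OF c h1])
    fix h2 f2 p2 assume "1 \<le> h2" "h2 \<le> length x + 1" "K (h1, f, p) (h2, f2, p2)"
    moreover from K[OF this(3)] have "K (h, f, p) (h2, f2, p2)" .
    moreover have "?v2(Flag := f2, IsE := 0, IsR := 0) = v(Flag := f2)" using v by (auto simp: fun_eq_iff)
    ultimately show "wp (clear IsE) (h2, ?v2(Flag := f2), p2) (\<lambda>s. wp (clear IsR) s ?Q)"
      using v0 by auto
  qed
  have 3: "wp goto_cell (h1, ?v1(Flag := f), p) (\<lambda>s. wp (If (In (Some True)) (Inc IsR) skip) s ?cl)"
    if "at_input h1 (concat (map enc_bool cs))" for h1
  proof (rule wp_goto_cell[where n = n and bs = cs and r = "[]"])
    fix h2 assume 2: "inp x h2 = Some (cs ! ((?v1(Flag := f)) Row * n + (?v1(Flag := f)) Col))" "1 \<le> h2" "h2 \<le> length x + 1"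
    show "wp (If (In (Some True)) (Inc IsR) skip) (h2, ?v1(Flag := f), p) ?cl"
      by (subst wp_read_bit[OF _ _ _ 2(1,3)]) (use v 4[OF 2(2,3)] in simp_all)
  qed (use v that length_cs nL in \<open>auto simp: tidy_def\<close>)
  have 2: "wp rewind (h1, ?v1(Flag := f), p) (\<lambda>s. wp skip_code s (\<lambda>s. wp skip_code s (\<lambda>s. wp skip_code s
      (\<lambda>s. wp (For Row' Dim (For Col' Dim skip_bool)) s (\<lambda>s. wp goto_cell s
        (\<lambda>s. wp (If (In (Some True)) (Inc IsR) skip) s ?cl))))))" if "h1 \<le> length x + 1" for h1
  proof (rule wp_goto_k[OF that], erule wp_skip_code)
    fix h2 assume at: "at_input h2 (concat (map enc_bool bs) @ concat (map enc_bool cs))"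
    show "wp (For Row' Dim (For Col' Dim skip_bool)) (h2, ?v1(Flag := f), p) (\<lambda>s. wp goto_cell s
        (\<lambda>s. wp (If (In (Some True)) (Inc IsR) skip) s ?cl))"
      by (rule wp_skip_rows[OF _ _ _ _ _ _ _ _ _ at]; (rule 3, assumption)?)
        (use v length_bs nL in \<open>auto simp: tidy_def\<close>)
  qed
  have 1: "wp goto_cell (h1, v(Flag := f), p) (\<lambda>s. wp (If (In (Some True)) (Inc IsE) skip) s
      (\<lambda>s. wp rewind s (\<lambda>s. wp skip_code s (\<lambda>s. wp skip_code s (\<lambda>s. wp skip_code s
      (\<lambda>s. wp (For Row' Dim (For Col' Dim skip_bool)) s (\<lambda>s. wp goto_cell s
        (\<lambda>s. wp (If (In (Some True)) (Inc IsR) skip) s ?cl))))))))"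
    if "at_input h1 (concat (map enc_bool bs) @ concat (map enc_bool cs))" for h1
  proof (rule wp_goto_cell[where n = n and bs = bs])
    fix h2 assume 3: "inp x h2 = Some (bs ! ((v(Flag := f)) Row * n + (v(Flag := f)) Col))" "1 \<le> h2" "h2 \<le> length x + 1"
    show "wp (If (In (Some True)) (Inc IsE) skip) (h2, v(Flag := f), p)
      (\<lambda>s. wp rewind s (\<lambda>s. wp skip_code s (\<lambda>s. wp skip_code s (\<lambda>s. wp skip_code s
      (\<lambda>s. wp (For Row' Dim (For Col' Dim skip_bool)) s (\<lambda>s. wp goto_cell s
        (\<lambda>s. wp (If (In (Some True)) (Inc IsR) skip) s ?cl)))))))"
      by (subst wp_read_bit[OF _ _ _ 3(1,3)]) (use v 2[OF 3(3)] in simp_all)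
  qed (use v that length_bs nL in \<open>auto simp: tidy_def\<close>)
  have "wp rewind (h, v(Flag := f), p) (\<lambda>s. wp skip_code s (\<lambda>s. wp skip_code s (\<lambda>s. wp skip_code s
      (\<lambda>s. wp goto_cell s (\<lambda>s. wp (If (In (Some True)) (Inc IsE) skip) s
      (\<lambda>s. wp rewind s (\<lambda>s. wp skip_code s (\<lambda>s. wp skip_code s (\<lambda>s. wp skip_code s
      (\<lambda>s. wp (For Row' Dim (For Col' Dim skip_bool)) s (\<lambda>s. wp goto_cell s
        (\<lambda>s. wp (If (In (Some True)) (Inc IsR) skip) s ?cl))))))))))))"
    by (rule wp_goto_k[OF h(2)], erule wp_skip_code, rule 1)
  then show "wp (with_cell c) (h, v(Flag := f), p) ?Q"
    unfolding with_cell_def wp_simps(5) .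
qed

lemma act_check_red:
  assumes "tidy v" "v IsE = 0" "v IsR = 0" "v Dim = n" "v Row = 0" "v Col = 0"
  shows "act v check_red (\<lambda>(h, f, p) (h', f', p'). p' = p \<and>
    (f' = 0 \<longleftrightarrow> f = 0 \<and> (\<forall>i<n. \<forall>j<n. cs ! (i * n + j) \<longrightarrow> bs ! (i * n + j))))"
proof -
  \<comment> \<open>Effects of this form compose by conjunction, so the nested loops accumulate the
    bounded quantifiers.\<close>
  define test :: "bool \<Rightarrow> rel" where
    "test b = (\<lambda>(h, f, p) (h', f', p'). p' = p \<and> (f' = 0 \<longleftrightarrow> f = 0 \<and> b))" for b
  define sub where "sub i j \<longleftrightarrow> (cs ! (i * n + j) \<longrightarrow> bs ! (i * n + j))" for i j
  have nL: "n \<le> L" using n_le L by simp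
  have v0: "v 0 = 0" using assms(1) by (simp add: tidy_def)
  have cell: "act (v(Row := i, Col := j)) (with_cell (If (Eq IsR 0) skip (If (Eq IsE 0) fail skip))) (test (sub i j))"
    if "i < n" "j < n" for i j
  proof (rule act_with_cell)
    let ?v = "v(Row := i, Col := j)"
    let ?w = "?v(IsE := of_bool (bs ! (?v Row * n + ?v Col)), IsR := of_bool (cs ! (?v Row * n + ?v Col)))"
    have s: "act w skip (test True)" for w
      by (rule act_mono[OF act_skip]) (auto simp: test_def)
    have f: "act ?w fail (test False)"
      by (rule act_mono[OF act_fail]) (use v0 in \<open>auto simp: test_def\<close>)
    show "act ?w (If (Eq IsR 0) skip (If (Eq IsE 0) fail skip)) (test (sub i j))"
      by (intro act_If) (use s f v0 in \<open>auto simp: sub_def\<close>)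
  qed (use that assms in \<open>auto simp: tidy_def test_def\<close>)
  have trans: "test P s s' \<Longrightarrow> test Q s' s'' \<Longrightarrow> test (P \<and> Q) s s''" for P Q s s' s''
    by (auto simp: test_def)
  have row: "act (v(Row := i)) (For Col Dim (with_cell (If (Eq IsR 0) skip (If (Eq IsE 0) fail skip))))
      (test (\<forall>j<(v(Row := i)) Dim. sub i j))" if "i < n" for i
  proof (rule act_For[where R = "\<lambda>m. test (\<forall>j<m. sub i j)" and K = "\<lambda>j. test (sub i j)"])
    show "test (\<forall>j<m. sub i j) s s' \<Longrightarrow> test (sub i m) s' s'' \<Longrightarrow> test (\<forall>j<Suc m. sub i j) s s''" for m s s' s''
      using trans[of "\<forall>j<m. sub i j" s s' "sub i m" s''] by (simp add: less_Suc_eq all_conj_distrib imp_conjL[symmetric] disj_imp test_def) (auto simp: less_Suc_eq)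
  qed (use assms cell that nL v0 in \<open>auto simp: test_def\<close>)
  have "act v check_red (test (\<forall>i<v Dim. \<forall>j<n. sub i j))"
    unfolding check_red_def
  proof (rule act_For[where R = "\<lambda>m. test (\<forall>i<m. \<forall>j<n. sub i j)" and K = "\<lambda>i. test (\<forall>j<n. sub i j)"])
    show "test (\<forall>i<m. \<forall>j<n. sub i j) s s' \<Longrightarrow> test (\<forall>j<n. sub m j) s' s'' \<Longrightarrow> test (\<forall>i<Suc m. \<forall>j<n. sub i j) s s''" for m s s' s''
      by (auto simp: test_def less_Suc_eq)
  qed (use assms row nL v0 in \<open>auto simp: test_def\<close>)
  then show ?thesis using assms(4) by (simp add: test_def sub_def)
qed

lemma act_out_cost_cell:
  assumes "v 0 = 0" "v IsE = of_bool ((v Row, v Col) \<in> E)" "v IsR = of_bool ((v Row, v Col) \<in> R)"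
  shows "act v (out_cost_cell a b) (emits (enc_cost (cell_cost E R k (v Row) a (v Col) b)))"
proof -
  have "bits (Suc (2 * k)) = True # bits k" using bits_pos[of "Suc (2 * k)"] by simp
  moreover have "nat (2 * int k + 1) = Suc (2 * k)" by simp
  ultimately have eq: "enc_cost (Some (2 * int k + 1)) = (enc_nat 1 @ enc_nat 0 @ [True, True]) @ enc_nat k"
    by (simp add: enc_cost_def enc_int_def) (simp add: enc_nat_def)
  have big: "act v (outs (enc_nat 1 @ enc_nat 0 @ [True, True]) ;; copy_k) (emits (enc_cost (Some (2 * int k + 1))))"
    unfolding eq by (rule act_emits_Seq[OF act_outs act_copy_k])
  note o = act_outs[of v "enc_cost _"]
  let ?c = "\<lambda>P c. emits (enc_cost (if P then Some c else None))"
  have 1: "act v (If (Eq IsR 0) (outs (enc_cost None)) (outs (enc_cost (Some 1)))) (?c ((v Row, v Col) \<in> R) 1)"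
    by (rule act_If) (use assms o in \<open>simp_all split: if_splits\<close>)
  have 2: "act v (If (Eq IsE 0) (outs (enc_cost None))
      (If (Eq IsR 0) (outs (enc_cost (Some 0))) (outs (enc_cost None)))) (?c ((v Row, v Col) \<in> E - R) 0)"
    by (rule act_If, simp, simp, simp, simp, use assms o in \<open>simp split: if_splits\<close>, rule act_If)
      (use assms o in \<open>simp_all split: if_splits\<close>)
  have 3: "act v (If (Eq Row Col) (outs (enc_cost (Some 0))) (outs (enc_cost None))) (?c (v Row = v Col) 0)"
    by (rule act_If) (use o in simp_all)
  have 4: "act v (If (Eq Row Col) (outs (enc_nat 1 @ enc_nat 0 @ [True, True]) ;; copy_k) (outs (enc_cost None)))
      (?c (v Row = v Col) (2 * int k + 1))"
    by (rule act_If) (use o big in simp_all)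
  show ?thesis
  proof (cases "b = 0 \<and> a = 0")
    case True
    show ?thesis unfolding out_cost_cell_def cell_cost_def if_P[OF True] by (rule 1)
  next
    case F1: False
    show ?thesis
    proof (cases "b = 0 \<and> a = 1")
      case True
      show ?thesis unfolding out_cost_cell_def cell_cost_def if_not_P[OF F1] if_P[OF True] by (rule 2)
    next
      case F2: False
      show ?thesis
      proof (cases "b = 1 \<and> a \<noteq> 2 \<or> b = 2 \<and> a = 2")
        case True
        show ?thesis
          unfolding out_cost_cell_def cell_cost_def if_not_P[OF F1] if_not_P[OF F2] if_P[OF True] by (rule 3)
      next
        case F3: False
        show ?thesis
          unfolding out_cost_cell_def cell_cost_def if_not_P[OF F1] if_not_P[OF F2] if_not_P[OF F3]
          using 4 o by (cases "a + b = 2") (simp_all only: if_True if_False refl)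
      qed
    qed
  qed
qed

lemma act_out_instance:
  assumes "tidy v" "v IsE = 0" "v IsR = 0" "v Dim = n" "v Row = 0" "v Col = 0" "v Aux = 0"
    and E: "\<And>i j. i < n \<Longrightarrow> j < n \<Longrightarrow> (i, j) \<in> E \<longleftrightarrow> bs ! (i * n + j)"
    and R: "\<And>i j. i < n \<Longrightarrow> j < n \<Longrightarrow> (i, j) \<in> R \<longleftrightarrow> cs ! (i * n + j)"
  shows "act v out_instance (emits (enc_RA (3 * n) (ra_matching n) (ra_cost n E R k) k (int k)))"
proof -
  have v0: "v 0 = 0" using assms(1) by (simp add: tidy_def)
  have nL: "n \<le> L" using n_le L by simp
  have dm: "(3 * i + a) div 3 = i" "(3 * i + a) mod 3 = a" if "a < 3" for i a :: nat
    using that by auto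
  have dim: "act v out_dim (emits (enc_nat (3 * n)))"
    using act_out_dim[of v] assms n_le by simp
  have matching: "act v (out_matrix (\<lambda>a. out_matching_cell a 0 ;; out_matching_cell a 1 ;; out_matching_cell a 2))
      (emits (concat (map enc_bool (grid (3 * n) (3 * n) (\<lambda>p q. (p, q) \<in> ra_matching n)))))"
  proof (rule act_out_matrix)
    fix i j a :: nat assume ij: "i < n" "j < n" "a < 3"
    have "((3 * i + a, 3 * j + b) \<in> ra_matching n) = (i = j \<and> a + b = 2)" if "b < 3" for b
      using ij that by (auto simp: ra_matching_def dm)
    from this[of 0] this[of 1] this[of 2]
    show "act (v(Row := i, Col := j)) (out_matching_cell a 0 ;; out_matching_cell a 1 ;; out_matching_cell a 2)
      (emits (enc_bool ((3 * i + a, 3 * j) \<in> ra_matching n) @ enc_bool ((3 * i + a, 3 * j + 1) \<in> ra_matching n) @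
        enc_bool ((3 * i + a, 3 * j + 2) \<in> ra_matching n)))"
      using act_emits_Seq[OF act_out_matching_cell act_emits_Seq[OF act_out_matching_cell act_out_matching_cell],
          of "v(Row := i, Col := j)" a 0 a 1 a 2]
      by simp
  qed (use assms v0 nL in auto)
  have cost: "act v (out_matrix (\<lambda>a. with_cell (out_cost_cell a 0 ;; out_cost_cell a 1 ;; out_cost_cell a 2)))
      (emits (concat (map enc_cost (grid (3 * n) (3 * n) (ra_cost n E R k)))))"
  proof (rule act_out_matrix)
    fix i j a :: nat assume ij: "i < n" "j < n" "a < 3"
    let ?v = "v(Row := i, Col := j)"
    have c: "ra_cost n E R k (3 * i + a) (3 * j + b) = cell_cost E R k i a j b" if "b < 3" for b
      using ij that by (auto simp: ra_cost_def dm)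
    show "act ?v (with_cell (out_cost_cell a 0 ;; out_cost_cell a 1 ;; out_cost_cell a 2))
      (emits (enc_cost (ra_cost n E R k (3 * i + a) (3 * j)) @ enc_cost (ra_cost n E R k (3 * i + a) (3 * j + 1)) @
        enc_cost (ra_cost n E R k (3 * i + a) (3 * j + 2))))"
    proof (rule act_with_cell)
      let ?w = "?v(IsE := of_bool (bs ! (?v Row * n + ?v Col)), IsR := of_bool (cs ! (?v Row * n + ?v Col)))"
      have "act ?w (out_cost_cell a b) (emits (enc_cost (cell_cost E R k i a j b)))" for b
        using act_out_cost_cell[of ?w E R a b] E[OF ij(1,2)] R[OF ij(1,2)] v0 by simp
      then have "act ?w (out_cost_cell a b) (emits (enc_cost (ra_cost n E R k (3 * i + a) (3 * j + b))))" if "b < 3" for b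
        using c[OF that] by simp
      from this[of 0] this[of 1] this[of 2]
      show "act ?w (out_cost_cell a 0 ;; out_cost_cell a 1 ;; out_cost_cell a 2)
        (emits (enc_cost (ra_cost n E R k (3 * i + a) (3 * j)) @ enc_cost (ra_cost n E R k (3 * i + a) (3 * j + 1)) @
        enc_cost (ra_cost n E R k (3 * i + a) (3 * j + 2))))"
        by (intro act_emits_Seq) simp_all
    qed (use assms ij in \<open>auto simp: tidy_def emits_def\<close>)
  qed (use assms v0 nL in auto)
  have "enc_int (int k) = enc_nat 0 @ enc_nat k" by (simp add: enc_int_def)
  then have eq: "enc_RA (3 * n) (ra_matching n) (ra_cost n E R k) k (int k) = enc_nat (3 * n) @ enc_nat k @ enc_nat 0 @ enc_nat k @
      concat (map enc_bool (grid (3 * n) (3 * n) (\<lambda>p q. (p, q) \<in> ra_matching n))) @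
      concat (map enc_cost (grid (3 * n) (3 * n) (ra_cost n E R k)))"
    unfolding enc_RA_grid by simp
  show ?thesis
    unfolding out_instance_def eq
    by (intro act_emits_Seq dim act_copy_k act_outs matching cost)
qed

end

section \<open>Correctness of the whole program\<close>

context bounded_run
begin

lemma wp_reduction: "wp reduction (0, \<lambda>_. 0, []) (\<lambda>(h, v, p). reduces_to x p)"
proof -
  let ?Q = "\<lambda>(h, v :: nat \<Rightarrow> nat, p). reduces_to x p"
  let ?rest = "\<lambda>s. wp (If (Eq Flag 0) (check_red ;; If (Eq Flag 0) out_instance skip) skip) s ?Q"
  let ?v0 = "(\<lambda>_. 0 :: nat)(Len := length x)"
  have "wp find_dim (Suc (length x), ?v0, []) (\<lambda>s. wp check_format s ?rest)"
  proof (rule wp_find_dim)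
    fix h n assume h: "1 \<le> h" "h \<le> length x + 1" and n: "n \<le> length x"
      and unique: "\<And>m r. m < length x \<Longrightarrow> x = enc_nat m @ r \<Longrightarrow> n = m"
    define w where "w = ?v0(Dim := n)"
    have v: "tidy w" "w Dim = n" "w IsE = 0" "w IsR = 0" "w Row = 0" "w Col = 0" "w Aux = 0" "w 0 = 0"
      by (simp_all add: tidy_def w_def)
    \<comment> \<open>The code of \<open>m\<close> is a prefix of the input and \<open>m\<close> is
      below its length, so the search has found it.\<close>
    have dim: "m = n" if "x = enc_EM m m E R k" for m E R k
      using unique[of m] less_length_enc_EM[of m E R k] that by (auto simp: enc_EM_grid)
    have format: "act w check_format (\<lambda>(h, f, p) (h', f', p'). p' = p \<and> (f' = 0 \<longleftrightarrow> f = 0 \<and> well_formed n))"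
      using act_check_format[OF v(1,5,6)] v(2) n L by simp
    have "wp check_format (h, w(Flag := 0), []) ?rest"
    proof (rule actD[OF format h])
      fix h1 f1 :: nat and p1 :: "bool list" assume h1: "1 \<le> h1" "h1 \<le> length x + 1"
        and K: "(\<lambda>(h, f, p) (h', f', p'). p' = p \<and> (f' = 0 \<longleftrightarrow> f = 0 \<and> well_formed n)) (h, 0, []) (h1, f1, p1)"
      then have p1: "p1 = []" and f1: "f1 = 0 \<longleftrightarrow> well_formed n" by auto
      have v1: "(w(Flag := f1)) Flag = f1" "(w(Flag := f1)) 0 = 0" using v(8) by simp_all
      show "?rest (h1, w(Flag := f1), p1)"
      proof (cases "well_formed n")
        case False
        have wf: "well_formed n" if "x = enc_EM m m E R k" for m E R k
        proof -
          have "x = enc_EM n n E R k" using that dim[OF that] by blast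
          note x = this[unfolded enc_EM_grid]
          show ?thesis
            unfolding well_formed_def
            by (rule exI[of _ k], rule exI[of _ "grid n n (\<lambda>i j. (i, j) \<in> E)"],
                rule exI[of _ "grid n n (\<lambda>i j. (i, j) \<in> R)"]) (intro conjI length_grid, rule x)
        qed
        have "reduces_to x []"
          unfolding reduces_to_def
          by (intro disjI2 conjI refl notI, elim exE conjE) (rule notE[OF False wf])
        with False h1 p1 f1 v1 show ?thesis by (simp only: wp_simps) simp
      next
        case True
        then obtain k bs cs where len: "length bs = n * n" "length cs = n * n"
          and enc: "x = enc_nat n @ enc_nat n @ enc_nat k @ concat (map enc_bool bs) @ concat (map enc_bool cs)"
          unfolding well_formed_def by blast
        interpret encoded_run x L n k bs cs
          by unfold_locales (rule enc, rule len, rule len, rule n)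
        define E where "E = {(i, j). i < n \<and> j < n \<and> bs ! (i * n + j)}"
        define R where "R = {(i, j). i < n \<and> j < n \<and> cs ! (i * n + j)}"
        let ?sub = "\<forall>i<n. \<forall>j<n. cs ! (i * n + j) \<longrightarrow> bs ! (i * n + j)"
        have "wp check_red (h1, w(Flag := f1), []) (\<lambda>s. wp (If (Eq Flag 0) out_instance skip) s ?Q)"
        proof (rule actD[OF act_check_red[OF v(1,3,4,2,5,6)] h1])
          fix h2 f2 :: nat and p2 :: "bool list" assume h2: "1 \<le> h2" "h2 \<le> length x + 1"
            and K: "(\<lambda>(h, f, p) (h', f', p'). p' = p \<and> (f' = 0 \<longleftrightarrow> f = 0 \<and> ?sub)) (h1, f1, []) (h2, f2, p2)"
          then have p2: "p2 = []" and f2: "f2 = 0 \<longleftrightarrow> ?sub" using f1 True by auto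
          show "wp (If (Eq Flag 0) out_instance skip) (h2, w(Flag := f2), p2) ?Q"
          proof (cases ?sub)
            case False
            \<comment> \<open>By prefix-freeness the bit lists \<open>bs\<close> and
              \<open>cs\<close> are determined by the input, so an instance with this code and
              \<open>R' \<subseteq> E'\<close> would pass the check that just failed.\<close>
            have sub: "?sub" if "x = enc_EM m m E' R' k'" "R' \<subseteq> E'" for m E' R' k'
            proof -
              have "x = enc_EM n n E' R' k'" using that(1) dim[OF that(1)] by simp
              with enc have "concat (map enc_bool bs) @ concat (map enc_bool cs) =
                concat (map enc_bool (grid n n (\<lambda>i j. (i, j) \<in> E'))) @ concat (map enc_bool (grid n n (\<lambda>i j. (i, j) \<in> R')))"
                unfolding enc_EM_grid by (metis prefix_freeD[OF prefix_free_enc_nat])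
              then have "bs = grid n n (\<lambda>i j. (i, j) \<in> E')" "cs = grid n n (\<lambda>i j. (i, j) \<in> R')"
                using len concat_prefix_free[OF prefix_free_enc_bool, of cs "grid n n (\<lambda>i j. (i, j) \<in> R')" "[]" "[]"]
                by (auto simp: concat_prefix_free[OF prefix_free_enc_bool])
              then show ?sub using that(2) by (auto simp: grid_nth)
            qed
            have "reduces_to x []"
              unfolding reduces_to_def
              by (intro disjI2 conjI refl notI, elim exE conjE) (rule notE[OF False sub])
            moreover have "f2 \<noteq> 0" using False f2 by blast
            ultimately show ?thesis using h2 p2 v(8) by simp
          next
            case sub: True
            have EM: "x = enc_EM n n E R k"
            proof -
              have "grid n n (\<lambda>i j. (i, j) \<in> E) = grid n n (\<lambda>i j. bs ! (i * n + j))"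
                "grid n n (\<lambda>i j. (i, j) \<in> R) = grid n n (\<lambda>i j. cs ! (i * n + j))"
                unfolding grid_eq_iff by (simp_all add: E_def R_def)
              then have g: "grid n n (\<lambda>i j. (i, j) \<in> E) = bs" "grid n n (\<lambda>i j. (i, j) \<in> R) = cs"
                unfolding grid_nth_eq[OF len(1)] grid_nth_eq[OF len(2)] by blast+
              show ?thesis unfolding enc_EM_grid g by (rule enc)
            qed
            have act: "act w out_instance (emits (enc_RA (3 * n) (ra_matching n) (ra_cost n E R k) k (int k)))"
              by (rule act_out_instance[OF v(1,3,4,2,5,6,7)]) (auto simp: E_def R_def)
            have "reduces_to x (enc_RA (3 * n) (ra_matching n) (ra_cost n E R k) k (int k))"
              unfolding reduces_to_def
              by (rule disjI1, rule exI[of _ n], rule exI[of _ E], rule exI[of _ R], rule exI[of _ k], intro conjI EM refl)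
                (use sub in \<open>auto simp: E_def R_def\<close>)
            then have "wp out_instance (h2, w(Flag := f2), p2) ?Q"
              by (intro actD[OF act h2]) (auto simp: emits_def p2)
            moreover have "f2 = 0" using sub f2 by blast
            ultimately show ?thesis using v(8) by simp
          qed
        qed
        with True f1 p1 v1 show ?thesis by (simp only: wp_simps) simp
      qed
    qed
    moreover have "w(Flag := 0) = w" by (simp add: fun_eq_iff w_def)
    ultimately show "wp check_format (h, w, []) ?rest" by (simp only: w_def)
  qed (auto simp: tidy_def)
  then show ?thesis by (simp add: reduction_def wp_measure_input)
qed

end

theorem theorem11:
  shows "logspace_reducible ExactMatching RecovAP_decision"
proof -
  let ?M = "compile reduction" and ?L = "\<lambda>x :: bool list. 3 * length x + 1"
  \<comment> \<open>The machine is the same for all inputs; the bound \<open>?L x\<close> enters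
    only the analysis of its runs.\<close>
  have "\<exists>y. reduces_to x y \<and> (\<exists>h v. exec (?L x) x reduction (0, \<lambda>_. 0, []) (h, v, y))" for x
  proof -
    interpret bounded_run x "?L x" by unfold_locales simp
    from wp_reduction show ?thesis unfolding wp_def by blast
  qed
  then obtain f where f: "\<And>x. reduces_to x (f x)"
      "\<And>x. \<exists>h v. exec (?L x) x reduction (0, \<lambda>_. 0, []) (h, v, f x)"
    by metis
  \<comment> \<open>For the least \<open>K\<close>,
    \<open>2 ^ (K - 1) \<le> 3 * length x + 1\<close>, which is at most
    \<open>4 * (length x + 2)\<close>; hence \<open>K\<close> is at most 3 plus the logarithm. The
    latter is at least 1 thanks to the summand 2, so the factor 4 absorbs the 3.\<close>
  have width: "\<exists>K. 1 \<le> K \<and> ?L x < 2 ^ K \<and> real K \<le> 4 * log 2 (real (length x) + 2)" for x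
  proof -
    define K where "K = (LEAST K. ?L x < 2 ^ K)"
    have less: "?L x < 2 ^ K"
      unfolding K_def by (rule LeastI[of _ "?L x"]) (rule less_exp)
    then have K: "1 \<le> K" by (cases K) auto
    then have "\<not> ?L x < 2 ^ (K - 1)"
      unfolding K_def by (intro not_less_Least) (simp add: K_def[symmetric])
    then have "(2::real) ^ (K - 1) \<le> real (?L x)"
      by (metis not_less of_nat_le_iff of_nat_numeral of_nat_power)
    then have "real (K - 1) \<le> log 2 (real (?L x))"
      by (intro le_log_of_power) auto
    also have "\<dots> \<le> log 2 (4 * (real (length x) + 2))"
      by (subst log_le_cancel_iff) auto
    also have "\<dots> = 2 + log 2 (real (length x) + 2)"
    proof -
      have "log 2 (4::real) = 2" using log_pow_cancel[of 2 2] by simp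
      then show ?thesis by (subst log_mult) auto
    qed
    finally have "real K \<le> 3 + log 2 (real (length x) + 2)" using K by simp
    moreover have "1 \<le> log 2 (real (length x) + 2)" by (subst le_log_iff) auto
    ultimately have "real K \<le> 4 * log 2 (real (length x) + 2)" by linarith
    with K less show ?thesis by blast
  qed
  have "computes ?M f"
    unfolding computes_def using compile_run(1) f(2) width by metis
  moreover have "logspace_bounded ?M"
    unfolding logspace_bounded_def
  proof (intro exI allI)
    fix x t
    obtain K where K: "1 \<le> K" "?L x < 2 ^ K" "real K \<le> 4 * log 2 (real (length x) + 2)"
      using width by blast
    obtain h v where "exec (?L x) x reduction (0, \<lambda>_. 0, []) (h, v, f x)" using f(2) by blast
    from compile_run(2)[OF this K(2,1), of t] K(3)
    show "real (cfg_work_head (run ?M x t)) \<le> 4 * log 2 (real (length x) + 2)" by linarith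
  qed
  ultimately show ?thesis
    unfolding logspace_reducible_def using compile_wf reduces_to_correct f(1) by blast
qed

end
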